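(* Let $m\ge 3$ and let $\theta\in\mathbb{R}$ be the true ability parameter in a computerized adaptive test with response revision based on the nominal response model, with any item selection strategy and any revision strategy. If $I_{\tau_n}(\theta)/n$ converges in probability under $\mathsf{P}_\theta$ as $n\to\infty$, then $$\sqrt{I_{\tau_n}(\hat\theta_{\tau_n})}\,(\hat\theta_{\tau_n}-\theta)\to\mathcal{N}(0,1).$$ This is true in particular when the information-maximizing item selection strategy $$\mathbf{b}_{i+1}\in\operatorname*{argmax}_{\mathbf{b}\in\mathbb{B}}J(\hat\theta_{\tau_i};\mathbf{b}),\qquad i\ge1,$$ is used and the number of revisions is much smaller than the number of items, in the sense that $\tau_n-n=o_p(n)$ (i.e. $(\tau_n-n)/n\to0$ in $\mathsf{P}_\theta$-probability), in which case we have $$\sqrt n\,(\hat\theta_{\tau_n}-\theta)\to\mathcal{N}\bigl(0,[J^*(\theta)]^{-1}\bigr),$$ where $J^*(\theta)=\sup_{\mathbf{b}\in\mathbb{B}}J(\theta;\mathbf{b})$. The convergences to normal laws are in distribution under $\mathsf{P}_\theta$ as $n\to\infty$.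
   Context: Nominal response model. Fix an integer $m\ge 3$ (number of categories). An item is characterized by real numbers $a_1,\dots,a_m,c_1,\dots,c_m$ with $\sum_{k=1}^m a_k=\sum_{k=1}^m c_k=0$, $\sum_{k=1}^m|a_k|\ne 0$ and $\sum_{k=1}^m|c_k|\neq 0$; it is identified with $\mathbf{b}=(a_2,\dots,a_m,c_2,\dots,c_m)\in\mathbb{R}^{2m-2}$ (so $a_1=-\sum_{k\ge2}a_k$, $c_1=-\sum_{k\ge2}c_k$). For $\theta\in\mathbb{R}$ set $p_k(\theta;\mathbf{b})=\exp(a_k\theta+c_k)/\sum_{h=1}^m\exp(a_h\theta+c_h)$. For a sequence $x_{1:j}=(x_1,\dots,x_j)$ of distinct categories, $0\le j\le m-2$ (empty if $j=0$), let $A=\{1,\dots,m\}\setminus\{x_1,\dots,x_j\}$ and define, for $k\in A$, $$p_k(\theta;\mathbf{b}\mid x_{1:j})=\frac{p_k(\theta;\mathbf{b})}{\sum_{h\in A}p_h(\theta;\mathbf{b})},\quad \bar a(\theta;\mathbf{b}\mid x_{1:j})=\sum_{h\in A}a_h\,p_h(\theta;\mathbf{b}\mid x_{1:j}),$$ $$s(\theta;\mathbf{b},k\mid x_{1:j})=a_k-\bar a(\theta;\mathbf{b}\mid x_{1:j}),\quad J(\theta;\mathbf{b}\mid x_{1:j})=\sum_{k\in A}\bigl(a_k-\bar a(\theta;\mathbf{b}\mid x_{1:j})\bigr)^2p_k(\theta;\mathbf{b}\mid x_{1:j}).$$ For $j=0$ write $s(\theta;\mathbf{b},k)$ and $J(\theta;\mathbf{b})$.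 All item vectors lie in a fixed nonempty compact set $\mathbb{B}\subset\mathbb{R}^{2m-2}$, each element $(a_2,\dots,a_m,c_2,\dots,c_m)$ of which, with $a_1=-\sum_{k\ge2}a_k$ and $c_1=-\sum_{k\ge2}c_k$, satisfies $\sum_{k=1}^m|a_k|\ne0$ and $\sum_{k=1}^m|c_k|\ne0$. CAT with revision. Responses (first answers and revisions) are indexed by $t=1,2,\dots$. After $t$ responses, $f_t$ is the number of distinct items administered ($f_1=1$) and $g_t^i$ is the number of responses so far on item $i\in\{1,\dots,f_t\}$. Each item may be revised at most $m-2$ times, so $1\le g_t^i\le m-1$; $C_t=\{i\le f_t: g_t^i<m-1\}$ is the set of items that can still be revised. The examinee's decision after the $t$-th response is a random variable $d_t\in\{0\}\cup C_t$: $d_t=0$ means that response $t+1$ is the first response to a new item (item $f_t+1$), and $d_t=i\in C_t$ means that it is a revision of item $i$; $d_t=0$ if $C_t=\emptyset$. The (otherwise arbitrary) sequence $(d_t)$ is the revision strategy. $X^i_j$ is the category chosen at the $j$-th attempt on item $i$, and $X^i_{1:j}=(X^i_1,\dots,X^i_j)$; previous answers to the same item cannot be repeated. Let $\mathcal{F}_t=\sigma\bigl(f_1,\dots,f_t,d_1,\dots,d_t,\;X^i_{1:g^i_t},\,1\le i\le f_t\bigr)$ and let $\mathcal F_0$ be trivial. For $n\ge1$ let $\tau_n=\min\{t\ge1: f_t=n\text{ and }d_t=0\}$, an $\{\mathcal{F}_t\}$-stopping time with $n\le\tau_n\le(m-1)n$. An item selection strategy is a sequence $(\mathbf{b}_i)$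 of $\mathbb{B}$-valued random vectors with $\mathbf{b}_{i+1}$ being $\mathcal{F}_{\tau_i}$-measurable for $i\ge1$ and $\mathbf{b}_1$ deterministic; $\mathbf{b}_i$ characterizes item $i$. Model under $\mathsf{P}_\theta$: conditionally on $\mathcal{F}_{t}$, the $(t+1)$-th response has probability mass function $k\mapsto p_k(\theta;\mathbf{b}_{f_t+1})$ if it is the first response to a new item ($t=0$, with $f_0=0$, or $d_t=0$), and $k\mapsto p_k(\theta;\mathbf{b}_i\mid X^i_{1:g_t^i})$ on the remaining categories if $d_t=i\in C_t$. The law of the decisions is not otherwise specified. Score and information: for $\vartheta\in\mathbb{R}$, $$S_t(\vartheta)=\sum_{i=1}^{f_t}\Bigl[s(\vartheta;\mathbf{b}_i,X^i_1)+\sum_{j=2}^{g_t^i}s(\vartheta;\mathbf{b}_i,X^i_j\mid X^i_{1:j-1})\Bigr],$$ $$I_t(\vartheta)=\sum_{i=1}^{f_t}J(\vartheta;\mathbf{b}_i)+I_t^R(\vartheta),\quad I^R_t(\vartheta)=\sum_{i=1}^{f_t}\sum_{j=2}^{g^i_t}J(\vartheta;\mathbf{b}_i\mid X^i_{1:j-1}).$$ Estimator: $\hat\theta_t$ is $\mathcal{F}_t$-measurable and is the (unique) root of $S_t(\cdot)$ whenever a root exists; when no root exists (which can only occur in an initial phase of the test) it is given by some arbitrary $\mathcal{F}_t$-measurable initialization rule. *)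

theory Defs
  imports "HOL-Probability.Probability"
begin

section \<open>Nominal response model\<close>

text \<open>
  The finite type \<open>'k\<close> indexes the categories \<open>2, \<dots>, m\<close>, so that \<open>CARD('k) = m - 1\<close>;
  the set of all \<open>m\<close> categories is \<open>'k option\<close>, where \<open>None\<close> is category \<open>1\<close>.  An item
  \<open>(a\<^sub>2, \<dots>, a\<^sub>m, c\<^sub>2, \<dots>, c\<^sub>m)\<close> is a vector of dimension \<open>2 m - 2\<close>: the \<open>a\<close>-coordinates are
  those at \<open>Inl k\<close>, the \<open>c\<close>-coordinates those at \<open>Inr k\<close>.
\<close>

type_synonym 'k item = "real ^ ('k + 'k)"

definition item_a :: "'k::finite item \<Rightarrow> 'k option \<Rightarrow> real" where
  "item_a b k = (case k of None \<Rightarrow> - (\<Sum>l\<in>UNIV. b $ Inl l) | Some l \<Rightarrow> b $ Inl l)"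

definition item_c :: "'k::finite item \<Rightarrow> 'k option \<Rightarrow> real" where
  "item_c b k = (case k of None \<Rightarrow> - (\<Sum>l\<in>UNIV. b $ Inr l) | Some l \<Rightarrow> b $ Inr l)"

definition nrm_prob :: "real \<Rightarrow> 'k::finite item \<Rightarrow> 'k option \<Rightarrow> real" where
  "nrm_prob \<theta> b k =
     exp (item_a b k * \<theta> + item_c b k) / (\<Sum>h\<in>UNIV. exp (item_a b h * \<theta> + item_c b h))"

text \<open>In the following, \<open>x\<close> is the list of the previous answers to the item.\<close>

definition nrm_cond_prob :: "real \<Rightarrow> 'k::finite item \<Rightarrow> 'k option list \<Rightarrow> 'k option \<Rightarrow> real" where
  "nrm_cond_prob \<theta> b x k = nrm_prob \<theta> b k / (\<Sum>h\<in>- set x. nrm_prob \<theta> b h)"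

definition nrm_abar :: "real \<Rightarrow> 'k::finite item \<Rightarrow> 'k option list \<Rightarrow> real" where
  "nrm_abar \<theta> b x = (\<Sum>h\<in>- set x. item_a b h * nrm_cond_prob \<theta> b x h)"

definition nrm_s :: "real \<Rightarrow> 'k::finite item \<Rightarrow> 'k option list \<Rightarrow> 'k option \<Rightarrow> real" where
  "nrm_s \<theta> b x k = item_a b k - nrm_abar \<theta> b x"

definition nrm_J :: "real \<Rightarrow> 'k::finite item \<Rightarrow> 'k option list \<Rightarrow> real" where
  "nrm_J \<theta> b x = (\<Sum>k\<in>- set x. (item_a b k - nrm_abar \<theta> b x)\<^sup>2 * nrm_cond_prob \<theta> b x k)"


section \<open>Adaptive testing with revision\<close>

text \<open>
  The quantities \<open>f\<^sub>t\<close>, \<open>g\<^sub>t\<^sup>i\<close> and \<open>C\<^sub>t\<close> along one realization \<open>\<delta>\<close> of the decisions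
  \<open>d\<^sub>1, d\<^sub>2, \<dots>\<close>.  The first response is always the first answer to item \<open>1\<close>, so the value
  \<open>\<delta> 0\<close> is never used.
\<close>

definition new_item :: "(nat \<Rightarrow> nat) \<Rightarrow> nat \<Rightarrow> bool" where
  "new_item \<delta> t \<longleftrightarrow> t = 0 \<or> \<delta> t = 0"

primrec num_items :: "(nat \<Rightarrow> nat) \<Rightarrow> nat \<Rightarrow> nat" where
  "num_items \<delta> 0 = 0"
| "num_items \<delta> (Suc t) = num_items \<delta> t + (if new_item \<delta> t then 1 else 0)"

text \<open>The item to which response \<open>t + 1\<close> refers.\<close>

definition next_item :: "(nat \<Rightarrow> nat) \<Rightarrow> nat \<Rightarrow> nat" where
  "next_item \<delta> t = (if new_item \<delta> t then num_items \<delta> t + 1 else \<delta> t)"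

primrec attempts :: "(nat \<Rightarrow> nat) \<Rightarrow> nat \<Rightarrow> nat \<Rightarrow> nat" where
  "attempts \<delta> 0 i = 0"
| "attempts \<delta> (Suc t) i = attempts \<delta> t i + (if next_item \<delta> t = i then 1 else 0)"

definition revisable :: "nat \<Rightarrow> (nat \<Rightarrow> nat) \<Rightarrow> nat \<Rightarrow> nat set" where
  "revisable m \<delta> t = {i \<in> {1..num_items \<delta> t}. attempts \<delta> t i < m - 1}"

definition tau :: "(nat \<Rightarrow> 'w \<Rightarrow> nat) \<Rightarrow> nat \<Rightarrow> 'w \<Rightarrow> nat" where
  "tau d n \<omega> = (LEAST t. 1 \<le> t \<and> num_items (\<lambda>u. d u \<omega>) t = n \<and> d t \<omega> = 0)"

text \<open>
  \<open>X i j\<close> is the category chosen at the \<open>j\<close>-th attempt on item \<open>i\<close>, with \<open>i, j \<ge> 1\<close>; its value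
  is irrelevant where that attempt never takes place.  \<open>answers X i j\<close> is \<open>X\<^sup>i\<^sub>1\<^sub>:\<^sub>j\<close>.
\<close>

definition answers :: "(nat \<Rightarrow> nat \<Rightarrow> 'w \<Rightarrow> 'c) \<Rightarrow> nat \<Rightarrow> nat \<Rightarrow> 'w \<Rightarrow> 'c list" where
  "answers X i j \<omega> = map (\<lambda>l. X i l \<omega>) [1..<Suc j]"

text \<open>
  \<open>\<F>\<^sub>t\<close> is generated by the level sets of discrete random variables.  For \<open>i > f\<^sub>t\<close> there are no
  attempts yet and the list of answers is empty, so letting \<open>i\<close> range over all items adds no
  information.
\<close>

definition hist_algebra ::
  "'w measure \<Rightarrow> (nat \<Rightarrow> 'w \<Rightarrow> nat) \<Rightarrow> (nat \<Rightarrow> nat \<Rightarrow> 'w \<Rightarrow> 'c) \<Rightarrow> nat \<Rightarrow> 'w measure" where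
  "hist_algebra M d X t = sigma (space M)
     ({{\<omega> \<in> space M. num_items (\<lambda>u. d u \<omega>) s = l} | s l. s \<in> {1..t}} \<union>
      {{\<omega> \<in> space M. d s \<omega> = l} | s l. s \<in> {1..t}} \<union>
      {{\<omega> \<in> space M. answers X i (attempts (\<lambda>u. d u \<omega>) t i) \<omega> = xs} | i xs. 1 \<le> i})"

text \<open>Response \<open>t + 1\<close>.\<close>

definition response :: "(nat \<Rightarrow> 'w \<Rightarrow> nat) \<Rightarrow> (nat \<Rightarrow> nat \<Rightarrow> 'w \<Rightarrow> 'c) \<Rightarrow> nat \<Rightarrow> 'w \<Rightarrow> 'c" where
  "response d X t \<omega> =
     (let i = next_item (\<lambda>u. d u \<omega>) t in X i (attempts (\<lambda>u. d u \<omega>) t i + 1) \<omega>)"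

text \<open>
  The probability measure \<open>M\<close> is \<open>P\<^sub>\<theta>\<close>.
\<close>

locale cat_revision = prob_space M
  for M :: "'w measure" +
  fixes m :: nat and \<theta> :: real
    and B :: "('k::finite) item set"
    and b :: "nat \<Rightarrow> 'w \<Rightarrow> 'k item"
    and d :: "nat \<Rightarrow> 'w \<Rightarrow> nat"
    and X :: "nat \<Rightarrow> nat \<Rightarrow> 'w \<Rightarrow> 'k option"
  assumes m_eq: "m = CARD('k option)" and m_ge: "3 \<le> m"
    and B_compact: "compact B" and B_nonempty: "B \<noteq> {}"
    and B_a: "\<And>v. v \<in> B \<Longrightarrow> (\<Sum>k\<in>UNIV. \<bar>item_a v k\<bar>) \<noteq> 0"
    and B_c: "\<And>v. v \<in> B \<Longrightarrow> (\<Sum>k\<in>UNIV. \<bar>item_c v k\<bar>) \<noteq> 0"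
    and d_measurable: "\<And>t. 1 \<le> t \<Longrightarrow> d t \<in> measurable M (count_space UNIV)"
    and X_measurable: "\<And>i j. 1 \<le> i \<Longrightarrow> 1 \<le> j \<Longrightarrow> X i j \<in> measurable M (count_space UNIV)"
    and d_range: "\<And>t \<omega>. 1 \<le> t \<Longrightarrow> \<omega> \<in> space M \<Longrightarrow>
        d t \<omega> \<in> {0} \<union> revisable m (\<lambda>u. d u \<omega>) t"
    and X_distinct: "\<And>t i \<omega>. \<omega> \<in> space M \<Longrightarrow> 1 \<le> i \<Longrightarrow>
        distinct (answers X i (attempts (\<lambda>u. d u \<omega>) t i) \<omega>)"
    and b_range: "\<And>i \<omega>. 1 \<le> i \<Longrightarrow> \<omega> \<in> space M \<Longrightarrow> b i \<omega> \<in> B"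
    and b_first: "\<exists>v. \<forall>\<omega>\<in>space M. b 1 \<omega> = v"
    and b_measurable: "\<And>i. 1 \<le> i \<Longrightarrow>
        b (Suc i) \<in> borel_measurable
          (filtration.pre_sigma (space M) (hist_algebra M d X) (tau d i))"
    and first_answer: "\<And>t k. AE \<omega> in M. new_item (\<lambda>u. d u \<omega>) t \<longrightarrow>
        real_cond_exp M (hist_algebra M d X t)
          (indicator {\<omega>' \<in> space M. response d X t \<omega>' = k}) \<omega> =
        nrm_prob \<theta> (b (num_items (\<lambda>u. d u \<omega>) t + 1) \<omega>) k"
    and revision: "\<And>t i k. 1 \<le> t \<Longrightarrow> 1 \<le> i \<Longrightarrow> AE \<omega> in M. d t \<omega> = i \<longrightarrow>
        k \<notin> set (answers X i (attempts (\<lambda>u. d u \<omega>) t i) \<omega>) \<longrightarrow>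
        real_cond_exp M (hist_algebra M d X t)
          (indicator {\<omega>' \<in> space M. response d X t \<omega>' = k}) \<omega> =
        nrm_cond_prob \<theta> (b i \<omega>) (answers X i (attempts (\<lambda>u. d u \<omega>) t i) \<omega>) k"


section \<open>Score and information\<close>

definition score ::
  "(nat \<Rightarrow> 'w \<Rightarrow> 'k::finite item) \<Rightarrow> (nat \<Rightarrow> 'w \<Rightarrow> nat) \<Rightarrow> (nat \<Rightarrow> nat \<Rightarrow> 'w \<Rightarrow> 'k option) \<Rightarrow>
   nat \<Rightarrow> real \<Rightarrow> 'w \<Rightarrow> real" where
  "score b d X t \<theta> \<omega> =
     (\<Sum>i = 1..num_items (\<lambda>u. d u \<omega>) t.
        nrm_s \<theta> (b i \<omega>) [] (X i 1 \<omega>) +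
        (\<Sum>j = 2..attempts (\<lambda>u. d u \<omega>) t i.
           nrm_s \<theta> (b i \<omega>) (answers X i (j - 1) \<omega>) (X i j \<omega>)))"

definition info_rev ::
  "(nat \<Rightarrow> 'w \<Rightarrow> 'k::finite item) \<Rightarrow> (nat \<Rightarrow> 'w \<Rightarrow> nat) \<Rightarrow> (nat \<Rightarrow> nat \<Rightarrow> 'w \<Rightarrow> 'k option) \<Rightarrow>
   nat \<Rightarrow> real \<Rightarrow> 'w \<Rightarrow> real" where
  "info_rev b d X t \<theta> \<omega> =
     (\<Sum>i = 1..num_items (\<lambda>u. d u \<omega>) t. \<Sum>j = 2..attempts (\<lambda>u. d u \<omega>) t i.
        nrm_J \<theta> (b i \<omega>) (answers X i (j - 1) \<omega>))"

definition info ::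
  "(nat \<Rightarrow> 'w \<Rightarrow> 'k::finite item) \<Rightarrow> (nat \<Rightarrow> 'w \<Rightarrow> nat) \<Rightarrow> (nat \<Rightarrow> nat \<Rightarrow> 'w \<Rightarrow> 'k option) \<Rightarrow>
   nat \<Rightarrow> real \<Rightarrow> 'w \<Rightarrow> real" where
  "info b d X t \<theta> \<omega> =
     (\<Sum>i = 1..num_items (\<lambda>u. d u \<omega>) t. nrm_J \<theta> (b i \<omega>) []) + info_rev b d X t \<theta> \<omega>"

text \<open>
  The estimator is only constrained at those realizations at which the score has a root; elsewhere
  it is an arbitrary measurable function of the history.
\<close>

locale cat_estimator = cat_revision M m \<theta> B b d X
  for M :: "'w measure" and m \<theta> and B :: "('k::finite) item set" and b d X +
  fixes \<theta>hat :: "nat \<Rightarrow> 'w \<Rightarrow> real"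
  assumes estimator_measurable: "\<And>t. 1 \<le> t \<Longrightarrow> \<theta>hat t \<in> borel_measurable (hist_algebra M d X t)"
    and estimator_root: "\<And>t \<omega>. 1 \<le> t \<Longrightarrow> \<omega> \<in> space M \<Longrightarrow> \<exists>\<xi>. score b d X t \<xi> \<omega> = 0 \<Longrightarrow>
        score b d X t (\<theta>hat t \<omega>) \<omega> = 0"


section \<open>Convergence in probability\<close>

definition tendsto_in_prob :: "'w measure \<Rightarrow> (nat \<Rightarrow> 'w \<Rightarrow> real) \<Rightarrow> ('w \<Rightarrow> real) \<Rightarrow> bool" where
  "tendsto_in_prob M Z L \<longleftrightarrow>
     (\<forall>\<epsilon>>0. (\<lambda>n. measure M {\<omega> \<in> space M. \<epsilon> < \<bar>Z n \<omega> - L \<omega>\<bar>}) \<longlonglongrightarrow> 0)"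

text \<open>The limit may be random.\<close>

definition converges_in_prob :: "'w measure \<Rightarrow> (nat \<Rightarrow> 'w \<Rightarrow> real) \<Rightarrow> bool" where
  "converges_in_prob M Z \<longleftrightarrow> (\<exists>L \<in> borel_measurable M. tendsto_in_prob M Z L)"

end

theory Submission
  imports Defs "HOL-Real_Asymp.Real_Asymp"
begin

text \<open>
  At the true ability the score is a martingale with bounded increments whose predictable variation
  is the information \<open>I\<close>.  For bounded predictable weights \<open>H\<close> the compensated exponential
  \<open>exp (\<i> \<Sum> H \<Delta>S + (1/2) \<Sum> H\<^sup>2 \<Delta>I)\<close> has expectation \<open>1 + O(n |H|\<^sup>3)\<close>.  The limit of \<open>I / n\<close> may be
  random, but it is approximated by the information of the first \<open>n powr (1/4)\<close> items; weighting
  only the later increments with this value keeps the weights predictable, loses a part of the score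
  that is negligible against \<open>\<surd>n\<close>, and makes the compensator asymptotically constant.  This gives the
  normal limit of \<open>S / \<surd>I\<close> at the stopping times \<open>\<tau>\<^sub>n\<close> without stable convergence.

  The score is decreasing in the ability with derivative \<open>- I\<close>, and near the true ability \<open>I\<close> is at
  least a constant multiple of the number of items.  With Chebyshev's inequality for
  \<open>S / n\<close> this localizes the root, so the estimator is consistent for every strategy; the mean value
  theorem transfers the normal limit.
  Under maximization of the information, consistency and equicontinuity of \<open>J\<close> make the average
  information of the items converge to its maximum.
\<close>

section \<open>Combinatorics of the decisions\<close>

text \<open>The obstacle is the random limit of \<open>I / n\<close>. The compensated exponential
  has expectation close to one, but its factor \<open>exp (Q / 2)\<close> can be taken out of the
  expectation only when the compensator \<open>Q\<close> has a constant limit. Dividing by the final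
  information would produce such a constant and destroy predictability. The early proxy resolves the
  conflict: all responses up to \<open>tau d N\<close> occur before the deterministic time
  \<open>(m - 1) * N\<close>, so their information is known from then on, and as \<open>N\<close>
  grows with \<open>n\<close> it has the same limit as \<open>I / n\<close>.

  The error bound fits the scaling: there are at most \<open>(m - 1) * n\<close> steps, each with a
  third-order error of size \<open>n powr (- 3 / 2)\<close>. The random horizon
  \<open>tau d n\<close> enters through the 0-1 weights \<open>t < tau d n \<omega>\<close> on a
  deterministic range.

  The information of an item vanishes as the ability tends to infinity, so the score is steep only
  near \<theta>; its monotonicity takes care of distant roots.\<close>

definition valid_decisions :: "nat \<Rightarrow> (nat \<Rightarrow> nat) \<Rightarrow> bool" where
  "valid_decisions m \<delta> \<longleftrightarrow> 3 \<le> m \<and> (\<forall>t\<ge>1. \<delta> t \<in> {0} \<union> revisable m \<delta> t)"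

lemma num_items_Suc_0 [simp]: "num_items \<delta> (Suc 0) = 1"
  by (simp add: new_item_def)

lemma num_items_mono: "s \<le> t \<Longrightarrow> num_items \<delta> s \<le> num_items \<delta> t"
  by (induction rule: dec_induct) auto

lemma num_items_le: "num_items \<delta> t \<le> t"
  by (induction t) auto

lemma revision_revisable:
  "valid_decisions m \<delta> \<Longrightarrow> \<not> new_item \<delta> t \<Longrightarrow> \<delta> t \<in> revisable m \<delta> t"
  unfolding valid_decisions_def new_item_def by (metis One_nat_def Suc_leI UnE bot_nat_0.not_eq_extremum singletonD)

text \<open>The count is taken at \<open>Suc t\<close> because an item opened by response
  \<open>t + 1\<close> is included only then.\<close>

lemma next_item_range:
  assumes "valid_decisions m \<delta>"
  shows "next_item \<delta> t \<in> {1..num_items \<delta> (Suc t)}"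
  using revision_revisable[OF assms, of t] by (cases "new_item \<delta> t")
    (auto simp: next_item_def revisable_def)

text \<open>Both cases go through one induction: a newly opened item has exactly one attempt only
  because it had none while it was outside the range. The bound \<open>3 \<le> m\<close> makes this
  first attempt admissible.\<close>

lemma attempts_range:
  assumes "valid_decisions m \<delta>"
  shows "if i \<in> {1..num_items \<delta> t} then attempts \<delta> t i \<in> {1..m - 1} else attempts \<delta> t i = 0"
proof (induction t)
  case (Suc t)
  show ?case
  proof (cases "new_item \<delta> t")
    case True
    then show ?thesis using Suc assms by (auto simp: next_item_def valid_decisions_def split: if_splits)
  next
    case False
    then have "\<delta> t \<in> revisable m \<delta> t"
      by (rule revision_revisable[OF assms])
    then show ?thesis using Suc False by (auto simp: next_item_def revisable_def split: if_splits)
  qed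
qed simp

lemma attempts_eq_0:
  "valid_decisions m \<delta> \<Longrightarrow> i \<notin> {1..num_items \<delta> t} \<Longrightarrow> attempts \<delta> t i = 0"
  using attempts_range[of m \<delta> i t] by simp

lemma attempts_bounds:
  "valid_decisions m \<delta> \<Longrightarrow> i \<in> {1..num_items \<delta> t} \<Longrightarrow> attempts \<delta> t i \<in> {1..m - 1}"
  using attempts_range[of m \<delta> i t] by simp

lemma attempts_new_item:
  "valid_decisions m \<delta> \<Longrightarrow> new_item \<delta> t \<Longrightarrow> attempts \<delta> t (next_item \<delta> t) = 0"
  by (rule attempts_eq_0) (auto simp: next_item_def)

lemma attempts_next_item_less:
  assumes "valid_decisions m \<delta>"
  shows "attempts \<delta> t (next_item \<delta> t) < m - 1"
proof (cases "new_item \<delta> t")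
  case True
  then show ?thesis using attempts_new_item[OF assms True] assms by (auto simp: valid_decisions_def)
next
  case False
  then show ?thesis using revision_revisable[OF assms False] by (auto simp: next_item_def revisable_def)
qed

text \<open>Each pair of an item and an attempt number is realized by exactly one response. This
  turns the double sums in score and information into sums over time, to which a filtration
  applies.\<close>

lemma sum_attempts:
  fixes h :: "nat \<Rightarrow> nat \<Rightarrow> 'a::comm_monoid_add"
  assumes "valid_decisions m \<delta>"
  shows "(\<Sum>i = 1..num_items \<delta> T. \<Sum>j = 1..attempts \<delta> T i. h i j) =
    (\<Sum>t<T. h (next_item \<delta> t) (Suc (attempts \<delta> t (next_item \<delta> t))))"
proof (induction T)
  case (Suc T)
  let ?n = "next_item \<delta> T"
  have n: "?n \<in> {1..num_items \<delta> (Suc T)}" by (rule next_item_range[OF assms])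
  have "(\<Sum>i = 1..num_items \<delta> (Suc T). \<Sum>j = 1..attempts \<delta> (Suc T) i. h i j) =
     (\<Sum>i = 1..num_items \<delta> (Suc T). (\<Sum>j = 1..attempts \<delta> T i. h i j) +
        (if i = ?n then h i (Suc (attempts \<delta> T i)) else 0))"
    by (intro sum.cong) (auto simp: add.commute)
  also have "\<dots> = (\<Sum>i = 1..num_items \<delta> (Suc T). \<Sum>j = 1..attempts \<delta> T i. h i j) +
      h ?n (Suc (attempts \<delta> T ?n))"
    using n by (simp add: sum.distrib sum.delta)
  also have "(\<Sum>i = 1..num_items \<delta> (Suc T). \<Sum>j = 1..attempts \<delta> T i. h i j) =
      (\<Sum>i = 1..num_items \<delta> T. \<Sum>j = 1..attempts \<delta> T i. h i j)"
    by (rule sum.mono_neutral_right) (auto simp: attempts_eq_0[OF assms])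
  finally show ?case using Suc.IH by simp
qed simp

lemma le_num_items:
  assumes "valid_decisions m \<delta>"
  shows "T \<le> (m - 1) * num_items \<delta> T"
proof -
  \<comment> \<open>With constant summand 1 the reindexing counts the responses.\<close>
  have "T = (\<Sum>i = 1..num_items \<delta> T. attempts \<delta> T i)"
    using sum_attempts[OF assms, where h = "\<lambda>_ _. 1::nat" and T = T] by simp
  also have "\<dots> \<le> (\<Sum>i = 1..num_items \<delta> T. m - 1)"
    using attempts_bounds[OF assms] by (intro sum_mono) auto
  finally show ?thesis by (simp add: mult.commute)
qed

definition tau_path :: "(nat \<Rightarrow> nat) \<Rightarrow> nat \<Rightarrow> nat" where
  "tau_path \<delta> n = (LEAST t. 1 \<le> t \<and> num_items \<delta> t = n \<and> \<delta> t = 0)"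

lemma tau_eq_tau_path: "tau d n \<omega> = tau_path (\<lambda>u. d u \<omega>) n"
  by (simp add: tau_def tau_path_def)

text \<open>By \<open>le_num_items\<close> the number of items exceeds \<open>n\<close> eventually,
  and it grows by at most one per response. Just before it first exceeds \<open>n\<close> it equals
  \<open>n\<close>, and the jump means that the decision there is 0.\<close>

lemma tau_path_ex:
  assumes "valid_decisions m \<delta>" "1 \<le> n"
  shows "\<exists>t. 1 \<le> t \<and> num_items \<delta> t = n \<and> \<delta> t = 0"
proof -
  let ?P = "\<lambda>t. n < num_items \<delta> t"
  have "(m - 1) * n < (m - 1) * num_items \<delta> (Suc ((m - 1) * n))"
    using le_num_items[OF assms(1), of "Suc ((m - 1) * n)"] by linarith
  then have ex: "?P (Suc ((m - 1) * n))" by simp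
  define t where "t = (LEAST t. ?P t)"
  have t: "?P t" unfolding t_def by (rule LeastI[of ?P, OF ex])
  have less: "\<not> ?P s" if "s < t" for s using not_less_Least[of s ?P] that by (simp add: t_def)
  have "t \<noteq> 0" using t by (auto simp del: num_items_Suc_0 intro!: Nat.gr0I)
  then obtain s where s: "t = Suc s" by (cases t) auto
  have 1: "num_items \<delta> s \<le> n" using less[of s] s by simp
  then have "new_item \<delta> s" "num_items \<delta> s = n" using t s by (auto split: if_splits)
  moreover have "s \<noteq> 0" using \<open>num_items \<delta> s = n\<close> assms(2) by (auto intro!: Nat.gr0I)
  ultimately show ?thesis by (intro exI[of _ s]) (auto simp: new_item_def)
qed

lemma tau_path_props:
  assumes "valid_decisions m \<delta>" "1 \<le> n"
  shows "1 \<le> tau_path \<delta> n" "num_items \<delta> (tau_path \<delta> n) = n" "\<delta> (tau_path \<delta> n) = 0"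
  using LeastI_ex[OF tau_path_ex[OF assms]] by (auto simp: tau_path_def)

text \<open>At \<open>tau_path\<close> there are \<open>n\<close> items and the next response opens
  another one. Reading the time off the monotone count is what later makes it a stopping
  time.\<close>

lemma tau_path_less_iff:
  assumes "valid_decisions m \<delta>" "1 \<le> n"
  shows "tau_path \<delta> n < t \<longleftrightarrow> n < num_items \<delta> t"
proof -
  note p = tau_path_props[OF assms]
  have "num_items \<delta> (Suc (tau_path \<delta> n)) = Suc n" using p by (simp add: new_item_def)
  then show ?thesis
    using num_items_mono[of "Suc (tau_path \<delta> n)" t \<delta>] num_items_mono[of t "tau_path \<delta> n" \<delta>] p
    by (cases "tau_path \<delta> n < t") auto
qed

lemma tau_path_ge: "valid_decisions m \<delta> \<Longrightarrow> 1 \<le> n \<Longrightarrow> n \<le> tau_path \<delta> n"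
  using tau_path_props(2)[of m \<delta> n] num_items_le[of \<delta> "tau_path \<delta> n"] by simp

lemma tau_path_le: "valid_decisions m \<delta> \<Longrightarrow> 1 \<le> n \<Longrightarrow> tau_path \<delta> n \<le> (m - 1) * n"
  using tau_path_props(2)[of m \<delta> n] le_num_items[of m \<delta> "tau_path \<delta> n"] by simp

section \<open>The nominal response model\<close>

definition nrm_weight :: "real \<Rightarrow> 'k::finite item \<Rightarrow> 'k option \<Rightarrow> real" where
  "nrm_weight \<theta> b k = exp (item_a b k * \<theta> + item_c b k)"

lemma nrm_weight_pos: "0 < nrm_weight \<theta> b k"
  by (simp add: nrm_weight_def)

lemma sum_nrm_weight_pos:
  "set x \<noteq> UNIV \<Longrightarrow> 0 < (\<Sum>h\<in>- set x. nrm_weight \<theta> b h)"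
  by (intro sum_pos) (auto simp: nrm_weight_pos)

text \<open>The normalization of \<open>nrm_prob\<close> cancels, so first answers and revisions
  follow the same exponential family restricted to the remaining categories.\<close>

lemma nrm_cond_prob_eq:
  "nrm_cond_prob \<theta> b x k = nrm_weight \<theta> b k / (\<Sum>h\<in>- set x. nrm_weight \<theta> b h)"
proof -
  have "0 < (\<Sum>h\<in>UNIV. nrm_weight \<theta> b h)"
    using sum_nrm_weight_pos[of "[]" \<theta> b] by simp
  then show ?thesis
    by (simp add: nrm_cond_prob_def nrm_prob_def nrm_weight_def[symmetric] sum_divide_distrib[symmetric])
qed

lemma nrm_cond_prob_Nil: "nrm_cond_prob \<theta> b [] k = nrm_prob \<theta> b k"
  by (simp add: nrm_cond_prob_eq nrm_prob_def nrm_weight_def)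

lemma nrm_cond_prob_pos: "set x \<noteq> UNIV \<Longrightarrow> 0 < nrm_cond_prob \<theta> b x k"
  by (simp add: nrm_cond_prob_eq sum_nrm_weight_pos nrm_weight_pos)

lemma nrm_cond_prob_nonneg: "0 \<le> nrm_cond_prob \<theta> b x k"
  by (simp add: nrm_cond_prob_eq nrm_weight_pos less_imp_le sum_nonneg)

lemma sum_nrm_cond_prob:
  "set x \<noteq> UNIV \<Longrightarrow> (\<Sum>k\<in>- set x. nrm_cond_prob \<theta> b x k) = 1"
  using sum_nrm_weight_pos[of x \<theta> b]
  by (simp add: nrm_cond_prob_eq sum_divide_distrib[symmetric])

lemma sum_nrm_s_prob:
  assumes "set x \<noteq> UNIV"
  shows "(\<Sum>k\<in>- set x. nrm_s \<theta> b x k * nrm_cond_prob \<theta> b x k) = 0"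
  using sum_nrm_cond_prob[OF assms, of \<theta> b]
  by (simp add: nrm_s_def left_diff_distrib sum_subtractf sum_distrib_left[symmetric] nrm_abar_def)

lemma sum_nrm_s_square_prob:
  "(\<Sum>k\<in>- set x. (nrm_s \<theta> b x k)\<^sup>2 * nrm_cond_prob \<theta> b x k) = nrm_J \<theta> b x"
  by (simp add: nrm_s_def nrm_J_def)

lemma nrm_J_nonneg: "0 \<le> nrm_J \<theta> b x"
  by (auto simp: nrm_J_def nrm_cond_prob_nonneg intro!: sum_nonneg)

text \<open>The variance as second moment minus squared mean, the form in which the quotient rule
  produces it.\<close>

lemma nrm_J_eq:
  assumes "set x \<noteq> UNIV"
  shows "nrm_J \<theta> b x =
    (\<Sum>k\<in>- set x. (item_a b k)\<^sup>2 * nrm_cond_prob \<theta> b x k) - (nrm_abar \<theta> b x)\<^sup>2"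
proof -
  let ?m = "nrm_abar \<theta> b x"
  have "nrm_J \<theta> b x = (\<Sum>k\<in>- set x. (item_a b k)\<^sup>2 * nrm_cond_prob \<theta> b x k
      - 2 * ?m * (item_a b k * nrm_cond_prob \<theta> b x k) + ?m\<^sup>2 * nrm_cond_prob \<theta> b x k)"
    unfolding nrm_J_def by (intro sum.cong) (auto simp: power2_eq_square algebra_simps)
  also have "\<dots> = (\<Sum>k\<in>- set x. (item_a b k)\<^sup>2 * nrm_cond_prob \<theta> b x k) - 2 * ?m * ?m + ?m\<^sup>2 * 1"
    by (simp only: sum.distrib sum_subtractf sum_distrib_left[symmetric]
        sum_nrm_cond_prob[OF assms] nrm_abar_def[symmetric])
  finally show ?thesis by (simp add: power2_eq_square)
qed

text \<open>The usual exponential family identity: the mean slope is the logarithmic derivative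
  \<open>N / D\<close> of the partition function \<open>D\<close>, and its derivative is the
  variance of the slope.\<close>

lemma nrm_s_has_derivative:
  assumes "set x \<noteq> UNIV"
  shows "((\<lambda>\<theta>. nrm_s \<theta> b x k) has_real_derivative - nrm_J \<theta> b x) (at \<theta>)"
proof -
  let ?D = "\<lambda>\<theta>. \<Sum>h\<in>- set x. nrm_weight \<theta> b h"
  let ?N = "\<lambda>\<theta>. \<Sum>h\<in>- set x. item_a b h * nrm_weight \<theta> b h"
  let ?Q = "\<Sum>h\<in>- set x. (item_a b h)\<^sup>2 * nrm_weight \<theta> b h"
  have D: "?D \<theta> > 0" using sum_nrm_weight_pos[OF assms] .
  have w: "((\<lambda>\<theta>. nrm_weight \<theta> b h) has_real_derivative item_a b h * nrm_weight \<theta> b h) (at \<theta>)" for h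
    unfolding nrm_weight_def by (auto intro!: derivative_eq_intros)
  have dD: "(?D has_real_derivative ?N \<theta>) (at \<theta>)"
    by (intro DERIV_sum w)
  have dN: "(?N has_real_derivative ?Q) (at \<theta>)"
    by (intro DERIV_sum) (auto intro!: derivative_eq_intros w simp: power2_eq_square)
  have abar: "nrm_abar \<theta> b x = ?N \<theta> / ?D \<theta>" for \<theta>
    by (simp add: nrm_abar_def nrm_cond_prob_eq sum_divide_distrib)
  have J: "nrm_J \<theta> b x = ?Q / ?D \<theta> - (?N \<theta> / ?D \<theta>)\<^sup>2"
    unfolding nrm_J_eq[OF assms] abar by (simp add: nrm_cond_prob_eq sum_divide_distrib)
  have "((\<lambda>\<theta>. item_a b k - ?N \<theta> / ?D \<theta>) has_real_derivative
      0 - (?Q * ?D \<theta> - ?N \<theta> * ?N \<theta>) / (?D \<theta> * ?D \<theta>)) (at \<theta>)"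
    using D by (intro DERIV_diff DERIV_const DERIV_divide dD dN) auto
  also have "0 - (?Q * ?D \<theta> - ?N \<theta> * ?N \<theta>) / (?D \<theta> * ?D \<theta>) = - nrm_J \<theta> b x"
    using D unfolding J by (simp add: field_simps power2_eq_square)
  finally show ?thesis unfolding nrm_s_def abar .
qed

lemma continuous_on_item_a [continuous_intros]:
  "continuous_on S f \<Longrightarrow> continuous_on S (\<lambda>x. item_a (f x) k)"
  by (cases k) (auto simp: item_a_def intro!: continuous_intros)

lemma continuous_on_item_c [continuous_intros]:
  "continuous_on S f \<Longrightarrow> continuous_on S (\<lambda>x. item_c (f x) k)"
  by (cases k) (auto simp: item_c_def intro!: continuous_intros)

text \<open>Continuity is joint in ability and item, for compactness arguments on
  \<open>cball \<theta> 1 \<times> B\<close>. A history containing all categories is separated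
  because the denominator vanishes there.\<close>

lemma continuous_on_nrm_abar:
  "continuous_on S (\<lambda>p. nrm_abar (fst p) (snd p) x)"
proof (cases "set x = UNIV")
  case False
  then show ?thesis
    using sum_nrm_weight_pos[OF False] unfolding nrm_abar_def nrm_cond_prob_eq
    by (intro continuous_intros ballI less_imp_neq[symmetric])
      (auto simp: nrm_weight_def intro!: continuous_intros)
qed (simp add: nrm_abar_def)

lemma continuous_on_nrm_J:
  "continuous_on S (\<lambda>p. nrm_J (fst p) (snd p) x)"
proof (cases "set x = UNIV")
  case False
  then show ?thesis
    using sum_nrm_weight_pos[OF False] unfolding nrm_J_def nrm_cond_prob_eq
    by (intro continuous_intros continuous_on_nrm_abar ballI less_imp_neq[symmetric])
      (auto simp: nrm_weight_def intro!: continuous_intros)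
qed (simp add: nrm_J_def)

lemma continuous_on_nrm_s:
  "continuous_on S (\<lambda>p. nrm_s (fst p) (snd p) x k)"
  unfolding nrm_s_def by (intro continuous_intros continuous_on_nrm_abar)

lemma continuous_on_nrm_cond_prob:
  "continuous_on S (\<lambda>p. nrm_cond_prob (fst p) (snd p) x k)"
proof (cases "set x = UNIV")
  case False
  then show ?thesis
    using sum_nrm_weight_pos[OF False] unfolding nrm_cond_prob_eq
    by (intro continuous_intros ballI less_imp_neq[symmetric])
      (auto simp: nrm_weight_def intro!: continuous_intros)
qed (simp add: nrm_cond_prob_eq)

lemma sum_item_a: "(\<Sum>k\<in>UNIV. item_a b k) = 0"
  by (simp add: UNIV_option_conv item_a_def sum.reindex)

text \<open>Zero variance under strictly positive probabilities makes all slopes equal. Since they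
  sum to zero, all of them vanish, which the assumption excludes.\<close>

lemma nrm_J_Nil_pos:
  assumes "(\<Sum>k\<in>UNIV. \<bar>item_a b k\<bar>) \<noteq> 0"
  shows "0 < nrm_J \<theta> b []"
proof (rule ccontr)
  assume "\<not> 0 < nrm_J \<theta> b []"
  then have "nrm_J \<theta> b [] = 0" using nrm_J_nonneg[of \<theta> b "[]"] by simp
  then have "\<forall>k. (item_a b k - nrm_abar \<theta> b [])\<^sup>2 * nrm_cond_prob \<theta> b [] k = 0"
    unfolding nrm_J_def by (subst (asm) sum_nonneg_eq_0_iff) (auto simp: nrm_cond_prob_nonneg)
  then have eq: "item_a b k = nrm_abar \<theta> b []" for k
    using nrm_cond_prob_pos[of "[]" \<theta> b k] by auto
  have "(\<Sum>k\<in>UNIV. item_a b k) = real CARD('a option) * nrm_abar \<theta> b []"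
    by (simp add: eq)
  then have "nrm_abar \<theta> b [] = 0" by (simp add: sum_item_a)
  then show False using assms eq by simp
qed

text \<open>The mean slope is a convex combination of slopes and obeys the same bound
  \<open>K\<close>; the deviation of a slope from it is then at most \<open>2 * K\<close>.\<close>

lemma nrm_abs_bounds:
  assumes "\<And>k. \<bar>item_a b k\<bar> \<le> K" "set x \<noteq> UNIV"
  shows "\<bar>nrm_s \<theta> b x k\<bar> \<le> 2 * K" "nrm_J \<theta> b x \<le> (2 * K)\<^sup>2"
proof -
  have "\<bar>nrm_abar \<theta> b x\<bar> \<le> (\<Sum>h\<in>- set x. K * nrm_cond_prob \<theta> b x h)"
    unfolding nrm_abar_def using assms(1) nrm_cond_prob_nonneg[of \<theta> b x]
    by (intro sum_abs[THEN order_trans] sum_mono) (auto simp: abs_mult intro!: mult_right_mono)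
  also have "\<dots> = K"
    using sum_nrm_cond_prob[OF assms(2), of \<theta> b] by (simp add: sum_distrib_left[symmetric])
  finally have abar: "\<bar>nrm_abar \<theta> b x\<bar> \<le> K" .
  show s: "\<bar>nrm_s \<theta> b x k\<bar> \<le> 2 * K" for k
    using abar assms(1)[of k] unfolding nrm_s_def by linarith
  have "nrm_J \<theta> b x \<le> (\<Sum>k\<in>- set x. (2 * K)\<^sup>2 * nrm_cond_prob \<theta> b x k)"
    unfolding sum_nrm_s_square_prob[symmetric]
    using s by (intro sum_mono mult_right_mono nrm_cond_prob_nonneg)
      (metis abs_le_square_iff abs_ge_zero abs_of_nonneg order_trans)
  also have "\<dots> = (2 * K)\<^sup>2"
    using sum_nrm_cond_prob[OF assms(2), of \<theta> b] by (simp add: sum_distrib_left[symmetric])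
  finally show "nrm_J \<theta> b x \<le> (2 * K)\<^sup>2" .
qed

lemma nrm_J_cong_set: "set x = set y \<Longrightarrow> nrm_J \<theta> b x = nrm_J \<theta> b y"
  by (simp add: nrm_J_def nrm_abar_def nrm_cond_prob_def)

lemma item_a_bounded:
  assumes "compact B"
  obtains K where "0 < K" "\<And>b k. b \<in> B \<Longrightarrow> \<bar>item_a b k\<bar> \<le> K"
proof -
  have "bounded ((\<lambda>b. item_a b k) ` B)" for k
    by (intro compact_imp_bounded compact_continuous_image assms continuous_intros)
  then have "\<exists>c>0. \<forall>b\<in>B. \<bar>item_a b k\<bar> \<le> c" for k
    unfolding bounded_pos by auto
  then obtain c where c: "\<And>k. 0 < c k" "\<And>k b. b \<in> B \<Longrightarrow> \<bar>item_a b k\<bar> \<le> c k" by metis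
  have le: "c k \<le> (\<Sum>k\<in>UNIV. c k)" for k
    by (rule member_le_sum) (auto simp: c less_imp_le)
  show thesis
  proof (rule that)
    show "0 < (\<Sum>k\<in>UNIV. c k)" by (intro sum_pos c) auto
    show "\<bar>item_a b k\<bar> \<le> (\<Sum>k\<in>UNIV. c k)" if "b \<in> B" for b k
      using c(2)[OF that, of k] le[of k] by linarith
  qed
qed

text \<open>A continuous positive function has a positive minimum on a compact set. The restriction
  to a neighbourhood of \<theta> is essential: for extreme abilities the probability concentrates on
  the categories of extreme slope and the information tends to 0.\<close>

lemma nrm_J_lower_bound:
  assumes "compact B" "\<And>b. b \<in> B \<Longrightarrow> (\<Sum>k\<in>UNIV. \<bar>item_a b k\<bar>) \<noteq> 0"
  obtains c where "0 < c" "\<And>b \<xi>. b \<in> B \<Longrightarrow> \<bar>\<xi> - \<theta>\<bar> \<le> 1 \<Longrightarrow> c \<le> nrm_J \<xi> b []"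
proof (cases "B = {}")
  case False
  have "compact (cball \<theta> 1 \<times> B)" using assms(1) by (intro compact_Times) auto
  then obtain p where p: "p \<in> cball \<theta> 1 \<times> B"
    "\<And>q. q \<in> cball \<theta> 1 \<times> B \<Longrightarrow> nrm_J (fst p) (snd p) [] \<le> nrm_J (fst q) (snd q) []"
    using continuous_attains_inf[of "cball \<theta> 1 \<times> B" "\<lambda>p. nrm_J (fst p) (snd p) []",
        OF _ _ continuous_on_nrm_J] False by force
  show thesis
  proof (rule that)
    show "0 < nrm_J (fst p) (snd p) []" using p(1) by (intro nrm_J_Nil_pos assms) auto
    show "nrm_J (fst p) (snd p) [] \<le> nrm_J \<xi> b []" if "b \<in> B" "\<bar>\<xi> - \<theta>\<bar> \<le> 1" for b \<xi>
      using p(2)[of "(\<xi>, b)"] that by (auto simp: dist_real_def abs_minus_commute)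
  qed
qed (use that[of 1] in auto)

text \<open>Uniform continuity on a compact set gives a modulus for each answer list. One modulus
  serves all lists because \<open>nrm_J\<close> depends only on the set of answers, and there are
  finitely many such sets.\<close>

lemma nrm_J_equicontinuous:
  fixes B :: "'k::finite item set"
  assumes "compact B" "0 < \<epsilon>"
  shows "\<exists>\<delta>>0. \<forall>b\<in>B. \<forall>x. \<forall>\<xi>. \<bar>\<xi> - \<theta>\<bar> < \<delta> \<longrightarrow> \<bar>nrm_J \<xi> b x - nrm_J \<theta> b x\<bar> < \<epsilon>"
proof -
  have "\<exists>\<delta>>0. \<forall>b\<in>B. \<forall>\<xi>. \<bar>\<xi> - \<theta>\<bar> < \<delta> \<longrightarrow> \<bar>nrm_J \<xi> b x - nrm_J \<theta> b x\<bar> < \<epsilon>" for x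
  proof -
    have "compact (cball \<theta> 1 \<times> B)" using assms(1) by (intro compact_Times) auto
    then have "uniformly_continuous_on (cball \<theta> 1 \<times> B) (\<lambda>p. nrm_J (fst p) (snd p) x)"
      by (intro compact_uniformly_continuous continuous_on_nrm_J)
    then obtain \<delta> where d: "0 < \<delta>" "\<And>p q. p \<in> cball \<theta> 1 \<times> B \<Longrightarrow> q \<in> cball \<theta> 1 \<times> B \<Longrightarrow> dist q p < \<delta> \<Longrightarrow>
        dist (nrm_J (fst q) (snd q) x) (nrm_J (fst p) (snd p) x) < \<epsilon>"
      unfolding uniformly_continuous_on_def using assms(2) by blast
    show ?thesis
    proof (intro exI[of _ "min 1 \<delta>"] conjI ballI allI impI)
      fix b \<xi> assume "b \<in> B" "\<bar>\<xi> - \<theta>\<bar> < min 1 \<delta>"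
      then show "\<bar>nrm_J \<xi> b x - nrm_J \<theta> b x\<bar> < \<epsilon>"
        using d(2)[of "(\<theta>, b)" "(\<xi>, b)"] by (auto simp: dist_Pair_Pair dist_real_def abs_minus_commute)
    qed (use d(1) in auto)
  qed
  then obtain \<delta> where d: "\<And>x. 0 < \<delta> x"
    "\<And>x b \<xi>. b \<in> B \<Longrightarrow> \<bar>\<xi> - \<theta>\<bar> < \<delta> x \<Longrightarrow> \<bar>nrm_J \<xi> b x - nrm_J \<theta> b x\<bar> < \<epsilon>"
    by metis
  \<comment> \<open>One representative list for each set of categories, so that the minimum below
    runs over a finite range.\<close>
  define r where "r A = (SOME x. set x = A)" for A :: "'k option set"
  have r: "set (r A) = A" for A unfolding r_def by (rule someI_ex) (simp add: finite_list)
  define e where "e = Min (range (\<lambda>A. \<delta> (r A)))"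
  have "0 < e" unfolding e_def using d(1) by (subst Min_gr_iff) auto
  moreover have "\<bar>nrm_J \<xi> b x - nrm_J \<theta> b x\<bar> < \<epsilon>" if "b \<in> B" "\<bar>\<xi> - \<theta>\<bar> < e" for b x \<xi>
  proof -
    have "e \<le> \<delta> (r (set x))" unfolding e_def by (rule Min_le) auto
    then have "\<bar>nrm_J \<xi> b (r (set x)) - nrm_J \<theta> b (r (set x))\<bar> < \<epsilon>" using d(2) that by force
    then show ?thesis using nrm_J_cong_set[OF r[of "set x"]] by metis
  qed
  ultimately show ?thesis by blast
qed

section \<open>A compensated exponential for bounded martingale differences\<close>

text \<open>The increment \<open>D t\<close> is revealed at time \<open>Suc t\<close>, its
  conditional variance \<open>v t\<close> is known at time \<open>t\<close>. Conditional moments are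
  expressed by integrals against bounded \<open>F t\<close>-measurable weights, the form in which
  they are used below.\<close>

locale bounded_martingale_differences = prob_space M
  for M :: "'w measure" +
  fixes F :: "nat \<Rightarrow> 'w measure" and D v :: "nat \<Rightarrow> 'w \<Rightarrow> real" and K :: real
  assumes subalgebra_F: "\<And>t. subalgebra M (F t)"
    and F_mono: "\<And>s t. s \<le> t \<Longrightarrow> sets (F s) \<subseteq> sets (F t)"
    and D_measurable: "\<And>t. D t \<in> borel_measurable (F (Suc t))"
    and v_measurable: "\<And>t. v t \<in> borel_measurable (F t)"
    and D_bound: "\<And>t \<omega>. \<omega> \<in> space M \<Longrightarrow> \<bar>D t \<omega>\<bar> \<le> K"
    and v_bound: "\<And>t \<omega>. \<omega> \<in> space M \<Longrightarrow> 0 \<le> v t \<omega> \<and> v t \<omega> \<le> K\<^sup>2"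
    and K_nonneg: "0 \<le> K"
    and mean_zero: "\<And>t W C. W \<in> borel_measurable (F t) \<Longrightarrow> (\<And>\<omega>. \<omega> \<in> space M \<Longrightarrow> \<bar>W \<omega>\<bar> \<le> C) \<Longrightarrow>
      (\<integral>\<omega>. W \<omega> * D t \<omega> \<partial>M) = 0"
    and variance: "\<And>t W C. W \<in> borel_measurable (F t) \<Longrightarrow> (\<And>\<omega>. \<omega> \<in> space M \<Longrightarrow> \<bar>W \<omega>\<bar> \<le> C) \<Longrightarrow>
      (\<integral>\<omega>. W \<omega> * (D t \<omega>)\<^sup>2 \<partial>M) = (\<integral>\<omega>. W \<omega> * v t \<omega> \<partial>M)"

lemma square_le_of_abs_le: "\<bar>x\<bar> \<le> y \<Longrightarrow> x\<^sup>2 \<le> y\<^sup>2" for x y :: real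
  using power_mono[of "\<bar>x\<bar>" y 2] by simp

text \<open>If \<open>y\<close> counts as a quantity of second order, then
  \<open>Complex ((y - x\<^sup>2) / 2) x\<close> collects all terms of order one and two of
  \<open>exp (y / 2 + \<i> x) - 1\<close>. For a centred \<open>x\<close> with conditional variance
  \<open>y\<close> this part has conditional mean zero, so only a cubic error survives.\<close>

lemma norm_exp_Complex_approx:
  fixes x y \<epsilon> :: real
  assumes "\<bar>x\<bar> \<le> \<epsilon>" "0 \<le> y" "y \<le> \<epsilon>\<^sup>2" "\<epsilon> \<le> 1"
  shows "norm (exp (Complex (y / 2) x) - 1 - Complex ((y - x\<^sup>2) / 2) x) \<le> 4 * \<epsilon> ^ 3"
proof -
  define z where "z = Complex (y / 2) x"
  have e0: "0 \<le> \<epsilon>" using assms(1) by linarith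
  have e2: "\<epsilon>\<^sup>2 \<le> \<epsilon>" using assms(4) e0 by (simp add: power2_eq_square mult_left_le)
  have e1: "\<epsilon>\<^sup>2 \<le> 1" using e2 assms(4) by linarith
  have e43: "\<epsilon> ^ 4 \<le> \<epsilon> ^ 3" using e0 assms(4) by (intro power_decreasing) auto
  have nz: "norm z \<le> 3 / 2 * \<epsilon>"
    using cmod_le[of z] assms e2 unfolding z_def by (auto)
  have "norm (exp z - (\<Sum>k\<le>2. z ^ k / fact k)) \<le> exp \<bar>Re z\<bar> * norm z ^ Suc 2 / fact 2"
    by (rule Taylor_exp)
  also have "\<dots> \<le> (5 / 3) * (3 / 2 * \<epsilon>) ^ 3 / 2"
  proof -
    have "exp \<bar>Re z\<bar> \<le> exp (1 / 2 :: real)" using assms e1 by (simp add: z_def)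
    also have "\<dots> \<le> 5 / 3"
    proof -
      have "exp (1 / 2 :: real) ^ 2 = exp 1" by (simp add: exp_of_nat_mult[symmetric])
      \<comment> \<open>Here \<open>e < 2.72 < 25 / 9\<close>.\<close>
      also have "\<dots> \<le> (5 / 3)\<^sup>2" using e_less_272 by (simp add: power2_eq_square)
      finally show ?thesis by (rule power2_le_imp_le) simp
    qed
    finally have "exp \<bar>Re z\<bar> \<le> 5 / 3" .
    from mult_mono[OF this power_mono[OF nz norm_ge_zero, of 3]]
    show ?thesis by (simp add: numeral_3_eq_3[symmetric] numeral_2_eq_2[symmetric] Suc_numeral del: power_Suc)
  qed
  finally have 1: "norm (exp z - (\<Sum>k\<le>2. z ^ k / fact k)) \<le> (45 / 16) * \<epsilon> ^ 3"
    by (simp add: power3_eq_cube)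
  \<comment> \<open>The second term beyond the claimed approximation consists of the parts of
    \<open>z\<^sup>2 / 2\<close> that contain \<open>y\<close>; these have order at least three. The
    constants add up to \<open>45 / 16 + 5 / 8\<close>, which is below 4.\<close>
  have eq: "(\<Sum>k\<le>2. z ^ k / fact k) = 1 + Complex ((y - x\<^sup>2) / 2) x + Complex (y\<^sup>2 / 8) (x * y / 2)"
    by (auto simp: numeral_2_eq_2 z_def complex_eq_iff power2_eq_square field_simps)
  have "norm (Complex (y\<^sup>2 / 8) (x * y / 2)) \<le> y\<^sup>2 / 8 + \<bar>x\<bar> * y / 2"
    using cmod_le[of "Complex (y\<^sup>2 / 8) (x * y / 2)"] assms by (simp add: abs_mult)
  also have "\<dots> \<le> (\<epsilon>\<^sup>2)\<^sup>2 / 8 + \<epsilon> * \<epsilon>\<^sup>2 / 2"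
    using assms e0 by (intro add_mono divide_right_mono mult_mono power_mono) auto
  also have "\<dots> \<le> \<epsilon> ^ 3 / 8 + \<epsilon> ^ 3 / 2"
  proof -
    have "(\<epsilon>\<^sup>2)\<^sup>2 = \<epsilon> ^ 4" by simp
    moreover have "\<epsilon> * \<epsilon>\<^sup>2 = \<epsilon> ^ 3" by (simp add: power2_eq_square power3_eq_cube)
    ultimately show ?thesis using e43 by simp
  qed
  finally have 2: "norm (Complex (y\<^sup>2 / 8) (x * y / 2)) \<le> \<epsilon> ^ 3 / 8 + \<epsilon> ^ 3 / 2" .
  have eq2: "exp z - 1 - Complex ((y - x\<^sup>2) / 2) x =
      (exp z - (\<Sum>k\<le>2. z ^ k / fact k)) + Complex (y\<^sup>2 / 8) (x * y / 2)"
    unfolding eq by simp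
  have "norm (exp z - 1 - Complex ((y - x\<^sup>2) / 2) x) \<le>
      (45 / 16) * \<epsilon> ^ 3 + (\<epsilon> ^ 3 / 8 + \<epsilon> ^ 3 / 2)"
    unfolding eq2 by (rule norm_triangle_mono[OF 1 2])
  also have "\<dots> \<le> 4 * \<epsilon> ^ 3" using e0 by simp
  finally show ?thesis by (simp add: z_def)
qed

context bounded_martingale_differences
begin

lemma measurable_F: "f \<in> borel_measurable (F t) \<Longrightarrow> f \<in> borel_measurable M"
  by (rule measurable_from_subalg[OF subalgebra_F])

lemma measurable_F_mono: "s \<le> t \<Longrightarrow> f \<in> borel_measurable (F s) \<Longrightarrow> f \<in> borel_measurable (F t)"
  by (rule measurable_from_subalg[of "F t" "F s"])
    (use subalgebra_F F_mono in \<open>auto simp: subalgebra_def\<close>)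

lemma partial_sum_measurable:
  assumes "\<And>t. H t \<in> borel_measurable (F t)"
  shows "(\<lambda>\<omega>. \<Sum>t<T. H t \<omega> * D t \<omega>) \<in> borel_measurable (F T)"
    and "(\<lambda>\<omega>. \<Sum>t<T. (H t \<omega>)\<^sup>2 * v t \<omega>) \<in> borel_measurable (F T)"
proof -
  have [measurable]: "H t \<in> borel_measurable (F T)" "D t \<in> borel_measurable (F T)"
    "v t \<in> borel_measurable (F T)" if "t < T" for t
    using that measurable_F_mono[OF _ assms, of t T] measurable_F_mono[OF _ D_measurable, of t T]
      measurable_F_mono[OF _ v_measurable, of t T] by auto
  show "(\<lambda>\<omega>. \<Sum>t<T. H t \<omega> * D t \<omega>) \<in> borel_measurable (F T)"
    "(\<lambda>\<omega>. \<Sum>t<T. (H t \<omega>)\<^sup>2 * v t \<omega>) \<in> borel_measurable (F T)"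
    by measurable
qed

lemma abs_weighted_bounds:
  assumes "\<And>t \<omega>. \<omega> \<in> space M \<Longrightarrow> \<bar>H t \<omega>\<bar> \<le> h" "\<omega> \<in> space M"
  shows "\<bar>H t \<omega> * D t \<omega>\<bar> \<le> h * K"
    and "(H t \<omega>)\<^sup>2 * v t \<omega> \<le> (h * K)\<^sup>2"
    and "\<bar>\<Sum>t<T. H t \<omega> * D t \<omega>\<bar> \<le> real T * (h * K)"
    and "(\<Sum>t<T. (H t \<omega>)\<^sup>2 * v t \<omega>) \<le> real T * (h * K)\<^sup>2"
proof -
  have h: "\<bar>H t \<omega>\<bar> \<le> h" for t using assms by blast
  then have h0: "0 \<le> h" by (rule order_trans[OF abs_ge_zero])
  show 1: "\<bar>H t \<omega> * D t \<omega>\<bar> \<le> h * K" for t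
    unfolding abs_mult using h D_bound[OF assms(2)] h0 by (intro mult_mono) auto
  show 2: "(H t \<omega>)\<^sup>2 * v t \<omega> \<le> (h * K)\<^sup>2" for t
    unfolding power_mult_distrib using h[of t] v_bound[OF assms(2)]
    by (intro mult_mono) (auto intro!: square_le_of_abs_le)
  show "\<bar>\<Sum>t<T. H t \<omega> * D t \<omega>\<bar> \<le> real T * (h * K)"
    using sum_bounded_above[of "{..<T}" "\<lambda>t. \<bar>H t \<omega> * D t \<omega>\<bar>" "h * K"] 1
    by (intro order_trans[OF sum_abs]) auto
  show "(\<Sum>t<T. (H t \<omega>)\<^sup>2 * v t \<omega>) \<le> real T * (h * K)\<^sup>2"
    using sum_bounded_above[of "{..<T}" "\<lambda>t. (H t \<omega>)\<^sup>2 * v t \<omega>" "(h * K)\<^sup>2"] 2 by simp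
qed

text \<open>Martingale increments are orthogonal, so the second moment of the sum is the sum of the
  second moments.\<close>

lemma second_moment_bound:
  assumes H: "\<And>t. H t \<in> borel_measurable (F t)"
    and h: "\<And>t \<omega>. \<omega> \<in> space M \<Longrightarrow> \<bar>H t \<omega>\<bar> \<le> h"
  shows "integrable M (\<lambda>\<omega>. (\<Sum>t<T. H t \<omega> * D t \<omega>)\<^sup>2)"
    and "(\<integral>\<omega>. (\<Sum>t<T. H t \<omega> * D t \<omega>)\<^sup>2 \<partial>M) \<le> real T * (h * K)\<^sup>2"
proof -
  define S where "S T \<omega> = (\<Sum>t<T. H t \<omega> * D t \<omega>)" for T \<omega>
  note SF = partial_sum_measurable(1)[of H, OF H, folded S_def]
  note bounds = abs_weighted_bounds[of H h, OF h]
  have [measurable]: "S T \<in> borel_measurable M" "H T \<in> borel_measurable M" "D T \<in> borel_measurable M" for T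
    using SF H D_measurable by (auto intro: measurable_F measurable_F[OF D_measurable])
  have Sb: "\<bar>S T \<omega>\<bar> \<le> real T * (h * K)" if "\<omega> \<in> space M" for T \<omega>
    using bounds(3)[OF _ that] by (simp add: S_def)
  have S2: "integrable M (\<lambda>\<omega>. (S T \<omega>)\<^sup>2)" for T
    using Sb by (intro integrable_const_bound[where B = "(real T * (h * K))\<^sup>2"] AE_I2)
      (auto intro!: square_le_of_abs_le)
  have hb: "\<bar>H T \<omega> * D T \<omega>\<bar> \<le> h * K" if "\<omega> \<in> space M" for T \<omega>
    using bounds(1)[OF _ that] .
  have SH: "\<bar>S T \<omega> * H T \<omega>\<bar> \<le> real T * (h * K) * h" if "\<omega> \<in> space M" for T \<omega>
    unfolding abs_mult using Sb[OF that, of T] h[OF that, of T] by (intro mult_mono) auto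
  have I1: "integrable M (\<lambda>\<omega>. S T \<omega> * H T \<omega> * D T \<omega>)" for T
    using SH D_bound by (intro integrable_const_bound[where B = "real T * (h * K) * h * K"] AE_I2)
      (auto simp: abs_mult intro!: mult_mono order_trans[OF _ SH, unfolded abs_mult])
  have I2: "integrable M (\<lambda>\<omega>. (H T \<omega> * D T \<omega>)\<^sup>2)" for T
    using hb by (intro integrable_const_bound[where B = "(h * K)\<^sup>2"] AE_I2)
      (auto intro!: square_le_of_abs_le)
  have "(\<integral>\<omega>. (S T \<omega>)\<^sup>2 \<partial>M) \<le> real T * (h * K)\<^sup>2" for T
  proof (induction T)
    case (Suc T)
    have "(\<integral>\<omega>. (S (Suc T) \<omega>)\<^sup>2 \<partial>M) =
      (\<integral>\<omega>. (S T \<omega>)\<^sup>2 + 2 * (S T \<omega> * H T \<omega> * D T \<omega>) + (H T \<omega> * D T \<omega>)\<^sup>2 \<partial>M)"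
      by (intro Bochner_Integration.integral_cong) (auto simp: S_def power2_eq_square algebra_simps)
    also have "\<dots> = (\<integral>\<omega>. (S T \<omega>)\<^sup>2 \<partial>M) + 2 * (\<integral>\<omega>. S T \<omega> * H T \<omega> * D T \<omega> \<partial>M) +
        (\<integral>\<omega>. (H T \<omega> * D T \<omega>)\<^sup>2 \<partial>M)"
      using S2 I1 I2 by simp
    \<comment> \<open>The cross term vanishes because \<open>S T\<close> and \<open>H T\<close> are
      known at time \<open>T\<close>.\<close>
    also have "(\<integral>\<omega>. S T \<omega> * H T \<omega> * D T \<omega> \<partial>M) = 0"
      using SF H SH by (intro mean_zero) auto
    also have "(\<integral>\<omega>. (H T \<omega> * D T \<omega>)\<^sup>2 \<partial>M) \<le> (\<integral>\<omega>. (h * K)\<^sup>2 \<partial>M)"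
      using hb I2 by (intro integral_mono)
        (auto intro!: square_le_of_abs_le)
    finally show ?case using Suc.IH by (simp add: algebra_simps prob_space)
  qed (simp add: S_def)
  then show "(\<integral>\<omega>. (\<Sum>t<T. H t \<omega> * D t \<omega>)\<^sup>2 \<partial>M) \<le> real T * (h * K)\<^sup>2"
    by (simp add: S_def)
  show "integrable M (\<lambda>\<omega>. (\<Sum>t<T. H t \<omega> * D t \<omega>)\<^sup>2)" using S2[of T] by (simp add: S_def)
qed

text \<open>Each step multiplies the exponential by \<open>1 + c + r\<close>, where \<open>c\<close>
  has conditional mean zero and \<open>r\<close> is of third order in \<open>h * K\<close>. The
  exponential factor of the bound controls the modulus of the product. For \<open>h\<close> of order
  \<open>1 / sqrt n\<close> and \<open>T\<close> of order \<open>n\<close> the total error has order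
  \<open>1 / sqrt n\<close>.\<close>

lemma compensated_exponential:
  assumes H: "\<And>t. H t \<in> borel_measurable (F t)"
    and h: "\<And>t \<omega>. \<omega> \<in> space M \<Longrightarrow> \<bar>H t \<omega>\<bar> \<le> h"
    and hK: "h * K \<le> 1"
  shows "norm ((\<integral>\<omega>. exp (Complex ((\<Sum>t<T. (H t \<omega>)\<^sup>2 * v t \<omega>) / 2) (\<Sum>t<T. H t \<omega> * D t \<omega>)) \<partial>M) - 1)
    \<le> real T * (4 * (h * K) ^ 3 * exp (real T * (h * K)\<^sup>2 / 2))"
proof -
  define S where "S T \<omega> = (\<Sum>t<T. H t \<omega> * D t \<omega>)" for T \<omega>
  define Q where "Q T \<omega> = (\<Sum>t<T. (H t \<omega>)\<^sup>2 * v t \<omega>)" for T \<omega>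
  define Z where "Z T \<omega> = exp (Complex (Q T \<omega> / 2) (S T \<omega>))" for T \<omega>
  define c where "c T \<omega> = Complex (((H T \<omega>)\<^sup>2 * v T \<omega> - (H T \<omega> * D T \<omega>)\<^sup>2) / 2) (H T \<omega> * D T \<omega>)" for T \<omega>
  define r where "r T \<omega> = exp (Complex ((H T \<omega>)\<^sup>2 * v T \<omega> / 2) (H T \<omega> * D T \<omega>)) - 1 - c T \<omega>" for T \<omega>
  define E where "E T = exp (real T * (h * K)\<^sup>2 / 2)" for T
  note SF = partial_sum_measurable(1)[of H, OF H, folded S_def]
  note QF = partial_sum_measurable(2)[of H, OF H, folded Q_def]
  note bounds = abs_weighted_bounds[of H h, OF h]
  have [measurable]: "S T \<in> borel_measurable M" "Q T \<in> borel_measurable M"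
      "H T \<in> borel_measurable M" "D T \<in> borel_measurable M" "v T \<in> borel_measurable M" for T
    using SF QF H by (auto intro: measurable_F measurable_F[OF D_measurable] measurable_F[OF v_measurable])
  have meas_Complex: "(\<lambda>\<omega>. Complex (f \<omega>) (g \<omega>)) \<in> borel_measurable M"
    if [measurable]: "f \<in> borel_measurable M" "g \<in> borel_measurable M" for f g
    unfolding Complex_eq by measurable
  have [measurable]: "Z T \<in> borel_measurable M" "c T \<in> borel_measurable M" "r T \<in> borel_measurable M" for T
    unfolding Z_def c_def[abs_def] r_def[abs_def]
    by (intro borel_measurable_diff borel_measurable_const meas_Complex
        borel_measurable_continuous_on[where f = exp] continuous_intros; measurable)+
  have Zb: "norm (Z T \<omega>) \<le> E T" if "\<omega> \<in> space M" for T \<omega>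
    using bounds(4)[OF _ that, of T] by (simp add: Z_def Q_def E_def norm_exp_eq_Re)
  have rb: "norm (r T \<omega>) \<le> 4 * (h * K) ^ 3" if "\<omega> \<in> space M" for T \<omega>
    unfolding r_def c_def using bounds(1,2)[OF _ that] v_bound[OF that] hK
    by (intro norm_exp_Complex_approx) auto
  have cb: "norm (c T \<omega>) \<le> 2" if "\<omega> \<in> space M" for T \<omega>
  proof -
    have "\<bar>H T \<omega> * D T \<omega>\<bar> \<le> 1" "(H T \<omega>)\<^sup>2 * v T \<omega> \<le> 1" "0 \<le> (H T \<omega>)\<^sup>2 * v T \<omega>"
      using bounds(1,2)[OF _ that, of T] v_bound[OF that] hK
        order_trans[OF abs_ge_zero bounds(1)[OF _ that, of T]]
      by (auto intro: order_trans power_le_one)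
    moreover from this have "(H T \<omega> * D T \<omega>)\<^sup>2 \<le> 1" by (simp add: abs_square_le_1)
    ultimately have "\<bar>(H T \<omega>)\<^sup>2 * v T \<omega> - (H T \<omega> * D T \<omega>)\<^sup>2\<bar> \<le> 1"
      using zero_le_power2[of "H T \<omega> * D T \<omega>"] by linarith
    then show ?thesis using cmod_le[of "c T \<omega>"] \<open>\<bar>H T \<omega> * D T \<omega>\<bar> \<le> 1\<close> by (auto simp: c_def)
  qed
  have E_mono: "E s \<le> E t" if "s \<le> t" for s t using that by (auto simp: E_def intro!: mult_right_mono)
  have IZ: "integrable M (Z T)" for T
    using Zb by (intro integrable_const_bound[where B = "E T"] AE_I2) auto
  have IZr: "integrable M (\<lambda>\<omega>. Z T \<omega> * r T \<omega>)" for T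
    using Zb rb by (intro integrable_const_bound[where B = "E T * (4 * (h * K) ^ 3)"] AE_I2)
      (auto simp: norm_mult intro!: mult_mono simp: E_def)
  have IZc: "integrable M (\<lambda>\<omega>. Z T \<omega> * c T \<omega>)" for T
    using Zb cb by (intro integrable_const_bound[where B = "E T * 2"] AE_I2)
      (auto simp: norm_mult intro!: mult_mono simp: E_def)
  \<comment> \<open>The martingale assumptions speak of real weights. These facts are applied to the
    real and the imaginary part of \<open>Z T\<close> and recombined in \<open>Zc0\<close>.\<close>
  have lin: "(\<integral>\<omega>. W \<omega> * (H T \<omega> * D T \<omega>) \<partial>M) = 0"
      "(\<integral>\<omega>. W \<omega> * (((H T \<omega>)\<^sup>2 * v T \<omega> - (H T \<omega> * D T \<omega>)\<^sup>2) / 2) \<partial>M) = 0"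
      "integrable M (\<lambda>\<omega>. W \<omega> * (H T \<omega> * D T \<omega>))"
      "integrable M (\<lambda>\<omega>. W \<omega> * (((H T \<omega>)\<^sup>2 * v T \<omega> - (H T \<omega> * D T \<omega>)\<^sup>2) / 2))"
    if W[measurable]: "W \<in> borel_measurable (F T)" and Wb: "\<And>\<omega>. \<omega> \<in> space M \<Longrightarrow> \<bar>W \<omega>\<bar> \<le> E T" for W T
  proof -
    have [measurable]: "W \<in> borel_measurable M" using W by (rule measurable_F)
    note H[measurable]
    have b1: "\<bar>W \<omega> * H T \<omega>\<bar> \<le> E T * h" if "\<omega> \<in> space M" for \<omega>
      unfolding abs_mult using Wb[OF that] h[OF that] by (intro mult_mono) (auto simp: E_def)
    have b2: "\<bar>W \<omega> * (H T \<omega>)\<^sup>2\<bar> \<le> E T * h\<^sup>2" if "\<omega> \<in> space M" for \<omega>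
      unfolding abs_mult using Wb[OF that] h[OF that, of T] by (intro mult_mono)
        (auto simp: E_def intro!: square_le_of_abs_le)
    have i1: "integrable M (\<lambda>\<omega>. W \<omega> * H T \<omega> * D T \<omega>)"
      using b1 D_bound K_nonneg by (intro integrable_const_bound[where B = "E T * h * K"] AE_I2)
        (auto simp: abs_mult[of "_ * _"] intro!: mult_mono intro: order_trans[OF abs_ge_zero])
    have i2: "integrable M (\<lambda>\<omega>. W \<omega> * (H T \<omega>)\<^sup>2 * v T \<omega>)"
      using b2 v_bound by (intro integrable_const_bound[where B = "E T * h\<^sup>2 * K\<^sup>2"] AE_I2)
        (auto simp: abs_mult[of "_ * _"] intro!: mult_mono intro: order_trans[OF abs_ge_zero])
    have i3: "integrable M (\<lambda>\<omega>. W \<omega> * (H T \<omega>)\<^sup>2 * (D T \<omega>)\<^sup>2)"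
      using b2 D_bound K_nonneg by (intro integrable_const_bound[where B = "E T * h\<^sup>2 * K\<^sup>2"] AE_I2)
        (auto simp: abs_mult[of "_ * _"] intro!: mult_mono square_le_of_abs_le intro: order_trans[OF abs_ge_zero])
    show "(\<integral>\<omega>. W \<omega> * (H T \<omega> * D T \<omega>) \<partial>M) = 0"
      using mean_zero[of "\<lambda>\<omega>. W \<omega> * H T \<omega>" T "E T * h"] b1 by (simp add: mult.assoc)
    show "integrable M (\<lambda>\<omega>. W \<omega> * (H T \<omega> * D T \<omega>))" using i1 by (simp add: mult.assoc)
    have eq: "W \<omega> * (((H T \<omega>)\<^sup>2 * v T \<omega> - (H T \<omega> * D T \<omega>)\<^sup>2) / 2) =
        (W \<omega> * (H T \<omega>)\<^sup>2 * v T \<omega> - W \<omega> * (H T \<omega>)\<^sup>2 * (D T \<omega>)\<^sup>2) / 2" for \<omega>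
      by (simp add: power_mult_distrib algebra_simps diff_divide_distrib)
    show "integrable M (\<lambda>\<omega>. W \<omega> * (((H T \<omega>)\<^sup>2 * v T \<omega> - (H T \<omega> * D T \<omega>)\<^sup>2) / 2))"
      unfolding eq using i2 i3 by simp
    show "(\<integral>\<omega>. W \<omega> * (((H T \<omega>)\<^sup>2 * v T \<omega> - (H T \<omega> * D T \<omega>)\<^sup>2) / 2) \<partial>M) = 0"
      unfolding eq using i2 i3 variance[of "\<lambda>\<omega>. W \<omega> * (H T \<omega>)\<^sup>2" T "E T * h\<^sup>2"] b2 by simp
  qed
  have Zc0: "(\<integral>\<omega>. Z T \<omega> * c T \<omega> \<partial>M) = 0" for T
  proof -
    note SF[measurable] QF[measurable]
    have ReZ: "(\<lambda>\<omega>. Re (Z T \<omega>)) \<in> borel_measurable (F T)"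
      and ImZ: "(\<lambda>\<omega>. Im (Z T \<omega>)) \<in> borel_measurable (F T)"
      unfolding Z_def Re_exp Im_exp complex.sel by measurable
    have b: "\<bar>Re (Z T \<omega>)\<bar> \<le> E T" "\<bar>Im (Z T \<omega>)\<bar> \<le> E T" if "\<omega> \<in> space M" for \<omega>
      using Zb[OF that, of T] abs_Re_le_cmod[of "Z T \<omega>"] abs_Im_le_cmod[of "Z T \<omega>"] by linarith+
    note r = lin[OF ReZ b(1)] and i = lin[OF ImZ b(2)]
    show ?thesis
    proof (rule complex_eqI)
      show "Re (\<integral>\<omega>. Z T \<omega> * c T \<omega> \<partial>M) = Re 0"
        using r i by (subst integral_Re[OF IZc, symmetric]) (simp add: c_def)
      show "Im (\<integral>\<omega>. Z T \<omega> * c T \<omega> \<partial>M) = Im 0"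
        using r i by (subst integral_Im[OF IZc, symmetric]) (simp add: c_def)
    qed
  qed
  have "norm ((\<integral>\<omega>. Z T \<omega> \<partial>M) - 1) \<le> real T * (4 * (h * K) ^ 3 * E T)" for T
  proof (induction T)
    case 0
    show ?case by (simp add: Z_def Q_def S_def prob_space zero_complex.code[symmetric])
  next
    case (Suc T)
    have "Z (Suc T) \<omega> = Z T \<omega> + Z T \<omega> * r T \<omega> + Z T \<omega> * c T \<omega>" for \<omega>
    proof -
      have "Z (Suc T) \<omega> = Z T \<omega> * exp (Complex ((H T \<omega>)\<^sup>2 * v T \<omega> / 2) (H T \<omega> * D T \<omega>))"
        by (simp add: Z_def Q_def S_def exp_add[symmetric] complex_add add_divide_distrib)
      then show ?thesis by (simp add: r_def algebra_simps)
    qed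
    then have "(\<integral>\<omega>. Z (Suc T) \<omega> \<partial>M) = (\<integral>\<omega>. Z T \<omega> \<partial>M) + (\<integral>\<omega>. Z T \<omega> * r T \<omega> \<partial>M)"
      using IZ IZr IZc Zc0 by simp
    moreover have "norm (\<integral>\<omega>. Z T \<omega> * r T \<omega> \<partial>M) \<le> (\<integral>\<omega>. E T * (4 * (h * K) ^ 3) \<partial>M)"
      using Zb rb by (intro order_trans[OF integral_norm_bound] integral_mono integrable_norm[OF IZr])
        (auto simp: norm_mult E_def intro!: mult_mono)
    ultimately have "norm ((\<integral>\<omega>. Z (Suc T) \<omega> \<partial>M) - 1) \<le>
        real T * (4 * (h * K) ^ 3 * E T) + E T * (4 * (h * K) ^ 3)"
      using Suc.IH norm_triangle_mono[OF Suc.IH, of "\<integral>\<omega>. Z T \<omega> * r T \<omega> \<partial>M" "E T * (4 * (h * K) ^ 3)"]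
      by (simp add: prob_space algebra_simps)
    also have "\<dots> = real (Suc T) * (4 * (h * K) ^ 3 * E T)" by (simp add: algebra_simps)
    \<comment> \<open>The bound \<open>E\<close> grows with \<open>T\<close>, so the last value
      dominates the factors of all earlier steps.\<close>
    also have "\<dots> \<le> real (Suc T) * (4 * (h * K) ^ 3 * E (Suc T))"
    proof -
      obtain \<omega> where w: "\<omega> \<in> space M" using not_empty by blast
      have "0 \<le> h * K" using order_trans[OF abs_ge_zero bounds(1)[OF _ w]] .
      then show ?thesis using E_mono[of T "Suc T"] by (intro mult_left_mono) auto
    qed
    finally show ?case .
  qed
  then show ?thesis by (simp add: Z_def Q_def S_def E_def)
qed

end

section \<open>Convergence in probability as a filter\<close>

text \<open>
  Convergence in probability of \<open>Z n\<close> to \<open>L\<close> becomes ordinary convergence of \<open>Z n \<omega> - L \<omega>\<close> along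
  this filter, so that the limit rules of the library apply to it.
\<close>

definition in_prob :: "'w measure \<Rightarrow> (nat \<times> 'w) filter" where
  "in_prob M = Abs_filter (\<lambda>P. \<forall>\<eta>>0. \<forall>\<^sub>F n in sequentially.
     \<exists>G\<in>sets M. measure M (space M - G) \<le> \<eta> \<and> (\<forall>\<omega>\<in>G. P (n, \<omega>)))"

context prob_space
begin

text \<open>The predicate only has to hold on a measurable set of large probability and need not
  define an event itself. This matters for points chosen by the mean value theorem. Conjunctions
  split the exceptional probability into two halves.\<close>

lemma eventually_in_prob:
  "eventually P (in_prob M) \<longleftrightarrow> (\<forall>\<eta>>0. \<forall>\<^sub>F n in sequentially.
     \<exists>G\<in>events. prob (space M - G) \<le> \<eta> \<and> (\<forall>\<omega>\<in>G. P (n, \<omega>)))"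
  unfolding in_prob_def
proof (rule eventually_Abs_filter, rule is_filter.intro)
  show "\<forall>\<eta>>0. \<forall>\<^sub>F n in sequentially. \<exists>G\<in>events. prob (space M - G) \<le> \<eta> \<and> (\<forall>\<omega>\<in>G. True)"
    by (auto intro!: always_eventually bexI[of _ "space M"])
next
  fix P Q :: "nat \<times> 'a \<Rightarrow> bool"
  assume P: "\<forall>\<eta>>0. \<forall>\<^sub>F n in sequentially. \<exists>G\<in>events. prob (space M - G) \<le> \<eta> \<and> (\<forall>\<omega>\<in>G. P (n, \<omega>))"
    and Q: "\<forall>\<eta>>0. \<forall>\<^sub>F n in sequentially. \<exists>G\<in>events. prob (space M - G) \<le> \<eta> \<and> (\<forall>\<omega>\<in>G. Q (n, \<omega>))"
  show "\<forall>\<eta>>0. \<forall>\<^sub>F n in sequentially. \<exists>G\<in>events. prob (space M - G) \<le> \<eta> \<and>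
      (\<forall>\<omega>\<in>G. P (n, \<omega>) \<and> Q (n, \<omega>))"
  proof (intro allI impI)
    fix \<eta> :: real assume "0 < \<eta>"
    then have "0 < \<eta> / 2" by simp
    with P Q have
      "\<forall>\<^sub>F n in sequentially. \<exists>G\<in>events. prob (space M - G) \<le> \<eta> / 2 \<and> (\<forall>\<omega>\<in>G. P (n, \<omega>))"
      "\<forall>\<^sub>F n in sequentially. \<exists>G\<in>events. prob (space M - G) \<le> \<eta> / 2 \<and> (\<forall>\<omega>\<in>G. Q (n, \<omega>))"
      by blast+
    then show "\<forall>\<^sub>F n in sequentially. \<exists>G\<in>events. prob (space M - G) \<le> \<eta> \<and>
      (\<forall>\<omega>\<in>G. P (n, \<omega>) \<and> Q (n, \<omega>))"
    proof eventually_elim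
      case (elim n)
      then obtain G H where G: "G \<in> events" "prob (space M - G) \<le> \<eta> / 2" "\<forall>\<omega>\<in>G. P (n, \<omega>)"
        and H: "H \<in> events" "prob (space M - H) \<le> \<eta> / 2" "\<forall>\<omega>\<in>H. Q (n, \<omega>)" by blast
      have "prob (space M - G \<inter> H) \<le> prob ((space M - G) \<union> (space M - H))"
        using G H by (intro finite_measure_mono) auto
      also have "\<dots> \<le> prob (space M - G) + prob (space M - H)"
        using G H by (intro measure_Un_le) auto
      finally show ?case using G H by (intro bexI[of _ "G \<inter> H"]) auto
    qed
  qed
next
  fix P Q :: "nat \<times> 'a \<Rightarrow> bool"
  assume "\<forall>x. P x \<longrightarrow> Q x"
    and P: "\<forall>\<eta>>0. \<forall>\<^sub>F n in sequentially. \<exists>G\<in>events. prob (space M - G) \<le> \<eta> \<and> (\<forall>\<omega>\<in>G. P (n, \<omega>))"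
  then have mono: "(\<exists>G\<in>events. prob (space M - G) \<le> \<eta> \<and> (\<forall>\<omega>\<in>G. P (n, \<omega>))) \<Longrightarrow>
      (\<exists>G\<in>events. prob (space M - G) \<le> \<eta> \<and> (\<forall>\<omega>\<in>G. Q (n, \<omega>)))" for \<eta> n by blast
  show "\<forall>\<eta>>0. \<forall>\<^sub>F n in sequentially. \<exists>G\<in>events. prob (space M - G) \<le> \<eta> \<and> (\<forall>\<omega>\<in>G. Q (n, \<omega>))"
    using P by (auto elim: eventually_mono intro!: mono)
qed

lemma eventually_in_probI:
  assumes "\<forall>\<^sub>F n in sequentially. \<forall>\<omega>\<in>space M. P (n, \<omega>)"
  shows "eventually P (in_prob M)"
  unfolding eventually_in_prob
proof (intro allI impI)
  fix \<eta> :: real assume "0 < \<eta>"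
  show "\<forall>\<^sub>F n in sequentially. \<exists>G\<in>events. prob (space M - G) \<le> \<eta> \<and> (\<forall>\<omega>\<in>G. P (n, \<omega>))"
    using assms by eventually_elim (use \<open>0 < \<eta>\<close> in \<open>auto intro!: bexI[of _ "space M"]\<close>)
qed

lemma eventually_space: "\<forall>\<^sub>F (n, \<omega>) in in_prob M. N \<le> n \<and> \<omega> \<in> space M"
  by (rule eventually_in_probI) (use eventually_ge_at_top[of N] in eventually_elim, auto)

lemma eventually_in_probI':
  assumes "\<And>n \<omega>. N \<le> n \<Longrightarrow> \<omega> \<in> space M \<Longrightarrow> P (n, \<omega>)"
  shows "eventually P (in_prob M)"
  using eventually_space[of N] by eventually_elim (use assms in auto)

lemma filterlim_fst_in_prob: "filterlim fst sequentially (in_prob M)"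
  unfolding filterlim_def le_filter_def
proof (intro allI impI)
  fix P :: "nat \<Rightarrow> bool" assume "eventually P sequentially"
  then show "eventually P (filtermap fst (in_prob M))"
    unfolding eventually_filtermap by (intro eventually_in_probI) (auto elim: eventually_mono)
qed

lemma tendsto_in_probI:
  "f \<longlonglongrightarrow> l \<Longrightarrow> ((\<lambda>p. f (fst p)) \<longlongrightarrow> l) (in_prob M)"
  using filterlim_compose[OF _ filterlim_fst_in_prob] .

text \<open>Convergence in probability passes to subsequences while \<omega> stays fixed. This
  compares the information at \<open>n\<close> with the one at
  \<open>fourth_root_floor n\<close>.\<close>

lemma filterlim_subsequence_in_prob:
  assumes "filterlim N sequentially sequentially"
  shows "filterlim (\<lambda>p. (N (fst p), snd p)) (in_prob M) (in_prob M)"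
  unfolding filterlim_def le_filter_def
proof (intro allI impI)
  fix P assume "eventually P (in_prob M)"
  then show "eventually P (filtermap (\<lambda>p. (N (fst p), snd p)) (in_prob M))"
    unfolding eventually_filtermap eventually_in_prob
    using eventually_compose_filterlim[OF _ assms] by auto
qed

lemma tendsto_in_prob_iff:
  assumes [measurable]: "\<And>n. 1 \<le> n \<Longrightarrow> Z n \<in> borel_measurable M" "L \<in> borel_measurable M"
  shows "tendsto_in_prob M Z L \<longleftrightarrow> ((\<lambda>(n, \<omega>). Z n \<omega> - L \<omega>) \<longlongrightarrow> 0) (in_prob M)"
proof
  assume Z: "tendsto_in_prob M Z L"
  show "((\<lambda>(n, \<omega>). Z n \<omega> - L \<omega>) \<longlongrightarrow> 0) (in_prob M)"
    unfolding tendsto_iff eventually_in_prob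
  proof (intro allI impI)
    fix \<epsilon> \<eta> :: real assume e: "0 < \<epsilon>" "0 < \<eta>"
    \<comment> \<open>Half of \<epsilon> is used because the complement of the strict event gives
      only a weak inequality.\<close>
    then have "(\<lambda>n. prob {\<omega> \<in> space M. \<epsilon> / 2 < \<bar>Z n \<omega> - L \<omega>\<bar>}) \<longlonglongrightarrow> 0"
      using Z[unfolded tendsto_in_prob_def, rule_format, of "\<epsilon> / 2"] by simp
    then have "\<forall>\<^sub>F n in sequentially. prob {\<omega> \<in> space M. \<epsilon> / 2 < \<bar>Z n \<omega> - L \<omega>\<bar>} < \<eta>"
      using e by (intro order_tendstoD) auto
    then show "\<forall>\<^sub>F n in sequentially. \<exists>G\<in>events. prob (space M - G) \<le> \<eta> \<and>
        (\<forall>\<omega>\<in>G. dist (case (n, \<omega>) of (n, \<omega>) \<Rightarrow> Z n \<omega> - L \<omega>) 0 < \<epsilon>)"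
      using eventually_ge_at_top[of 1]
    proof eventually_elim
      case (elim n)
      have [measurable]: "Z n \<in> borel_measurable M" using elim(2) by measurable
      have "space M - {\<omega> \<in> space M. \<bar>Z n \<omega> - L \<omega>\<bar> \<le> \<epsilon> / 2} = {\<omega> \<in> space M. \<epsilon> / 2 < \<bar>Z n \<omega> - L \<omega>\<bar>}"
        by auto
      then show ?case using elim e
        by (intro bexI[of _ "{\<omega> \<in> space M. \<bar>Z n \<omega> - L \<omega>\<bar> \<le> \<epsilon> / 2}"]) auto
    qed
  qed
next
  assume Z: "((\<lambda>(n, \<omega>). Z n \<omega> - L \<omega>) \<longlongrightarrow> 0) (in_prob M)"
  show "tendsto_in_prob M Z L"
    unfolding tendsto_in_prob_def
  proof (intro allI impI)
    fix \<epsilon> :: real assume e: "0 < \<epsilon>"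
    then have ev: "\<forall>\<^sub>F p in in_prob M. dist (case p of (n, \<omega>) \<Rightarrow> Z n \<omega> - L \<omega>) 0 < \<epsilon>"
      using Z by (auto simp: tendsto_iff)
    show "(\<lambda>n. prob {\<omega> \<in> space M. \<epsilon> < \<bar>Z n \<omega> - L \<omega>\<bar>}) \<longlonglongrightarrow> 0"
    proof (rule tendstoI)
      fix \<eta> :: real assume "0 < \<eta>"
      then have "\<forall>\<^sub>F n in sequentially. \<exists>G\<in>events. prob (space M - G) \<le> \<eta> / 2 \<and>
        (\<forall>\<omega>\<in>G. dist (case (n, \<omega>) of (n, \<omega>) \<Rightarrow> Z n \<omega> - L \<omega>) 0 < \<epsilon>)"
        using ev unfolding eventually_in_prob by (auto dest: spec[of _ "\<eta> / 2"])
      then show "\<forall>\<^sub>F n in sequentially. dist (prob {\<omega> \<in> space M. \<epsilon> < \<bar>Z n \<omega> - L \<omega>\<bar>}) 0 < \<eta>"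
      proof eventually_elim
        case (elim n)
        then obtain G where G: "G \<in> events" "prob (space M - G) \<le> \<eta> / 2"
          "\<forall>\<omega>\<in>G. \<bar>Z n \<omega> - L \<omega>\<bar> < \<epsilon>" by (auto simp: dist_real_def)
        have "prob {\<omega> \<in> space M. \<epsilon> < \<bar>Z n \<omega> - L \<omega>\<bar>} \<le> prob (space M - G)"
          using G by (intro finite_measure_mono) fastforce+
        then show ?case using G \<open>0 < \<eta>\<close> by simp
      qed
    qed
  qed
qed

text \<open>Bounded convergence in probability: the integrand is small on the good set, and its
  bound is multiplied by a small probability elsewhere.\<close>

lemma tendsto_expectation_in_prob:
  fixes g :: "nat \<Rightarrow> 'a \<Rightarrow> 'b::{banach, second_countable_topology}"
  assumes [measurable]: "\<And>n. N \<le> n \<Longrightarrow> g n \<in> borel_measurable M"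
    and bound: "\<And>n \<omega>. N \<le> n \<Longrightarrow> \<omega> \<in> space M \<Longrightarrow> norm (g n \<omega>) \<le> C"
    and lim: "((\<lambda>(n, \<omega>). g n \<omega>) \<longlongrightarrow> 0) (in_prob M)"
  shows "(\<lambda>n. \<integral>\<omega>. g n \<omega> \<partial>M) \<longlonglongrightarrow> 0"
proof (rule tendstoI)
  fix \<epsilon> :: real assume e: "0 < \<epsilon>"
  obtain \<omega>0 where "\<omega>0 \<in> space M" using not_empty by blast
  then have C: "0 \<le> C" using bound[of N \<omega>0] norm_ge_zero order_trans by blast
  \<comment> \<open>The added 1 keeps the quotient meaningful when \<open>C = 0\<close>.\<close>
  define \<eta> where "\<eta> = \<epsilon> / (2 * (C + 1))"
  have eta: "0 < \<eta>" using e C by (simp add: \<eta>_def)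
  have "\<forall>\<^sub>F p in in_prob M. dist (case p of (n, \<omega>) \<Rightarrow> g n \<omega>) 0 < \<epsilon> / 4"
    using e by (intro tendstoD[OF lim]) auto
  then have "\<forall>\<^sub>F n in sequentially. \<exists>G\<in>events. prob (space M - G) \<le> \<eta> \<and>
        (\<forall>\<omega>\<in>G. norm (g n \<omega>) < \<epsilon> / 4)"
    using eta unfolding eventually_in_prob by simp
  then show "\<forall>\<^sub>F n in sequentially. dist (\<integral>\<omega>. g n \<omega> \<partial>M) 0 < \<epsilon>"
    using eventually_ge_at_top[of N]
  proof eventually_elim
    case (elim n)
    then obtain G where G[measurable]: "G \<in> events" and Gp: "prob (space M - G) \<le> \<eta>"
      and Gn: "\<And>\<omega>. \<omega> \<in> G \<Longrightarrow> norm (g n \<omega>) < \<epsilon> / 4" by blast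
    have [measurable]: "g n \<in> borel_measurable M" using elim(2) by measurable
    have I: "integrable M (g n)"
      using bound[OF elim(2)] by (intro integrable_const_bound[where B = C] AE_I2) auto
    have "norm (\<integral>\<omega>. g n \<omega> \<partial>M) \<le> (\<integral>\<omega>. norm (g n \<omega>) \<partial>M)" by (rule integral_norm_bound)
    also have "\<dots> \<le> (\<integral>\<omega>. \<epsilon> / 4 + C * indicator (space M - G) \<omega> \<partial>M)"
      using I e C Gn bound[OF elim(2)]
      by (intro integral_mono integrable_norm Bochner_Integration.integrable_add
          integrable_const integrable_mult_right integrable_real_indicator)
        (auto simp: indicator_def less_top[symmetric] intro: less_imp_le add_increasing)
    also have "\<dots> = \<epsilon> / 4 + C * prob (space M - G)"
      by (subst Bochner_Integration.integral_add) (auto simp: prob_space less_top[symmetric])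
    also have "\<dots> \<le> \<epsilon> / 4 + C * \<eta>" using Gp C by (intro add_left_mono mult_left_mono)
    also have "C * \<eta> \<le> \<epsilon> / 2" using C e by (simp add: \<eta>_def field_simps)
    finally show ?case using e by simp
  qed
qed

lemma prob_square_bound:
  assumes [measurable]: "Y \<in> borel_measurable M"
    and "integrable M (\<lambda>\<omega>. (Y \<omega>)\<^sup>2)" "(\<integral>\<omega>. (Y \<omega>)\<^sup>2 \<partial>M) \<le> C" "0 < R"
  shows "prob {\<omega> \<in> space M. R \<le> \<bar>Y \<omega>\<bar>} \<le> C / R\<^sup>2"
proof -
  have "{\<omega> \<in> space M. R \<le> \<bar>Y \<omega>\<bar>} = {\<omega> \<in> space M. R\<^sup>2 \<le> (Y \<omega>)\<^sup>2}"
    using assms(4) by (auto simp: abs_le_square_iff[symmetric])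
  also have "prob \<dots> \<le> (\<integral>\<omega>. (Y \<omega>)\<^sup>2 \<partial>M) / R\<^sup>2"
    using assms by (intro integral_Markov_inequality_measure[where A = "{}"]) auto
  also have "\<dots> \<le> C / R\<^sup>2" using assms by (intro divide_right_mono) auto
  finally show ?thesis .
qed

text \<open>Bounded second moments make the sequence \<open>Y\<close> tight by Chebyshev's
  inequality, and a tight sequence times one that vanishes in probability vanishes in
  probability.\<close>

lemma tendsto_mult_bounded_in_prob:
  assumes Y: "\<And>n. 1 \<le> n \<Longrightarrow> Y n \<in> borel_measurable M"
    "\<And>n. 1 \<le> n \<Longrightarrow> integrable M (\<lambda>\<omega>. (Y n \<omega>)\<^sup>2)"
    "\<And>n. 1 \<le> n \<Longrightarrow> (\<integral>\<omega>. (Y n \<omega>)\<^sup>2 \<partial>M) \<le> C"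
    and \<rho>: "((\<lambda>(n, \<omega>). \<rho> n \<omega>) \<longlongrightarrow> 0) (in_prob M)"
  shows "((\<lambda>(n, \<omega>). Y n \<omega> * \<rho> n \<omega> :: real) \<longlongrightarrow> 0) (in_prob M)"
  unfolding tendsto_iff eventually_in_prob
proof (intro allI impI)
  fix \<epsilon> \<eta> :: real assume e: "0 < \<epsilon>" "0 < \<eta>"
  \<comment> \<open>Chosen such that \<open>\<bar>Y n\<bar>\<close> reaches \<open>R\<close> with
    probability at most half of \<eta>.\<close>
  define R where "R = sqrt (2 * (\<bar>C\<bar> + 1) / \<eta>)"
  have R: "0 < R" "R\<^sup>2 = 2 * (\<bar>C\<bar> + 1) / \<eta>" using e by (auto simp: R_def)
  have "C * \<eta> \<le> (\<bar>C\<bar> + 1) * \<eta>" using e by (intro mult_right_mono) auto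
  then have CR: "C / R\<^sup>2 \<le> \<eta> / 2" unfolding R using e by (simp add: field_simps)
  have "\<forall>\<^sub>F p in in_prob M. dist (case p of (n, \<omega>) \<Rightarrow> \<rho> n \<omega>) 0 < \<epsilon> / R"
    using \<rho> e R(1) by (auto simp: tendsto_iff)
  then have "\<forall>\<^sub>F n in sequentially. \<exists>G\<in>events. prob (space M - G) \<le> \<eta> / 2 \<and>
        (\<forall>\<omega>\<in>G. \<bar>\<rho> n \<omega>\<bar> < \<epsilon> / R)"
    using e unfolding eventually_in_prob by (auto dest: spec[of _ "\<eta> / 2"])
  then show "\<forall>\<^sub>F n in sequentially. \<exists>G\<in>events. prob (space M - G) \<le> \<eta> \<and>
        (\<forall>\<omega>\<in>G. dist (case (n, \<omega>) of (n, \<omega>) \<Rightarrow> Y n \<omega> * \<rho> n \<omega>) 0 < \<epsilon>)"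
    using eventually_ge_at_top[of 1]
  proof eventually_elim
    case (elim n)
    then obtain G where G[measurable]: "G \<in> events" and Gp: "prob (space M - G) \<le> \<eta> / 2"
      and Gn: "\<And>\<omega>. \<omega> \<in> G \<Longrightarrow> \<bar>\<rho> n \<omega>\<bar> < \<epsilon> / R" by blast
    note [measurable] = Y(1)[OF elim(2)]
    let ?H = "{\<omega> \<in> space M. \<bar>Y n \<omega>\<bar> < R}"
    have "prob (space M - G \<inter> ?H) \<le> prob ((space M - G) \<union> {\<omega> \<in> space M. R \<le> \<bar>Y n \<omega>\<bar>})"
      by (intro finite_measure_mono) auto
    also have "\<dots> \<le> prob (space M - G) + prob {\<omega> \<in> space M. R \<le> \<bar>Y n \<omega>\<bar>}"
      by (intro measure_Un_le) auto
    also have "\<dots> \<le> \<eta> / 2 + \<eta> / 2"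
      using Gp prob_square_bound[OF Y[OF elim(2)] R(1)] CR by linarith
    finally have "prob (space M - G \<inter> ?H) \<le> \<eta>" by simp
    moreover have "\<bar>Y n \<omega> * \<rho> n \<omega>\<bar> < \<epsilon>" if "\<omega> \<in> G \<inter> ?H" for \<omega>
    proof -
      have "\<bar>Y n \<omega>\<bar> * \<bar>\<rho> n \<omega>\<bar> < R * (\<epsilon> / R)"
        using Gn[of \<omega>] that by (intro mult_strict_mono') auto
      then show ?thesis using R(1) by (simp add: abs_mult)
    qed
    ultimately show ?case by (intro bexI[of _ "G \<inter> ?H"]) auto
  qed
qed

end

section \<open>Continuous mapping and weak convergence to normal laws\<close>

text \<open>A continuous mapping rule for two sequences that approach each other without a common
  constant limit; uniform continuity on a compact set replaces continuity at the limit.\<close>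

lemma tendsto_uniformly_continuous_diff:
  fixes \<phi> :: "'a::metric_space \<Rightarrow> 'b::real_normed_vector"
  assumes "compact S" "continuous_on S \<phi>"
    and "\<forall>\<^sub>F p in F. f p \<in> S \<and> g p \<in> S"
    and "((\<lambda>p. dist (f p) (g p)) \<longlongrightarrow> 0) F"
  shows "((\<lambda>p. \<phi> (f p) - \<phi> (g p)) \<longlongrightarrow> 0) F"
proof (rule tendstoI)
  fix e :: real assume "0 < e"
  with compact_uniformly_continuous[OF assms(2,1)] obtain \<delta> where d: "0 < \<delta>"
    "\<And>x y. x \<in> S \<Longrightarrow> y \<in> S \<Longrightarrow> dist x y < \<delta> \<Longrightarrow> dist (\<phi> x) (\<phi> y) < e"
    unfolding uniformly_continuous_on_def by blast
  have "\<forall>\<^sub>F p in F. dist (f p) (g p) < \<delta>"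
    using order_tendstoD(2)[OF assms(4) d(1)] .
  with assms(3) show "\<forall>\<^sub>F p in F. dist (\<phi> (f p) - \<phi> (g p)) 0 < e"
    by eventually_elim (use d(2) in \<open>auto simp: dist_norm\<close>)
qed

lemma real_distribution_normal:
  assumes "0 < \<sigma>"
  shows "real_distribution (density lborel (normal_density 0 \<sigma>))"
  using prob_space_normal_density[OF assms, of 0]
  by (simp add: real_distribution_def real_distribution_axioms_def)

text \<open>A centred normal variable is a scaled standard normal one.\<close>

lemma char_normal:
  assumes s: "0 < \<sigma>"
  shows "char (density lborel (normal_density 0 \<sigma>)) u = complex_of_real (exp (- (\<sigma> * u)\<^sup>2 / 2))"
proof -
  interpret std: prob_space std_normal_distribution
    by (rule prob_space_normal_density) simp
  have "distributed std_normal_distribution lborel (\<lambda>x. x) (normal_density 0 1)"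
    unfolding distributed_def by (auto simp: distr_id2)
  from std.normal_density_affine[OF this, of \<sigma> 0] s
  have "distributed std_normal_distribution lborel (\<lambda>x. \<sigma> * x) (normal_density 0 \<sigma>)" by simp
  then have eq: "density lborel (normal_density 0 \<sigma>) = distr std_normal_distribution lborel (\<lambda>x. \<sigma> * x)"
    by (simp add: distributed_def)
  have "char (density lborel (normal_density 0 \<sigma>)) u = char std_normal_distribution (\<sigma> * u)"
    unfolding eq char_def by (subst integral_distr) (auto simp: mult_ac)
  then show ?thesis by (simp add: char_std_normal_distribution)
qed

text \<open>The index \<open>0\<close> is excluded because \<open>tau d 0\<close> is a junk value, at which nothing is measurable.\<close>

lemma (in prob_space) weak_conv_normal:
  assumes s: "0 < \<sigma>"
    and A: "\<And>n. 1 \<le> n \<Longrightarrow> A n \<in> borel_measurable M"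
    and W: "\<And>n. 1 \<le> n \<Longrightarrow> W n \<in> borel_measurable M"
    and diff: "((\<lambda>(n, \<omega>). A n \<omega> - \<sigma> * W n \<omega>) \<longlongrightarrow> 0) (in_prob M)"
    and lim: "\<And>u. (\<lambda>n. \<integral>\<omega>. iexp (u * W n \<omega>) \<partial>M) \<longlonglongrightarrow> complex_of_real (exp (- u\<^sup>2 / 2))"
  shows "weak_conv_m (\<lambda>n. distr M borel (A n)) (density lborel (normal_density 0 \<sigma>))"
proof -
  have meas_iexp: "(\<lambda>\<omega>. iexp (f \<omega>)) \<in> borel_measurable M" if "f \<in> borel_measurable M" for f :: "'a \<Rightarrow> real"
    using that by measurable
  \<comment> \<open>Levy's theorem needs a probability distribution at every index, hence the shift
    to \<open>Suc n\<close>, which is undone at the end.\<close>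
  have "weak_conv_m (\<lambda>n. distr M borel (A (Suc n))) (density lborel (normal_density 0 \<sigma>))"
  proof (rule levy_continuity)
    show "real_distribution (distr M borel (A (Suc n)))" for n
      using A[of "Suc n"] by (intro real_distribution_distr) auto
    show "real_distribution (density lborel (normal_density 0 \<sigma>))"
      by (rule real_distribution_normal[OF s])
    fix u :: real
    have "((\<lambda>p. iexp (u * (case p of (n, \<omega>) \<Rightarrow> A n \<omega> - \<sigma> * W n \<omega>))) \<longlongrightarrow> iexp (u * 0)) (in_prob M)"
      by (intro tendsto_intros diff)
    then have 0: "((\<lambda>p. norm (iexp (u * (case p of (n, \<omega>) \<Rightarrow> A n \<omega> - \<sigma> * W n \<omega>)) - 1)) \<longlongrightarrow> 0) (in_prob M)"
      by (auto simp: tendsto_norm_zero_iff LIM_zero_iff)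
    \<comment> \<open>Factoring out an exponential of modulus one reduces the difference of two
      characteristic exponentials to the difference of their arguments.\<close>
    have eq: "norm (iexp (u * (A n \<omega> - \<sigma> * W n \<omega>)) - 1) =
        norm (iexp (u * A n \<omega>) - iexp (u * \<sigma> * W n \<omega>))" for n \<omega>
    proof -
      have "iexp (u * A n \<omega>) - iexp (u * \<sigma> * W n \<omega>) =
          iexp (u * \<sigma> * W n \<omega>) * (iexp (u * (A n \<omega> - \<sigma> * W n \<omega>)) - 1)"
        by (simp add: right_diff_distrib exp_add[symmetric] distrib_left[symmetric])
      then show ?thesis by (simp add: norm_mult)
    qed
    have 1: "((\<lambda>(n, \<omega>). iexp (u * A n \<omega>) - iexp (u * \<sigma> * W n \<omega>)) \<longlongrightarrow> 0) (in_prob M)"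
      using 0 unfolding case_prod_beta' eq by (rule tendsto_norm_zero_cancel)
    have 2: "(\<lambda>n. \<integral>\<omega>. iexp (u * A n \<omega>) - iexp (u * \<sigma> * W n \<omega>) \<partial>M) \<longlonglongrightarrow> 0"
      using A W 1
      by (intro tendsto_expectation_in_prob[where N = 1 and C = 2])
        (auto intro!: order_trans[OF norm_triangle_ineq4] borel_measurable_diff meas_iexp)
    have int: "integrable M (\<lambda>\<omega>. iexp (f \<omega>))" if "f \<in> borel_measurable M" for f
      using that by (intro integrable_const_bound[where B = 1] AE_I2) auto
    have "(\<lambda>n. (\<integral>\<omega>. iexp (u * A n \<omega>) - iexp (u * \<sigma> * W n \<omega>) \<partial>M) + (\<integral>\<omega>. iexp (u * \<sigma> * W n \<omega>) \<partial>M))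
        \<longlonglongrightarrow> 0 + complex_of_real (exp (- (u * \<sigma>)\<^sup>2 / 2))"
      by (intro tendsto_add 2 lim)
    moreover have "\<forall>\<^sub>F n in sequentially. (\<integral>\<omega>. iexp (u * A n \<omega>) - iexp (u * \<sigma> * W n \<omega>) \<partial>M) +
        (\<integral>\<omega>. iexp (u * \<sigma> * W n \<omega>) \<partial>M) = (\<integral>\<omega>. iexp (u * A n \<omega>) \<partial>M)"
      using eventually_ge_at_top[of 1]
    proof eventually_elim
      case (elim n)
      have "integrable M (\<lambda>\<omega>. iexp (u * A n \<omega>))" "integrable M (\<lambda>\<omega>. iexp (u * \<sigma> * W n \<omega>))"
        by (intro int borel_measurable_times borel_measurable_const A[OF elim] W[OF elim])+
      then show ?case by simp
    qed
    ultimately have lim_A: "(\<lambda>n. \<integral>\<omega>. iexp (u * A n \<omega>) \<partial>M) \<longlonglongrightarrow> complex_of_real (exp (- (\<sigma> * u)\<^sup>2 / 2))"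
      by (auto dest: Lim_transform_eventually simp: mult.commute)
    have char_A: "char (distr M borel (A (Suc n))) u = (\<integral>\<omega>. iexp (u * A (Suc n) \<omega>) \<partial>M)" for n
      unfolding char_def using A[of "Suc n"] by (subst integral_distr) auto
    show "(\<lambda>n. char (distr M borel (A (Suc n))) u) \<longlonglongrightarrow> char (density lborel (normal_density 0 \<sigma>)) u"
      unfolding char_normal[OF s] char_A by (rule LIMSEQ_Suc[OF lim_A])
  qed
  then show ?thesis
    unfolding weak_conv_m_def weak_conv_def
    using LIMSEQ_imp_Suc[of "\<lambda>n. cdf (distr M borel (A n)) _"] by simp
qed

lemma cesaro_null:
  fixes x :: "nat \<Rightarrow> real"
  assumes x: "x \<longlonglongrightarrow> 0"
  shows "(\<lambda>n. (\<Sum>i<n. x i) / real n) \<longlonglongrightarrow> 0"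
proof (rule LIMSEQ_I)
  fix e :: real assume e: "0 < e"
  obtain N where N: "\<And>n. N \<le> n \<Longrightarrow> \<bar>x n\<bar> < e / 2"
    using LIMSEQ_D[OF x, of "e / 2"] e by auto
  define C where "C = (\<Sum>i<N. \<bar>x i\<bar>)"
  obtain K :: nat where K: "2 * C / e < real K" using reals_Archimedean2 by blast
  show "\<exists>no. \<forall>n\<ge>no. norm ((\<Sum>i<n. x i) / real n - 0) < e"
  proof (intro exI allI impI)
    fix n assume n: "max 1 (max N K) \<le> n"
    have "\<bar>\<Sum>i<n. x i\<bar> \<le> (\<Sum>i<n. \<bar>x i\<bar>)" by (rule sum_abs)
    also have "(\<Sum>i<n. \<bar>x i\<bar>) = C + (\<Sum>i=N..<n. \<bar>x i\<bar>)"
      using sum.atLeastLessThan_concat[of 0 N n "\<lambda>i. \<bar>x i\<bar>"] n by (simp add: C_def lessThan_atLeast0)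
    also have "(\<Sum>i=N..<n. \<bar>x i\<bar>) \<le> real n * (e / 2)"
    proof -
      have "(\<Sum>i=N..<n. \<bar>x i\<bar>) \<le> real (card {N..<n}) * (e / 2)"
        using N by (intro sum_bounded_above) (auto intro: less_imp_le)
      also have "\<dots> \<le> real n * (e / 2)" using e by (intro mult_right_mono) auto
      finally show ?thesis .
    qed
    also have "C + real n * (e / 2) < real n * e"
    proof -
      have "2 * C / e < real n" using K n by simp
      then show ?thesis using e by (simp add: field_simps)
    qed
    finally have "\<bar>\<Sum>i<n. x i\<bar> < real n * e" by simp
    then show "norm ((\<Sum>i<n. x i) / real n - 0) < e"
      using n by (simp add: field_simps)
  qed
qed

lemma (in prob_space) tendsto_in_prob_L1:
  fixes g :: "nat \<Rightarrow> 'a \<Rightarrow> real"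
  assumes int: "\<And>n. 1 \<le> n \<Longrightarrow> integrable M (g n)"
    and lim: "(\<lambda>n. \<integral>\<omega>. \<bar>g n \<omega>\<bar> \<partial>M) \<longlonglongrightarrow> 0"
  shows "((\<lambda>(n, \<omega>). g n \<omega>) \<longlongrightarrow> 0) (in_prob M)"
proof -
  have "tendsto_in_prob M g (\<lambda>_. 0)"
    unfolding tendsto_in_prob_def
  proof (intro allI impI)
    fix \<epsilon> :: real assume e: "0 < \<epsilon>"
    show "(\<lambda>n. prob {\<omega> \<in> space M. \<epsilon> < \<bar>g n \<omega> - 0\<bar>}) \<longlonglongrightarrow> 0"
    proof (rule Lim_null_comparison)
      show "\<forall>\<^sub>F n in sequentially. norm (prob {\<omega> \<in> space M. \<epsilon> < \<bar>g n \<omega> - 0\<bar>}) \<le>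
          (\<integral>\<omega>. \<bar>g n \<omega>\<bar> \<partial>M) / \<epsilon>"
        using eventually_ge_at_top[of 1]
      proof eventually_elim
        case (elim n)
        note [measurable] = borel_measurable_integrable[OF int[OF elim]]
        have "prob {\<omega> \<in> space M. \<epsilon> < \<bar>g n \<omega> - 0\<bar>} \<le> prob {\<omega> \<in> space M. \<epsilon> \<le> \<bar>g n \<omega>\<bar>}"
          by (intro finite_measure_mono) auto
        also have "\<dots> \<le> (\<integral>\<omega>. \<bar>g n \<omega>\<bar> \<partial>M) / \<epsilon>"
          using e int[OF elim] by (intro integral_Markov_inequality_measure[where A = "{}"]) auto
        finally show ?case by simp
      qed
      show "(\<lambda>n. (\<integral>\<omega>. \<bar>g n \<omega>\<bar> \<partial>M) / \<epsilon>) \<longlonglongrightarrow> 0"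
        using tendsto_divide[OF lim tendsto_const[of \<epsilon>]] e by simp
    qed
  qed
  then show ?thesis
    using int by (subst (asm) tendsto_in_prob_iff) (auto dest: borel_measurable_integrable)
qed

definition fourth_root_floor :: "nat \<Rightarrow> nat" where
  "fourth_root_floor n = nat \<lfloor>real n powr (1 / 4)\<rfloor>"

lemma fourth_root_floor:
  assumes "1 \<le> n"
  shows "1 \<le> fourth_root_floor n" "fourth_root_floor n \<le> n"
    "real (fourth_root_floor n) \<le> real n powr (1 / 4)"
proof -
  have 1: "1 \<le> real n powr (1 / 4)" using assms by (intro ge_one_powr_ge_zero) auto
  then have "1 \<le> \<lfloor>real n powr (1 / 4)\<rfloor>" by simp
  then show "1 \<le> fourth_root_floor n" unfolding fourth_root_floor_def by linarith
  show 2: "real (fourth_root_floor n) \<le> real n powr (1 / 4)"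
    unfolding fourth_root_floor_def using 1 by (simp add: of_nat_nat)
  have "real n powr (1 / 4) \<le> real n powr 1" using assms by (intro powr_mono) auto
  then have "real (fourth_root_floor n) \<le> real n" using 2 assms by simp
  then show "fourth_root_floor n \<le> n" by simp
qed

lemma filterlim_fourth_root_floor: "filterlim fourth_root_floor at_top at_top"
  unfolding fourth_root_floor_def by real_asymp

section \<open>The history filtration\<close>

text \<open>The count at time \<open>Suc t\<close> depends only on decisions up to time
  \<open>t\<close>; this shift by one makes \<open>tau\<close> a stopping time. The measure
  \<open>N\<close> is left open so that the lemma serves both the history and the whole
  space.\<close>

lemma measurable_num_items:
  assumes "\<And>s. 1 \<le> s \<Longrightarrow> s \<le> t \<Longrightarrow> d s \<in> N \<rightarrow>\<^sub>M count_space UNIV" "s \<le> Suc t"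
  shows "(\<lambda>\<omega>. num_items (\<lambda>u. d u \<omega>) s) \<in> N \<rightarrow>\<^sub>M count_space UNIV"
  using assms(2)
proof (induction s)
  case (Suc s)
  have [measurable]: "(\<lambda>\<omega>. num_items (\<lambda>u. d u \<omega>) s) \<in> N \<rightarrow>\<^sub>M count_space UNIV"
    using Suc by simp
  show ?case
  proof (cases "s = 0")
    case False
    then have [measurable]: "d s \<in> N \<rightarrow>\<^sub>M count_space UNIV" using assms(1)[of s] Suc.prems by simp
    show ?thesis using False by (simp add: new_item_def)
  qed (simp add: new_item_def)
qed simp

lemma measurable_next_item:
  assumes "\<And>s. 1 \<le> s \<Longrightarrow> s \<le> t \<Longrightarrow> d s \<in> N \<rightarrow>\<^sub>M count_space UNIV" "s \<le> t"
  shows "(\<lambda>\<omega>. next_item (\<lambda>u. d u \<omega>) s) \<in> N \<rightarrow>\<^sub>M count_space UNIV"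
proof -
  have [measurable]: "(\<lambda>\<omega>. num_items (\<lambda>u. d u \<omega>) s) \<in> N \<rightarrow>\<^sub>M count_space UNIV"
    using assms by (intro measurable_num_items[of t]) auto
  show ?thesis
  proof (cases "s = 0")
    case False
    then have [measurable]: "d s \<in> N \<rightarrow>\<^sub>M count_space UNIV" using assms(1)[of s] assms(2) by simp
    show ?thesis using False by (simp add: new_item_def next_item_def)
  qed (simp add: new_item_def next_item_def)
qed

lemma measurable_attempts:
  assumes "\<And>s. 1 \<le> s \<Longrightarrow> s \<le> t \<Longrightarrow> d s \<in> N \<rightarrow>\<^sub>M count_space UNIV" "s \<le> Suc t"
  shows "(\<lambda>\<omega>. attempts (\<lambda>u. d u \<omega>) s i) \<in> N \<rightarrow>\<^sub>M count_space UNIV"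
  using assms(2)
proof (induction s)
  case (Suc s)
  have [measurable]: "(\<lambda>\<omega>. attempts (\<lambda>u. d u \<omega>) s i) \<in> N \<rightarrow>\<^sub>M count_space UNIV"
    using Suc by simp
  have [measurable]: "(\<lambda>\<omega>. next_item (\<lambda>u. d u \<omega>) s) \<in> N \<rightarrow>\<^sub>M count_space UNIV"
    using Suc.prems assms(1) by (intro measurable_next_item[of t]) auto
  show ?case by simp
qed simp

lemma answers_0 [simp]: "answers X i 0 \<omega> = []"
  by (simp add: answers_def)

lemma answers_Suc: "answers X i (Suc j) \<omega> = answers X i j \<omega> @ [X i (Suc j) \<omega>]"
  by (simp add: answers_def)

lemma take_answers: "j \<le> l \<Longrightarrow> take j (answers X i l \<omega>) = answers X i j \<omega>"
  by (simp add: answers_def take_map del: upt_Suc)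

lemma length_answers [simp]: "length (answers X i j \<omega>) = j"
  by (simp add: answers_def)

lemma measurable_discrete2:
  fixes f :: "'a \<Rightarrow> 'b::countable" and g :: "'a \<Rightarrow> 'c::countable"
  assumes f: "f \<in> N \<rightarrow>\<^sub>M count_space UNIV" and g: "g \<in> N \<rightarrow>\<^sub>M count_space UNIV"
  shows "(\<lambda>\<omega>. h (f \<omega>) (g \<omega>)) \<in> N \<rightarrow>\<^sub>M count_space UNIV"
proof -
  have "(\<lambda>\<omega>. h i (g \<omega>)) \<in> N \<rightarrow>\<^sub>M count_space UNIV" for i
    by (rule measurable_compose[OF g, where g = "h i"]) simp
  then show ?thesis by (rule measurable_compose_countable[OF _ f])
qed

context cat_revision
begin

section \<open>Score and information as sums over response times\<close>

abbreviation "hist \<equiv> hist_algebra M d X"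

text \<open>The index \<open>t\<close> refers to response \<open>t + 1\<close>: its item, the
  earlier answers to that item and its information are known at time \<open>t\<close>, its score
  contribution only at time \<open>Suc t\<close>.\<close>

definition item_at :: "nat \<Rightarrow> 'w \<Rightarrow> nat" where
  "item_at t \<omega> = next_item (\<lambda>u. d u \<omega>) t"

definition past :: "nat \<Rightarrow> 'w \<Rightarrow> 'k option list" where
  "past t \<omega> = answers X (item_at t \<omega>) (attempts (\<lambda>u. d u \<omega>) t (item_at t \<omega>)) \<omega>"

definition score_term :: "real \<Rightarrow> nat \<Rightarrow> 'w \<Rightarrow> real" where
  "score_term \<xi> t \<omega> = nrm_s \<xi> (b (item_at t \<omega>) \<omega>) (past t \<omega>) (response d X t \<omega>)"

definition info_term :: "real \<Rightarrow> nat \<Rightarrow> 'w \<Rightarrow> real" where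
  "info_term \<xi> t \<omega> = nrm_J \<xi> (b (item_at t \<omega>) \<omega>) (past t \<omega>)"

lemma valid: "\<omega> \<in> space M \<Longrightarrow> valid_decisions m (\<lambda>u. d u \<omega>)"
  using d_range m_ge by (simp add: valid_decisions_def)

lemma item_at_ge_1: "\<omega> \<in> space M \<Longrightarrow> 1 \<le> item_at t \<omega>"
  using next_item_range[OF valid, of \<omega> t] by (simp add: item_at_def)

lemma item_at_le: "\<omega> \<in> space M \<Longrightarrow> item_at t \<omega> \<le> num_items (\<lambda>u. d u \<omega>) (Suc t)"
  using next_item_range[OF valid, of \<omega> t] by (simp add: item_at_def)

lemma b_item_at: "\<omega> \<in> space M \<Longrightarrow> b (item_at t \<omega>) \<omega> \<in> B"
  by (intro b_range item_at_ge_1)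

text \<open>Fewer than \<open>m - 1\<close> earlier answers cannot exhaust \<open>m\<close>
  categories, so the conditional probabilities never have a vanishing denominator.\<close>

lemma set_past: "\<omega> \<in> space M \<Longrightarrow> set (past t \<omega>) \<noteq> UNIV"
proof
  assume "\<omega> \<in> space M" "set (past t \<omega>) = UNIV"
  then have "m \<le> length (past t \<omega>)"
    using card_length[of "past t \<omega>"] m_eq by simp
  moreover have "length (past t \<omega>) < m - 1"
    using attempts_next_item_less[OF valid, of \<omega> t] \<open>\<omega> \<in> space M\<close> by (simp add: past_def item_at_def)
  ultimately show False by simp
qed

lemma past_Nil:
  assumes "\<omega> \<in> space M" "new_item (\<lambda>u. d u \<omega>) t"
  shows "past t \<omega> = []"
  using attempts_new_item[OF valid[OF assms(1)] assms(2)] by (simp add: past_def item_at_def)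

lemma answers_snoc:
  "answers X (item_at t \<omega>) (attempts (\<lambda>u. d u \<omega>) (Suc t) (item_at t \<omega>)) \<omega> =
    past t \<omega> @ [response d X t \<omega>]"
  by (simp add: past_def response_def item_at_def Let_def answers_Suc)

text \<open>The distinctness assumption at time \<open>Suc t\<close> covers the list to which this
  response has just been appended.\<close>

lemma response_notin_past: "\<omega> \<in> space M \<Longrightarrow> response d X t \<omega> \<notin> set (past t \<omega>)"
  using X_distinct[of \<omega> "item_at t \<omega>" "Suc t"] item_at_ge_1[of \<omega> t] unfolding answers_snoc by simp

lemma score_eq:
  assumes "\<omega> \<in> space M"
  shows "score b d X T \<xi> \<omega> = (\<Sum>t<T. score_term \<xi> t \<omega>)"
proof -
  let ?\<delta> = "\<lambda>u. d u \<omega>"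
  \<comment> \<open>For \<open>j = 1\<close> the history is empty, so the separately listed first
    answer becomes an ordinary summand.\<close>
  define h where "h i j = nrm_s \<xi> (b i \<omega>) (answers X i (j - 1) \<omega>) (X i j \<omega>)" for i j
  have "score b d X T \<xi> \<omega> = (\<Sum>i = 1..num_items ?\<delta> T. \<Sum>j = 1..attempts ?\<delta> T i. h i j)"
    unfolding score_def
  proof (rule sum.cong)
    fix i assume "i \<in> {1..num_items ?\<delta> T}"
    then have "1 \<le> attempts ?\<delta> T i" using attempts_bounds[OF valid[OF assms]] by simp
    then show "nrm_s \<xi> (b i \<omega>) [] (X i 1 \<omega>) + (\<Sum>j = 2..attempts ?\<delta> T i.
        nrm_s \<xi> (b i \<omega>) (answers X i (j - 1) \<omega>) (X i j \<omega>)) = (\<Sum>j = 1..attempts ?\<delta> T i. h i j)"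
      by (simp add: sum.atLeast_Suc_atMost[of "Suc 0"] h_def numeral_2_eq_2)
  qed simp
  then show ?thesis
    unfolding sum_attempts[OF valid[OF assms]]
    by (simp add: h_def score_term_def past_def response_def item_at_def Let_def)
qed

lemma info_eq:
  assumes "\<omega> \<in> space M"
  shows "info b d X T \<xi> \<omega> = (\<Sum>t<T. info_term \<xi> t \<omega>)"
proof -
  let ?\<delta> = "\<lambda>u. d u \<omega>"
  define h where "h i j = nrm_J \<xi> (b i \<omega>) (answers X i (j - 1) \<omega>)" for i j :: nat
  have "info b d X T \<xi> \<omega> = (\<Sum>i = 1..num_items ?\<delta> T. \<Sum>j = 1..attempts ?\<delta> T i. h i j)"
    unfolding info_def info_rev_def sum.distrib[symmetric]
  proof (rule sum.cong)
    fix i assume "i \<in> {1..num_items ?\<delta> T}"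
    then have "1 \<le> attempts ?\<delta> T i" using attempts_bounds[OF valid[OF assms]] by simp
    then show "nrm_J \<xi> (b i \<omega>) [] + (\<Sum>j = 2..attempts ?\<delta> T i.
        nrm_J \<xi> (b i \<omega>) (answers X i (j - 1) \<omega>)) = (\<Sum>j = 1..attempts ?\<delta> T i. h i j)"
      by (simp add: sum.atLeast_Suc_atMost[of "Suc 0"] h_def numeral_2_eq_2)
  qed simp
  then show ?thesis
    unfolding sum_attempts[OF valid[OF assms]]
    by (simp add: h_def info_term_def past_def item_at_def)
qed

section \<open>Measurability with respect to the history\<close>

lemma space_hist [simp]: "space (hist t) = space M"
  unfolding hist_algebra_def by (rule space_measure_of) auto

lemma sets_hist: "sets (hist t) = sigma_sets (space M)
     ({{\<omega> \<in> space M. num_items (\<lambda>u. d u \<omega>) s = l} | s l. s \<in> {1..t}} \<union>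
      {{\<omega> \<in> space M. d s \<omega> = l} | s l. s \<in> {1..t}} \<union>
      {{\<omega> \<in> space M. answers X i (attempts (\<lambda>u. d u \<omega>) t i) \<omega> = xs} | i xs. 1 \<le> i})"
  unfolding hist_algebra_def by (rule sets_measure_of) auto

lemma measurable_hist_generator:
  fixes f :: "'w \<Rightarrow> 'z::countable"
  assumes "\<And>l. {\<omega> \<in> space M. f \<omega> = l} \<in> sets (hist t)"
  shows "f \<in> hist t \<rightarrow>\<^sub>M count_space UNIV"
proof -
  have "f -` {l} \<inter> space (hist t) = {\<omega> \<in> space M. f \<omega> = l}" for l by auto
  then show ?thesis using assms by (simp add: measurable_count_space_eq2_countable)
qed

lemma d_hist: "1 \<le> s \<Longrightarrow> s \<le> t \<Longrightarrow> d s \<in> hist t \<rightarrow>\<^sub>M count_space UNIV"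
proof (rule measurable_hist_generator)
  fix l assume "1 \<le> s" "s \<le> t"
  then have s: "s \<in> {1..t}" by simp
  show "{\<omega> \<in> space M. d s \<omega> = l} \<in> sets (hist t)"
    unfolding sets_hist
    by (rule sigma_sets.Basic, rule UnI1, rule UnI2, rule CollectI) (rule exI[of _ s], rule exI[of _ l], simp add: s[simplified])
qed

lemma num_items_hist: "s \<le> Suc t \<Longrightarrow> (\<lambda>\<omega>. num_items (\<lambda>u. d u \<omega>) s) \<in> hist t \<rightarrow>\<^sub>M count_space UNIV"
  by (rule measurable_num_items[OF d_hist])

lemma attempts_hist: "s \<le> Suc t \<Longrightarrow> (\<lambda>\<omega>. attempts (\<lambda>u. d u \<omega>) s i) \<in> hist t \<rightarrow>\<^sub>M count_space UNIV"
  by (rule measurable_attempts[OF d_hist])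

lemma item_at_hist: "s \<le> t \<Longrightarrow> item_at s \<in> hist t \<rightarrow>\<^sub>M count_space UNIV"
  unfolding item_at_def[abs_def] by (rule measurable_next_item[OF d_hist])

lemma answers_hist:
  "1 \<le> i \<Longrightarrow> (\<lambda>\<omega>. answers X i (attempts (\<lambda>u. d u \<omega>) t i) \<omega>) \<in> hist t \<rightarrow>\<^sub>M count_space UNIV"
proof (rule measurable_hist_generator)
  fix l assume i: "1 \<le> i"
  show "{\<omega> \<in> space M. answers X i (attempts (\<lambda>u. d u \<omega>) t i) \<omega> = l} \<in> sets (hist t)"
    unfolding sets_hist
    by (rule sigma_sets.Basic, rule UnI2, rule CollectI) (rule exI[of _ i], rule exI[of _ l], simp add: i[simplified])
qed

lemma answers_measurable: "1 \<le> i \<Longrightarrow> answers X i j \<in> M \<rightarrow>\<^sub>M count_space UNIV"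
proof (induction j)
  case 0
  then show ?case by (simp add: answers_def[abs_def])
next
  case (Suc j)
  then show ?case
    unfolding answers_Suc[abs_def] by (intro measurable_discrete2[where h = "\<lambda>xs x. xs @ [x]"] X_measurable) auto
qed

lemma hist_subalgebra: "subalgebra M (hist t)"
  unfolding subalgebra_def sets_hist
proof (intro conjI sets.sigma_sets_subset subsetI)
  fix A assume A: "A \<in> {{\<omega> \<in> space M. num_items (\<lambda>u. d u \<omega>) s = l} | s l. s \<in> {1..t}} \<union>
      {{\<omega> \<in> space M. d s \<omega> = l} | s l. s \<in> {1..t}} \<union>
      {{\<omega> \<in> space M. answers X i (attempts (\<lambda>u. d u \<omega>) t i) \<omega> = xs} | i xs. 1 \<le> i}"
  have n: "(\<lambda>\<omega>. num_items (\<lambda>u. d u \<omega>) s) \<in> M \<rightarrow>\<^sub>M count_space UNIV" for s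
    by (rule measurable_num_items[of s]) (auto simp: d_measurable)
  have a: "(\<lambda>\<omega>. attempts (\<lambda>u. d u \<omega>) t i) \<in> M \<rightarrow>\<^sub>M count_space UNIV" for i
    by (rule measurable_attempts[of t]) (auto simp: d_measurable)
  have aa: "(\<lambda>\<omega>. answers X i (attempts (\<lambda>u. d u \<omega>) t i) \<omega>) \<in> M \<rightarrow>\<^sub>M count_space UNIV"
    if "1 \<le> i" for i
    by (rule measurable_compose_countable[OF answers_measurable[OF that] a])
  have ev: "{\<omega> \<in> space M. f \<omega> = x} \<in> sets M" if "f \<in> M \<rightarrow>\<^sub>M count_space UNIV" for f :: "'w \<Rightarrow> 'z" and x
    using that by measurable
  show "A \<in> sets M"
    using A by (auto intro!: ev n d_measurable aa)
qed simp

text \<open>The answer lists that generate the history at \<open>t\<close> are not among the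
  generators at \<open>Suc t\<close>. They are recovered as prefixes of the later lists, cut at the
  number of attempts at time \<open>t\<close>, which is still known. Inclusion of the sigma-algebras
  is expressed as measurability of the identity.\<close>

lemma hist_mono_Suc: "sets (hist t) \<subseteq> sets (hist (Suc t))"
proof -
  have "sets (hist t) \<subseteq> sets (hist (Suc t)) \<longleftrightarrow> id \<in> hist (Suc t) \<rightarrow>\<^sub>M hist t"
    using sets.sets_into_space[of _ "hist t"]
    by (auto simp: measurable_def Int_absorb2)
  also have "\<dots>"
    unfolding hist_algebra_def[of M d X t]
  proof (rule measurable_measure_of)
    fix A assume A: "A \<in> {{\<omega> \<in> space M. num_items (\<lambda>u. d u \<omega>) s = l} | s l. s \<in> {1..t}} \<union>
      {{\<omega> \<in> space M. d s \<omega> = l} | s l. s \<in> {1..t}} \<union>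
      {{\<omega> \<in> space M. answers X i (attempts (\<lambda>u. d u \<omega>) t i) \<omega> = xs} | i xs. 1 \<le> i}"
    have ev: "{\<omega> \<in> space M. f \<omega> = x} \<in> sets (hist (Suc t))"
      if "f \<in> hist (Suc t) \<rightarrow>\<^sub>M count_space UNIV" for f :: "'w \<Rightarrow> 'z" and x
      using measurable_sets[OF that, of "{x}"] by (simp add: vimage_def Int_def conj_commute)
    have aa: "(\<lambda>\<omega>. answers X i (attempts (\<lambda>u. d u \<omega>) t i) \<omega>) \<in> hist (Suc t) \<rightarrow>\<^sub>M count_space UNIV"
      if "1 \<le> i" for i
    proof -
      have "(\<lambda>\<omega>. take (attempts (\<lambda>u. d u \<omega>) t i)
          (answers X i (attempts (\<lambda>u. d u \<omega>) (Suc t) i) \<omega>)) \<in> hist (Suc t) \<rightarrow>\<^sub>M count_space UNIV"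
        using that by (intro measurable_discrete2[where h = take] attempts_hist answers_hist) auto
      then show ?thesis by (simp add: take_answers)
    qed
    show "id -` A \<inter> space (hist (Suc t)) \<in> sets (hist (Suc t))"
      using A by (auto simp: Int_def conj_commute intro!: ev num_items_hist d_hist aa)
  qed auto
  finally show ?thesis .
qed

lemma hist_mono: "s \<le> t \<Longrightarrow> sets (hist s) \<subseteq> sets (hist t)"
  by (rule lift_Suc_mono_le[of "\<lambda>t. sets (hist t)"]) (rule hist_mono_Suc)

lemma measurable_hist_mono: "s \<le> t \<Longrightarrow> f \<in> hist s \<rightarrow>\<^sub>M N \<Longrightarrow> f \<in> hist t \<rightarrow>\<^sub>M N"
  by (rule measurable_from_subalg[of "hist t" "hist s"]) (auto simp: subalgebra_def dest: hist_mono)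

lemma measurable_hist: "f \<in> hist s \<rightarrow>\<^sub>M N \<Longrightarrow> f \<in> M \<rightarrow>\<^sub>M N"
  by (rule measurable_from_subalg[OF hist_subalgebra])

lemma past_hist: "past t \<in> hist t \<rightarrow>\<^sub>M count_space UNIV"
proof -
  \<comment> \<open>The maximum makes every index of the countable family at least 1; on the sample
    space it changes nothing.\<close>
  have "(\<lambda>\<omega>. answers X (max 1 (item_at t \<omega>)) (attempts (\<lambda>u. d u \<omega>) t (max 1 (item_at t \<omega>))) \<omega>)
      \<in> hist t \<rightarrow>\<^sub>M count_space UNIV"
    by (rule measurable_compose_countable[OF answers_hist item_at_hist]) auto
  then show ?thesis
  proof (rule measurable_cong[THEN iffD1, rotated])
    fix \<omega> assume "\<omega> \<in> space (hist t)"
    then have "max 1 (item_at t \<omega>) = item_at t \<omega>" using item_at_ge_1[of \<omega> t] by simp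
    then show "answers X (max 1 (item_at t \<omega>)) (attempts (\<lambda>u. d u \<omega>) t (max 1 (item_at t \<omega>))) \<omega> =
        past t \<omega>" by (simp only: past_def)
  qed
qed

text \<open>Response \<open>t + 1\<close> is the last entry of the answer list of its item at time
  \<open>Suc t\<close>.\<close>

lemma response_hist: "response d X t \<in> hist (Suc t) \<rightarrow>\<^sub>M count_space UNIV"
proof -
  have last: "(\<lambda>\<omega>. last (answers X i (attempts (\<lambda>u. d u \<omega>) (Suc t) i) \<omega>)) \<in> hist (Suc t) \<rightarrow>\<^sub>M count_space UNIV"
    if "1 \<le> i" for i
    by (rule measurable_compose[OF answers_hist[OF that], where g = last]) simp
  have "(\<lambda>\<omega>. last (answers X (max 1 (item_at t \<omega>)) (attempts (\<lambda>u. d u \<omega>) (Suc t) (max 1 (item_at t \<omega>))) \<omega>))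
      \<in> hist (Suc t) \<rightarrow>\<^sub>M count_space UNIV"
    by (rule measurable_compose_countable[OF last item_at_hist]) auto
  then show ?thesis
  proof (rule measurable_cong[THEN iffD1, rotated])
    fix \<omega> assume "\<omega> \<in> space (hist (Suc t))"
    then have "max 1 (item_at t \<omega>) = item_at t \<omega>" using item_at_ge_1[of \<omega> t] by simp
    then show "last (answers X (max 1 (item_at t \<omega>)) (attempts (\<lambda>u. d u \<omega>) (Suc t) (max 1 (item_at t \<omega>))) \<omega>) =
        response d X t \<omega>" by (simp only: answers_snoc) simp
  qed
qed

interpretation hist: filtration "space M" hist
proof
  show "space (hist t) = space M" for t by simp
  show "sets (hist s) \<subseteq> sets (hist t)" if "s \<le> t" for s t using that by (rule hist_mono)
qed

lemma tau_le_iff: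
  assumes "\<omega> \<in> space M" "1 \<le> n"
  shows "tau d n \<omega> \<le> t \<longleftrightarrow> n < num_items (\<lambda>u. d u \<omega>) (Suc t)"
  using tau_path_less_iff[OF valid[OF assms(1)] assms(2), of "Suc t"]
  by (simp only: tau_eq_tau_path less_Suc_eq_le)

text \<open>Whether response \<open>t + 1\<close> opens a new item is settled by the decisions up to
  \<open>t\<close>, so the count at \<open>Suc t\<close> is already known at time
  \<open>t\<close>.\<close>

lemma tau_le_measurable:
  assumes n: "1 \<le> n"
  shows "Measurable.pred (hist t) (\<lambda>\<omega>. tau d n \<omega> \<le> t)"
proof -
  have 1: "(\<lambda>\<omega>. num_items (\<lambda>u. d u \<omega>) (Suc t)) \<in> hist t \<rightarrow>\<^sub>M count_space UNIV"
    by (rule num_items_hist[OF le_refl])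
  have 2: "{n<..} \<in> sets (count_space UNIV)" by simp
  have eq: "(\<lambda>\<omega>. num_items (\<lambda>u. d u \<omega>) (Suc t)) -` {n<..} \<inter> space (hist t) =
      {\<omega> \<in> space (hist t). tau d n \<omega> \<le> t}"
    unfolding space_hist using tau_le_iff[OF _ n] by blast
  show ?thesis using measurable_sets[OF 1 2] unfolding eq pred_def .
qed

lemma stopping_time_tau: "1 \<le> n \<Longrightarrow> stopping_time hist (tau d n)"
  by (intro stopping_timeI tau_le_measurable)

text \<open>Item \<open>Suc l\<close> is chosen at time \<open>tau d l\<close>. If response
  \<open>t + 1\<close> refers to it, then this time is at most \<open>t\<close>, so on that event
  its vector is known at time \<open>t\<close>.\<close>

lemma item_hist: "(\<lambda>\<omega>. b (item_at t \<omega>) \<omega>) \<in> borel_measurable (hist t)"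
proof (rule measurableI)
  fix A :: "'k item set" assume A: "A \<in> sets borel"
  have it: "{\<omega> \<in> space M. item_at t \<omega> = i} \<in> sets (hist t)" for i
    using measurable_sets[OF item_at_hist[of t t], of "{i}"] by (simp add: vimage_def Int_def conj_commute)
  have "{\<omega> \<in> space M. b i \<omega> \<in> A \<and> item_at t \<omega> = i} \<in> sets (hist t)" if i: "1 \<le> i" for i
  proof (cases "i = 1")
    case True
    obtain v where "\<And>\<omega>. \<omega> \<in> space M \<Longrightarrow> b 1 \<omega> = v" using b_first by blast
    then have "{\<omega> \<in> space M. b i \<omega> \<in> A \<and> item_at t \<omega> = i} =
        (if v \<in> A then {\<omega> \<in> space M. item_at t \<omega> = i} else {})" using True by auto
    then show ?thesis using it by simp
  next
    case False
    then obtain l where l: "i = Suc l" "1 \<le> l" using i by (cases i) auto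
    have "b i -` A \<inter> space M \<in> sets (hist.pre_sigma (tau d l))"
      using measurable_sets[OF b_measurable[OF l(2)] A] l(1) by (simp add: hist.space_pre_sigma)
    then have *: "{\<omega> \<in> b i -` A \<inter> space M. tau d l \<omega> \<le> t} \<in> sets (hist t)"
      by (rule hist.sets_pre_sigmaD[OF stopping_time_tau[OF l(2)]])
    have "{\<omega> \<in> space M. b i \<omega> \<in> A \<and> item_at t \<omega> = i} =
        {\<omega> \<in> b i -` A \<inter> space M. tau d l \<omega> \<le> t} \<inter> {\<omega> \<in> space M. item_at t \<omega> = i}"
      using item_at_le[of _ t] l by (force simp: tau_le_iff simp del: num_items.simps)
    then show ?thesis using * it by auto
  qed
  then have "(\<Union>i\<in>{1..}. {\<omega> \<in> space M. b i \<omega> \<in> A \<and> item_at t \<omega> = i}) \<in> sets (hist t)"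
    by (intro sets.countable_UN') auto
  also have "(\<Union>i\<in>{1..}. {\<omega> \<in> space M. b i \<omega> \<in> A \<and> item_at t \<omega> = i}) =
      (\<lambda>\<omega>. b (item_at t \<omega>) \<omega>) -` A \<inter> space (hist t)"
    using item_at_ge_1 by auto
  finally show "(\<lambda>\<omega>. b (item_at t \<omega>) \<omega>) -` A \<inter> space (hist t) \<in> sets (hist t)" .
qed simp

lemma item_measurable:
  assumes "1 \<le> i"
  shows "b i \<in> borel_measurable M"
proof (cases "i = 1")
  case True
  obtain v where "\<And>\<omega>. \<omega> \<in> space M \<Longrightarrow> b 1 \<omega> = v" using b_first by blast
  then show ?thesis unfolding True by (subst measurable_cong[where g = "\<lambda>_. v"]) auto
next
  case False
  then obtain l where l: "i = Suc l" "1 \<le> l" using assms by (cases i) auto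
  show ?thesis
  proof (rule measurableI)
    fix A :: "'k item set" assume A: "A \<in> sets borel"
    have "b i -` A \<inter> space M \<in> sets (hist.pre_sigma (tau d l))"
      using measurable_sets[OF b_measurable[OF l(2)] A] l(1) by (simp add: hist.space_pre_sigma)
    then have "{\<omega> \<in> b i -` A \<inter> space M. tau d l \<omega> \<le> t} \<in> sets M" for t
      using hist.sets_pre_sigmaD[OF stopping_time_tau[OF l(2)]] hist_subalgebra[of t]
      unfolding subalgebra_def by blast
    \<comment> \<open>The stopping time takes only finite values, so these sets exhaust the
      preimage.\<close>
    then have "(\<Union>t. {\<omega> \<in> b i -` A \<inter> space M. tau d l \<omega> \<le> t}) \<in> sets M" by blast
    moreover have "(\<Union>t. {\<omega> \<in> b i -` A \<inter> space M. tau d l \<omega> \<le> t}) = b i -` A \<inter> space M" by auto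
    ultimately show "b i -` A \<inter> space M \<in> sets M" by simp
  qed simp
qed

lemma item_term_hist:
  fixes h :: "'k item \<Rightarrow> 'k option list \<Rightarrow> real"
  assumes "\<And>x. (\<lambda>v. h v x) \<in> borel_measurable borel"
  shows "(\<lambda>\<omega>. h (b (item_at t \<omega>) \<omega>) (past t \<omega>)) \<in> borel_measurable (hist t)"
  by (rule measurable_compose_countable[OF measurable_compose[OF item_hist assms] past_hist])

lemma borel_measurable_nrm:
  "(\<lambda>v. nrm_s \<xi> v x k) \<in> borel_measurable borel"
  "(\<lambda>v. nrm_J \<xi> v x) \<in> borel_measurable borel"
  "(\<lambda>v. nrm_cond_prob \<xi> v x k) \<in> borel_measurable borel"
proof -
  have c: "continuous_on UNIV (\<lambda>v. (\<xi>, v))" by (intro continuous_intros)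
  show "(\<lambda>v. nrm_s \<xi> v x k) \<in> borel_measurable borel"
    using continuous_on_compose[OF c continuous_on_nrm_s, of x k]
    by (intro borel_measurable_continuous_onI) (simp add: o_def)
  show "(\<lambda>v. nrm_J \<xi> v x) \<in> borel_measurable borel"
    using continuous_on_compose[OF c continuous_on_nrm_J, of x]
    by (intro borel_measurable_continuous_onI) (simp add: o_def)
  show "(\<lambda>v. nrm_cond_prob \<xi> v x k) \<in> borel_measurable borel"
    using continuous_on_compose[OF c continuous_on_nrm_cond_prob, of x k]
    by (intro borel_measurable_continuous_onI) (simp add: o_def)
qed

lemma info_term_hist: "info_term \<xi> t \<in> borel_measurable (hist t)"
  unfolding info_term_def[abs_def] by (rule item_term_hist[OF borel_measurable_nrm(2)])

lemma score_term_hist: "score_term \<xi> t \<in> borel_measurable (hist (Suc t))"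
proof -
  have "(\<lambda>\<omega>. nrm_s \<xi> (b (item_at t \<omega>) \<omega>) (past t \<omega>) k) \<in> borel_measurable (hist (Suc t))" for k
    by (rule measurable_hist_mono[OF _ item_term_hist[OF borel_measurable_nrm(1)]]) simp
  then show ?thesis
    unfolding score_term_def[abs_def] by (rule measurable_compose_countable[OF _ response_hist])
qed

section \<open>The conditional law of a response\<close>

text \<open>The two clauses of the model merge into one, since a first answer is a response with
  empty history.\<close>

lemma response_cond_exp:
  "AE \<omega> in M. k \<notin> set (past t \<omega>) \<longrightarrow>
    real_cond_exp M (hist t) (indicator {\<omega>' \<in> space M. response d X t \<omega>' = k}) \<omega> =
    nrm_cond_prob \<theta> (b (item_at t \<omega>) \<omega>) (past t \<omega>) k"
proof -
  have rev: "AE \<omega> in M. 1 \<le> t \<longrightarrow> 1 \<le> i \<longrightarrow> d t \<omega> = i \<longrightarrow>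
        k \<notin> set (answers X i (attempts (\<lambda>u. d u \<omega>) t i) \<omega>) \<longrightarrow>
        real_cond_exp M (hist t) (indicator {\<omega>' \<in> space M. response d X t \<omega>' = k}) \<omega> =
        nrm_cond_prob \<theta> (b i \<omega>) (answers X i (attempts (\<lambda>u. d u \<omega>) t i) \<omega>) k" for i
    using revision[of t i k] by (cases "1 \<le> t \<and> 1 \<le> i") auto
  \<comment> \<open>The clause for revisions holds almost everywhere for each fixed item. Countably
    many exceptional sets are combined so that the random item \<open>d t \<omega>\<close> may be
    inserted.\<close>
  then have "AE \<omega> in M. \<forall>i. 1 \<le> t \<longrightarrow> 1 \<le> i \<longrightarrow> d t \<omega> = i \<longrightarrow>
        k \<notin> set (answers X i (attempts (\<lambda>u. d u \<omega>) t i) \<omega>) \<longrightarrow>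
        real_cond_exp M (hist t) (indicator {\<omega>' \<in> space M. response d X t \<omega>' = k}) \<omega> =
        nrm_cond_prob \<theta> (b i \<omega>) (answers X i (attempts (\<lambda>u. d u \<omega>) t i) \<omega>) k"
    by (simp only: AE_all_countable) blast
  with first_answer[of t k] AE_space show ?thesis
  proof eventually_elim
    case (elim \<omega>)
    show ?case
    proof (cases "new_item (\<lambda>u. d u \<omega>) t")
      case True
      then have "item_at t \<omega> = num_items (\<lambda>u. d u \<omega>) t + 1"
        by (simp add: item_at_def next_item_def)
      then show ?thesis
        using elim(1) True past_Nil[OF elim(2) True] by (simp add: nrm_cond_prob_Nil)
    next
      case False
      then have "1 \<le> t" "1 \<le> d t \<omega>" "item_at t \<omega> = d t \<omega>"
        by (auto simp: new_item_def item_at_def next_item_def)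
      then show ?thesis using elim(3) by (simp add: past_def)
    qed
  qed
qed

text \<open>Decomposing over the finitely many values of the response turns the expectation into
  integrals of history-measurable factors times indicators, whose conditional expectations are given
  by the model.\<close>

lemma expectation_response:
  assumes y: "\<And>k. y k \<in> borel_measurable (hist t)"
    and bound: "\<And>k \<omega>. \<omega> \<in> space M \<Longrightarrow> \<bar>y k \<omega>\<bar> \<le> C"
  shows "(\<integral>\<omega>. y (response d X t \<omega>) \<omega> \<partial>M) =
    (\<integral>\<omega>. (\<Sum>k\<in>- set (past t \<omega>). y k \<omega> * nrm_cond_prob \<theta> (b (item_at t \<omega>) \<omega>) (past t \<omega>) k) \<partial>M)"
proof -
  interpret fs: finite_measure_subalgebra M "hist t"
    by unfold_locales (rule hist_subalgebra)
  let ?I = "\<lambda>k. indicator {\<omega> \<in> space M. response d X t \<omega> = k} :: 'w \<Rightarrow> real"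
  let ?q = "\<lambda>k \<omega>. nrm_cond_prob \<theta> (b (item_at t \<omega>) \<omega>) (past t \<omega>) k"
  \<comment> \<open>The model fixes conditional probabilities only for categories not yet used.
    Setting the factor to 0 elsewhere loses nothing, because a response never repeats an earlier
    answer.\<close>
  define y' where "y' k \<omega> = (if k \<in> set (past t \<omega>) then 0 else y k \<omega>)" for k \<omega>
  have y'_hist: "y' k \<in> borel_measurable (hist t)" for k
  proof -
    have "(\<lambda>\<omega>. if k \<in> set x then 0 else y k \<omega>) \<in> borel_measurable (hist t)" for x
      using y[of k] by (cases "k \<in> set x") auto
    then show ?thesis
      unfolding y'_def[abs_def] by (rule measurable_compose_countable[OF _ past_hist])
  qed
  have y'_bound: "\<bar>y' k \<omega>\<bar> \<le> C" if "\<omega> \<in> space M" for k \<omega>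
    using bound[OF that, of k] by (auto simp: y'_def)
  have resp: "response d X t \<in> M \<rightarrow>\<^sub>M count_space UNIV"
    by (rule measurable_hist[OF response_hist])
  have "{\<omega> \<in> space M. response d X t \<omega> = k} = response d X t -` {k} \<inter> space M" for k by auto
  then have ev: "{\<omega> \<in> space M. response d X t \<omega> = k} \<in> events" for k
    using measurable_sets[OF resp, of "{k}"] by simp
  note [measurable] = measurable_hist[OF y'_hist]
  have I_meas: "?I k \<in> borel_measurable M" for k using ev by measurable
  have int: "integrable M (\<lambda>\<omega>. y' k \<omega> * ?I k \<omega>)" for k
  proof (rule integrable_const_bound[where B = C])
    show "(\<lambda>\<omega>. y' k \<omega> * ?I k \<omega>) \<in> borel_measurable M"
      by (intro borel_measurable_times measurable_hist[OF y'_hist] I_meas)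
    show "AE \<omega> in M. norm (y' k \<omega> * ?I k \<omega>) \<le> C"
      using y'_bound by (intro AE_I2) (auto simp: indicator_def intro: order_trans[OF abs_ge_zero])
  qed
  have q_meas: "?q k \<in> borel_measurable M" for k
    by (rule measurable_hist[OF item_term_hist[OF borel_measurable_nrm(3)]])
  have step: "(\<integral>\<omega>. y' k \<omega> * ?I k \<omega> \<partial>M) = (\<integral>\<omega>. y' k \<omega> * ?q k \<omega> \<partial>M)"
    and int2: "integrable M (\<lambda>\<omega>. y' k \<omega> * ?q k \<omega>)" for k
  proof -
    note ce = fs.real_cond_exp_intg[OF int y'_hist I_meas, of k]
    have ae: "AE \<omega> in M. y' k \<omega> * real_cond_exp M (hist t) (?I k) \<omega> = y' k \<omega> * ?q k \<omega>"
      using response_cond_exp[of k t] by eventually_elim (simp add: y'_def)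
    show "(\<integral>\<omega>. y' k \<omega> * ?I k \<omega> \<partial>M) = (\<integral>\<omega>. y' k \<omega> * ?q k \<omega> \<partial>M)"
      unfolding ce(2)[symmetric]
      by (rule integral_cong_AE[OF _ _ ae]) (auto intro!: borel_measurable_times q_meas)
    show "integrable M (\<lambda>\<omega>. y' k \<omega> * ?q k \<omega>)"
      by (rule integrable_cong_AE_imp[OF ce(1) _ ae]) (auto intro!: borel_measurable_times q_meas)
  qed
  have "(\<integral>\<omega>. y (response d X t \<omega>) \<omega> \<partial>M) = (\<integral>\<omega>. (\<Sum>k\<in>UNIV. y' k \<omega> * ?I k \<omega>) \<partial>M)"
  proof (rule Bochner_Integration.integral_cong)
    fix \<omega> assume w: "\<omega> \<in> space M"
    have "(\<Sum>k\<in>UNIV. y' k \<omega> * ?I k \<omega>) = (\<Sum>k\<in>UNIV. if k = response d X t \<omega> then y' k \<omega> else 0)"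
      using w by (intro sum.cong) (auto simp: indicator_def)
    then show "y (response d X t \<omega>) \<omega> = (\<Sum>k\<in>UNIV. y' k \<omega> * ?I k \<omega>)"
      using response_notin_past[OF w, of t] by (simp add: y'_def)
  qed simp
  also have "\<dots> = (\<Sum>k\<in>UNIV. \<integral>\<omega>. y' k \<omega> * ?I k \<omega> \<partial>M)"
    by (rule Bochner_Integration.integral_sum) (rule int)
  also have "\<dots> = (\<Sum>k\<in>UNIV. \<integral>\<omega>. y' k \<omega> * ?q k \<omega> \<partial>M)" by (simp only: step)
  also have "\<dots> = (\<integral>\<omega>. (\<Sum>k\<in>UNIV. y' k \<omega> * ?q k \<omega>) \<partial>M)"
    by (rule Bochner_Integration.integral_sum[symmetric]) (rule int2)
  also have "\<dots> = (\<integral>\<omega>. (\<Sum>k\<in>- set (past t \<omega>). y k \<omega> * ?q k \<omega>) \<partial>M)"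
    by (intro Bochner_Integration.integral_cong sum.mono_neutral_cong_right) (auto simp: y'_def)
  finally show ?thesis .
qed

section \<open>Uniform bounds and the score martingale\<close>

text \<open>The factor 2 comes from the deviation of a slope from a mean of slopes; the constant
  thus bounds every score term directly.\<close>

definition slope_bound :: real where
  "slope_bound = 2 * (SOME K. 0 < K \<and> (\<forall>v\<in>B. \<forall>k. \<bar>item_a v k\<bar> \<le> K))"

lemma slope_bound: "0 < slope_bound" "v \<in> B \<Longrightarrow> \<bar>item_a v k\<bar> \<le> slope_bound / 2"
proof -
  have "\<exists>K. 0 < K \<and> (\<forall>v\<in>B. \<forall>k. \<bar>item_a v k\<bar> \<le> K)"
    using item_a_bounded[OF B_compact] by metis
  from someI_ex[OF this] show "0 < slope_bound" "v \<in> B \<Longrightarrow> \<bar>item_a v k\<bar> \<le> slope_bound / 2"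
    by (auto simp: slope_bound_def)
qed

lemma nrm_bounds:
  assumes "v \<in> B" "set x \<noteq> UNIV"
  shows "\<bar>nrm_s \<xi> v x k\<bar> \<le> slope_bound" "nrm_J \<xi> v x \<le> slope_bound\<^sup>2"
  using nrm_abs_bounds[of v "slope_bound / 2" x \<xi>] slope_bound(2)[OF assms(1)] assms(2) by auto

lemma score_term_bound: "\<omega> \<in> space M \<Longrightarrow> \<bar>score_term \<xi> t \<omega>\<bar> \<le> slope_bound"
  unfolding score_term_def by (intro nrm_bounds b_item_at set_past)

lemma info_term_bounds: "\<omega> \<in> space M \<Longrightarrow> 0 \<le> info_term \<xi> t \<omega> \<and> info_term \<xi> t \<omega> \<le> slope_bound\<^sup>2"
  unfolding info_term_def by (intro conjI nrm_J_nonneg nrm_bounds b_item_at set_past)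

text \<open>The weight \<open>W\<close> is fixed given the history, so it factors out of the sum
  over categories. What remains is the mean of the score term, which is 0, or its second moment,
  which is \<open>info_term\<close>.\<close>

sublocale martingale: bounded_martingale_differences M hist "score_term \<theta>" "info_term \<theta>" slope_bound
proof
  let ?s = "\<lambda>t k \<omega>. nrm_s \<theta> (b (item_at t \<omega>) \<omega>) (past t \<omega>) k"
  have s_hist: "?s t k \<in> borel_measurable (hist t)" for t k
    by (rule item_term_hist[OF borel_measurable_nrm(1)])
  have s_bound: "\<bar>?s t k \<omega>\<bar> \<le> slope_bound" if "\<omega> \<in> space M" for t k \<omega>
    using that by (intro nrm_bounds b_item_at set_past)
  fix t and W :: "'w \<Rightarrow> real" and C :: real
  assume W: "W \<in> borel_measurable (hist t)" and C: "\<And>\<omega>. \<omega> \<in> space M \<Longrightarrow> \<bar>W \<omega>\<bar> \<le> C"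
  note [measurable] = W s_hist
  have "(\<integral>\<omega>. W \<omega> * score_term \<theta> t \<omega> \<partial>M) =
    (\<integral>\<omega>. (\<Sum>k\<in>- set (past t \<omega>). W \<omega> * ?s t k \<omega> * nrm_cond_prob \<theta> (b (item_at t \<omega>) \<omega>) (past t \<omega>) k) \<partial>M)"
    unfolding score_term_def
  proof (rule expectation_response[where y = "\<lambda>k \<omega>. W \<omega> * ?s t k \<omega>"])
    show "\<bar>W \<omega> * ?s t k \<omega>\<bar> \<le> C * slope_bound" if "\<omega> \<in> space M" for k \<omega>
      unfolding abs_mult using C[OF that] s_bound[OF that] by (intro mult_mono) auto
  qed measurable
  also have "\<dots> = (\<integral>\<omega>. 0 \<partial>M)"
    using set_past
    by (intro Bochner_Integration.integral_cong)
      (simp_all add: mult.assoc sum_distrib_left[symmetric] sum_nrm_s_prob)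
  finally show "(\<integral>\<omega>. W \<omega> * score_term \<theta> t \<omega> \<partial>M) = 0" by simp
  have "(\<integral>\<omega>. W \<omega> * (score_term \<theta> t \<omega>)\<^sup>2 \<partial>M) =
    (\<integral>\<omega>. (\<Sum>k\<in>- set (past t \<omega>). W \<omega> * (?s t k \<omega>)\<^sup>2 * nrm_cond_prob \<theta> (b (item_at t \<omega>) \<omega>) (past t \<omega>) k) \<partial>M)"
    unfolding score_term_def
  proof (rule expectation_response[where y = "\<lambda>k \<omega>. W \<omega> * (?s t k \<omega>)\<^sup>2"])
    show "\<bar>W \<omega> * (?s t k \<omega>)\<^sup>2\<bar> \<le> C * slope_bound\<^sup>2" if "\<omega> \<in> space M" for k \<omega>
      unfolding abs_mult using C[OF that] square_le_of_abs_le[OF s_bound[OF that]]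
      by (intro mult_mono) auto
  qed measurable
  also have "\<dots> = (\<integral>\<omega>. W \<omega> * info_term \<theta> t \<omega> \<partial>M)"
    by (intro Bochner_Integration.integral_cong)
      (simp_all add: mult.assoc sum_distrib_left[symmetric] sum_nrm_s_square_prob info_term_def)
  finally show "(\<integral>\<omega>. W \<omega> * (score_term \<theta> t \<omega>)\<^sup>2 \<partial>M) = (\<integral>\<omega>. W \<omega> * info_term \<theta> t \<omega> \<partial>M)" .
qed (use slope_bound(1) in \<open>auto intro: hist_subalgebra score_term_hist info_term_hist
    score_term_bound info_term_bounds[THEN conjunct1] info_term_bounds[THEN conjunct2] less_imp_le dest: hist_mono\<close>)

definition info_floor :: real where
  "info_floor = (SOME c. 0 < c \<and> (\<forall>v\<in>B. \<forall>\<xi>. \<bar>\<xi> - \<theta>\<bar> \<le> 1 \<longrightarrow> c \<le> nrm_J \<xi> v []))"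

lemma info_floor:
  "0 < info_floor" "v \<in> B \<Longrightarrow> \<bar>\<xi> - \<theta>\<bar> \<le> 1 \<Longrightarrow> info_floor \<le> nrm_J \<xi> v []"
proof -
  have "\<exists>c. 0 < c \<and> (\<forall>v\<in>B. \<forall>\<xi>. \<bar>\<xi> - \<theta>\<bar> \<le> 1 \<longrightarrow> c \<le> nrm_J \<xi> v [])"
    using nrm_J_lower_bound[OF B_compact B_a, of \<theta>] by metis
  from someI_ex[OF this] show "0 < info_floor" "v \<in> B \<Longrightarrow> \<bar>\<xi> - \<theta>\<bar> \<le> 1 \<Longrightarrow> info_floor \<le> nrm_J \<xi> v []"
    by (auto simp: info_floor_def)
qed

section \<open>Score and information along one realization\<close>

lemma info_nonneg: "\<omega> \<in> space M \<Longrightarrow> 0 \<le> info b d X T \<xi> \<omega>"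
  using info_term_bounds by (auto simp: info_eq intro!: sum_nonneg)

lemma info_le: "\<omega> \<in> space M \<Longrightarrow> info b d X T \<xi> \<omega> \<le> real T * slope_bound\<^sup>2"
  using sum_bounded_above[of "{..<T}" "\<lambda>t. info_term \<xi> t \<omega>" "slope_bound\<^sup>2"] info_term_bounds
  by (simp add: info_eq)

lemma info_rev_nonneg: "0 \<le> info_rev b d X T \<xi> \<omega>"
  unfolding info_rev_def by (intro sum_nonneg nrm_J_nonneg)

text \<open>Only first answers are estimated from below; revisions contribute a nonnegative
  amount.\<close>

lemma info_ge:
  assumes "\<omega> \<in> space M" "\<bar>\<xi> - \<theta>\<bar> \<le> 1"
  shows "info_floor * real (num_items (\<lambda>u. d u \<omega>) T) \<le> info b d X T \<xi> \<omega>"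
proof -
  have "(\<Sum>i = 1..num_items (\<lambda>u. d u \<omega>) T. info_floor) \<le>
      (\<Sum>i = 1..num_items (\<lambda>u. d u \<omega>) T. nrm_J \<xi> (b i \<omega>) [])"
    using assms by (intro sum_mono info_floor b_range) auto
  then show ?thesis using info_rev_nonneg[of T \<xi> \<omega>] unfolding info_def by (simp add: mult.commute)
qed

text \<open>The modulus is independent of \<omega> and \<open>T\<close>, since later
  \<open>T\<close> is a random time and the ability a random point.\<close>

lemma info_equicontinuous:
  assumes "0 < \<epsilon>"
  obtains \<delta> where "0 < \<delta>" "\<And>\<omega> T \<xi>. \<omega> \<in> space M \<Longrightarrow> \<bar>\<xi> - \<theta>\<bar> < \<delta> \<Longrightarrow>
    \<bar>info b d X T \<xi> \<omega> - info b d X T \<theta> \<omega>\<bar> \<le> real T * \<epsilon>"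
proof -
  from nrm_J_equicontinuous[OF B_compact assms, of \<theta>] obtain \<delta> where d: "0 < \<delta>"
    "\<And>v x \<xi>. v \<in> B \<Longrightarrow> \<bar>\<xi> - \<theta>\<bar> < \<delta> \<Longrightarrow> \<bar>nrm_J \<xi> v x - nrm_J \<theta> v x\<bar> < \<epsilon>" by blast
  show thesis
  proof (rule that[OF d(1)])
    fix \<omega> T \<xi> assume "\<omega> \<in> space M" "\<bar>\<xi> - \<theta>\<bar> < \<delta>"
    then have "\<bar>info_term \<xi> t \<omega> - info_term \<theta> t \<omega>\<bar> \<le> \<epsilon>" for t
      unfolding info_term_def by (intro less_imp_le[OF d(2)] b_item_at)
    then have "(\<Sum>t<T. \<bar>info_term \<xi> t \<omega> - info_term \<theta> t \<omega>\<bar>) \<le> real T * \<epsilon>"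
      using sum_bounded_above[of "{..<T}" "\<lambda>t. \<bar>info_term \<xi> t \<omega> - info_term \<theta> t \<omega>\<bar>" \<epsilon>] by simp
    then show "\<bar>info b d X T \<xi> \<omega> - info b d X T \<theta> \<omega>\<bar> \<le> real T * \<epsilon>"
      using \<open>\<omega> \<in> space M\<close> sum_abs[of "\<lambda>t. info_term \<xi> t \<omega> - info_term \<theta> t \<omega>" "{..<T}"]
      by (simp add: info_eq sum_subtractf)
  qed
qed

lemma score_has_derivative:
  assumes "\<omega> \<in> space M"
  shows "((\<lambda>\<xi>. score b d X T \<xi> \<omega>) has_real_derivative - info b d X T \<xi> \<omega>) (at \<xi>)"
  unfolding score_eq[OF assms] info_eq[OF assms] sum_negf[symmetric] score_term_def info_term_def
  by (intro DERIV_sum nrm_s_has_derivative set_past assms)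

lemma score_mvt:
  assumes "\<omega> \<in> space M"
  obtains z where "\<bar>z - \<theta>\<bar> \<le> \<bar>\<xi> - \<theta>\<bar>"
    "score b d X T \<xi> \<omega> - score b d X T \<theta> \<omega> = - (\<xi> - \<theta>) * info b d X T z \<omega>"
proof (cases "\<xi> = \<theta>")
  case False
  note der = score_has_derivative[OF assms, of T]
  show thesis
  proof (cases "\<theta> < \<xi>")
    case True
    from MVT2[OF this, of "\<lambda>\<xi>. score b d X T \<xi> \<omega>", OF der] obtain z where
      "\<theta> < z" "z < \<xi>" "score b d X T \<xi> \<omega> - score b d X T \<theta> \<omega> = (\<xi> - \<theta>) * - info b d X T z \<omega>" by blast
    then show thesis by (intro that[of z]) (auto simp: left_diff_distrib)
  next
    case False
    then have "\<xi> < \<theta>" using \<open>\<xi> \<noteq> \<theta>\<close> by simp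
    from MVT2[OF this, of "\<lambda>\<xi>. score b d X T \<xi> \<omega>", OF der] obtain z where
      "\<xi> < z" "z < \<theta>" "score b d X T \<theta> \<omega> - score b d X T \<xi> \<omega> = (\<theta> - \<xi>) * - info b d X T z \<omega>" by blast
    then show thesis by (intro that[of z]) (auto simp: algebra_simps)
  qed
qed (auto intro: that[of \<theta>])

lemma score_antimono:
  assumes "\<omega> \<in> space M" "\<xi> \<le> \<xi>'"
  shows "score b d X T \<xi>' \<omega> \<le> score b d X T \<xi> \<omega>"
  using assms(2)
  by (rule DERIV_nonpos_imp_nonincreasing)
    (use score_has_derivative[OF assms(1)] info_nonneg[OF assms(1)] in \<open>auto intro!: exI\<close>)

text \<open>Within distance 1 of \<theta> the score falls at a rate of at least
  \<open>info_floor\<close> per item. Over the distance \<epsilon> it therefore changes sign on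
  either side, which gives a root by continuity, and monotonicity keeps every root inside this
  interval.\<close>

lemma score_root:
  assumes w: "\<omega> \<in> space M" and e: "0 < \<epsilon>" "\<epsilon> \<le> 1"
    and small: "\<bar>score b d X T \<theta> \<omega>\<bar> < \<epsilon> * (info_floor * real (num_items (\<lambda>u. d u \<omega>) T))"
  shows "\<exists>\<xi>. score b d X T \<xi> \<omega> = 0"
    and "score b d X T \<xi> \<omega> = 0 \<Longrightarrow> \<bar>\<xi> - \<theta>\<bar> < \<epsilon>"
proof -
  let ?I = "info_floor * real (num_items (\<lambda>u. d u \<omega>) T)"
  have 1: "score b d X T (\<theta> + \<epsilon>) \<omega> < 0"
  proof -
    obtain z where "\<bar>z - \<theta>\<bar> \<le> \<bar>(\<theta> + \<epsilon>) - \<theta>\<bar>"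
      "score b d X T (\<theta> + \<epsilon>) \<omega> - score b d X T \<theta> \<omega> = - ((\<theta> + \<epsilon>) - \<theta>) * info b d X T z \<omega>"
      using score_mvt[OF w] .
    moreover from this have "\<epsilon> * ?I \<le> \<epsilon> * info b d X T z \<omega>"
      using e by (intro mult_left_mono info_ge[OF w]) auto
    ultimately show ?thesis using small by simp
  qed
  have 2: "0 < score b d X T (\<theta> - \<epsilon>) \<omega>"
  proof -
    obtain z where "\<bar>z - \<theta>\<bar> \<le> \<bar>(\<theta> - \<epsilon>) - \<theta>\<bar>"
      "score b d X T (\<theta> - \<epsilon>) \<omega> - score b d X T \<theta> \<omega> = - ((\<theta> - \<epsilon>) - \<theta>) * info b d X T z \<omega>"
      using score_mvt[OF w] .
    moreover from this have "\<epsilon> * ?I \<le> \<epsilon> * info b d X T z \<omega>"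
      using e by (intro mult_left_mono info_ge[OF w]) auto
    ultimately show ?thesis using small by simp
  qed
  have cont: "isCont (\<lambda>\<xi>. score b d X T \<xi> \<omega>) x" for x
    using score_has_derivative[OF w] by (rule DERIV_isCont)
  show "\<exists>\<xi>. score b d X T \<xi> \<omega> = 0"
    using IVT2[of "\<lambda>\<xi>. score b d X T \<xi> \<omega>" "\<theta> + \<epsilon>" 0 "\<theta> - \<epsilon>"] 1 2 e cont by auto
  assume z: "score b d X T \<xi> \<omega> = 0"
  have "\<not> \<theta> + \<epsilon> \<le> \<xi>" using score_antimono[OF w, of "\<theta> + \<epsilon>" \<xi> T] 1 z by auto
  moreover have "\<not> \<xi> \<le> \<theta> - \<epsilon>" using score_antimono[OF w, of \<xi> "\<theta> - \<epsilon>" T] 2 z by auto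
  ultimately show "\<bar>\<xi> - \<theta>\<bar> < \<epsilon>" by linarith
qed

section \<open>Quantities stopped at \<open>tau\<close>\<close>

lemma tau_bounds:
  assumes "\<omega> \<in> space M" "1 \<le> n"
  shows "1 \<le> tau d n \<omega>" "n \<le> tau d n \<omega>" "tau d n \<omega> \<le> (m - 1) * n"
    "num_items (\<lambda>u. d u \<omega>) (tau d n \<omega>) = n"
  using tau_path_props[OF valid[OF assms(1)] assms(2)] tau_path_ge[OF valid[OF assms(1)] assms(2)]
    tau_path_le[OF valid[OF assms(1)] assms(2)]
  unfolding tau_eq_tau_path by auto

lemma tau_measurable:
  assumes "1 \<le> n"
  shows "tau d n \<in> M \<rightarrow>\<^sub>M count_space UNIV"
proof -
  have *: "{\<omega> \<in> space M. tau d n \<omega> \<le> t} \<in> sets M" for t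
    using measurable_hist[OF tau_le_measurable[OF assms, of t]] by (simp add: pred_def)
  show ?thesis
    unfolding measurable_count_space_eq2_countable
  proof (intro conjI allI ballI)
    fix a
    have "tau d n -` {a} \<inter> space M = {\<omega> \<in> space M. tau d n \<omega> \<le> a} -
        (if a = 0 then {} else {\<omega> \<in> space M. tau d n \<omega> \<le> a - 1})" by auto
    then show "tau d n -` {a} \<inter> space M \<in> sets M" using *[of a] *[of "a - 1"] by auto
  qed auto
qed

text \<open>The event that the test has not stopped by time \<open>t\<close> is known at
  \<open>t\<close>, so the stopping indicator is a predictable weight.\<close>

lemma less_tau_hist:
  assumes "1 \<le> n" "f \<in> borel_measurable (hist t)"
  shows "(\<lambda>\<omega>. if t < tau d n \<omega> then f \<omega> else (0::real)) \<in> borel_measurable (hist t)"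
proof -
  have "(\<lambda>\<omega>. if tau d n \<omega> \<le> t then 0 else f \<omega>) \<in> borel_measurable (hist t)"
    using tau_le_measurable[OF assms(1), of t] assms(2) by (intro measurable_If) (auto simp: pred_def)
  then show ?thesis by (rule measurable_cong[THEN iffD1, rotated]) auto
qed

text \<open>The ability may be random, so that the estimator can be inserted; joint continuity of
  \<open>nrm_J\<close> makes this measurable.\<close>

lemma info_measurable:
  assumes "\<xi> \<in> borel_measurable M"
  shows "(\<lambda>\<omega>. info b d X T (\<xi> \<omega>) \<omega>) \<in> borel_measurable M"
proof -
  have J: "(\<lambda>p. nrm_J (fst p) (snd p) x) \<in> borel_measurable borel"
    for x :: "'k option list"
    by (intro borel_measurable_continuous_onI continuous_on_nrm_J)
  have pair: "(\<lambda>\<omega>. (\<xi> \<omega>, b (item_at t \<omega>) \<omega>)) \<in> borel_measurable M" for t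
    by (intro borel_measurable_Pair assms measurable_hist[OF item_hist])
  have "(\<lambda>\<omega>. nrm_J (\<xi> \<omega>) (b (item_at t \<omega>) \<omega>) x) \<in> borel_measurable M" for t x
    using measurable_compose[OF pair J] by simp
  then have "(\<lambda>\<omega>. info_term (\<xi> \<omega>) t \<omega>) \<in> borel_measurable M" for t
    unfolding info_term_def by (rule measurable_compose_countable[OF _ measurable_hist[OF past_hist]])
  then have "(\<lambda>\<omega>. \<Sum>t<T. info_term (\<xi> \<omega>) t \<omega>) \<in> borel_measurable M"
    by (intro borel_measurable_sum)
  then show ?thesis by (rule measurable_cong[THEN iffD1, rotated]) (simp add: info_eq)
qed

lemma score_measurable: "score b d X T \<xi> \<in> borel_measurable M"
proof -
  have "(\<lambda>\<omega>. \<Sum>t<T. score_term \<xi> t \<omega>) \<in> borel_measurable M"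
    by (intro borel_measurable_sum measurable_hist[OF score_term_hist])
  then show ?thesis by (rule measurable_cong[THEN iffD1, rotated]) (simp add: score_eq)
qed

definition norm_score :: "nat \<Rightarrow> 'w \<Rightarrow> real" where
  "norm_score n \<omega> = score b d X (tau d n \<omega>) \<theta> \<omega> / sqrt (real n)"

definition mean_info :: "real \<Rightarrow> nat \<Rightarrow> 'w \<Rightarrow> real" where
  "mean_info \<xi> n \<omega> = info b d X (tau d n \<omega>) \<xi> \<omega> / real n"

lemma norm_score_measurable: "1 \<le> n \<Longrightarrow> norm_score n \<in> borel_measurable M"
  unfolding norm_score_def[abs_def]
  by (intro borel_measurable_divide measurable_compose_countable[OF score_measurable tau_measurable]) auto

lemma mean_info_measurable: "1 \<le> n \<Longrightarrow> mean_info \<xi> n \<in> borel_measurable M"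
  unfolding mean_info_def[abs_def]
  by (intro borel_measurable_divide measurable_compose_countable[OF info_measurable tau_measurable]) auto

definition info_ceil :: real where
  "info_ceil = real (m - 1) * slope_bound\<^sup>2"

lemma mean_info_bounds:
  assumes "\<omega> \<in> space M" "1 \<le> n" "\<bar>\<xi> - \<theta>\<bar> \<le> 1"
  shows "mean_info \<xi> n \<omega> \<in> {info_floor..info_ceil}"
proof -
  have "info b d X (tau d n \<omega>) \<xi> \<omega> \<le> real ((m - 1) * n) * slope_bound\<^sup>2"
    using tau_bounds(3)[OF assms(1,2)]
    by (intro order_trans[OF info_le[OF assms(1)]] mult_right_mono) (simp_all only: of_nat_le_iff zero_le_power2)
  then show ?thesis
    using info_ge[OF assms(1,3), of "tau d n \<omega>"] tau_bounds(4)[OF assms(1,2)] assms(2)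
    unfolding mean_info_def info_ceil_def by (auto simp: field_simps)
qed

text \<open>A random upper limit becomes an indicator on a deterministic range, to which the
  fixed-horizon martingale bounds apply.\<close>

lemma stopped_sum:
  assumes "\<omega> \<in> space M" "1 \<le> n"
  shows "(\<Sum>t<tau d n \<omega>. f t) = (\<Sum>t<(m - 1) * n. if t < tau d n \<omega> then f t else (0::real))"
  using tau_bounds(3)[OF assms] by (intro sum.mono_neutral_cong_left) auto

lemma norm_score_second_moment:
  assumes n: "1 \<le> n"
  shows "integrable M (\<lambda>\<omega>. (norm_score n \<omega>)\<^sup>2)" "(\<integral>\<omega>. (norm_score n \<omega>)\<^sup>2 \<partial>M) \<le> info_ceil"
proof -
  define H where "H t \<omega> = (if t < tau d n \<omega> then 1 else 0 :: real)" for t \<omega>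
  have H: "H t \<in> borel_measurable (hist t)" for t
    unfolding H_def[abs_def] by (rule less_tau_hist[OF n]) simp
  have h: "\<bar>H t \<omega>\<bar> \<le> 1" for t \<omega> by (simp add: H_def)
  note sm = martingale.second_moment_bound[of H 1 "(m - 1) * n", OF H h]
  have eq: "(norm_score n \<omega>)\<^sup>2 = (\<Sum>t<(m - 1) * n. H t \<omega> * score_term \<theta> t \<omega>)\<^sup>2 / real n"
    if "\<omega> \<in> space M" for \<omega>
  proof -
    have "score b d X (tau d n \<omega>) \<theta> \<omega> = (\<Sum>t<(m - 1) * n. H t \<omega> * score_term \<theta> t \<omega>)"
      unfolding score_eq[OF that] stopped_sum[OF that n] by (intro sum.cong) (auto simp: H_def)
    then show ?thesis by (simp add: norm_score_def power_divide)
  qed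
  show "integrable M (\<lambda>\<omega>. (norm_score n \<omega>)\<^sup>2)"
    using integrable_divide[OF sm(1), of "real n"] eq
    by (subst Bochner_Integration.integrable_cong[OF refl eq]) auto
  have "(\<integral>\<omega>. (norm_score n \<omega>)\<^sup>2 \<partial>M) = (\<integral>\<omega>. (\<Sum>t<(m - 1) * n. H t \<omega> * score_term \<theta> t \<omega>)\<^sup>2 \<partial>M) / real n"
    by (subst Bochner_Integration.integral_cong[OF refl eq]) auto
  also have "\<dots> \<le> (real ((m - 1) * n) * (1 * slope_bound)\<^sup>2) / real n"
    using sm(2) by (intro divide_right_mono) auto
  also have "\<dots> = info_ceil" using n by (simp add: info_ceil_def)
  finally show "(\<integral>\<omega>. (norm_score n \<omega>)\<^sup>2 \<partial>M) \<le> info_ceil" .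
qed

text \<open>The bounded second moment makes the normalized score tight. All remainder terms below
  are products of this kind.\<close>

lemma norm_score_mult_tendsto:
  assumes "((\<lambda>(n, \<omega>). \<rho> n \<omega>) \<longlongrightarrow> 0) (in_prob M)"
  shows "((\<lambda>(n, \<omega>). norm_score n \<omega> * \<rho> n \<omega>) \<longlongrightarrow> 0) (in_prob M)"
  by (rule tendsto_mult_bounded_in_prob[OF norm_score_measurable norm_score_second_moment assms])

section \<open>Maximal information and the contribution of revisions\<close>

definition max_info :: real where
  "max_info = (SUP v\<in>B. nrm_J \<theta> v [])"

lemma nrm_J_le_max_info: "v \<in> B \<Longrightarrow> nrm_J \<theta> v [] \<le> max_info"
  unfolding max_info_def
  by (rule cSUP_upper) (auto intro!: bdd_aboveI2[where M = "slope_bound\<^sup>2"] nrm_bounds)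

lemma max_info_leI: "(\<And>v. v \<in> B \<Longrightarrow> nrm_J \<theta> v [] \<le> C) \<Longrightarrow> max_info \<le> C"
  unfolding max_info_def by (rule cSUP_least[OF B_nonempty])

lemma max_info_pos: "0 < max_info"
proof -
  obtain v where "v \<in> B" using B_nonempty by blast
  then show ?thesis
    using nrm_J_le_max_info[of v] info_floor(2)[of v \<theta>] info_floor(1) by simp
qed

text \<open>The difference between responses and items is the number of revisions, and each revision
  contributes at most \<open>slope_bound\<^sup>2\<close>.\<close>

lemma info_rev_le:
  assumes w: "\<omega> \<in> space M"
  shows "info_rev b d X T \<theta> \<omega> \<le> slope_bound\<^sup>2 * (real T - real (num_items (\<lambda>u. d u \<omega>) T))"
proof -
  let ?\<delta> = "\<lambda>u. d u \<omega>"
  have len: "set (answers X i (j - 1) \<omega>) \<noteq> UNIV"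
    if "i \<in> {1..num_items ?\<delta> T}" "j \<in> {2..attempts ?\<delta> T i}" for i j
  proof
    assume "set (answers X i (j - 1) \<omega>) = UNIV"
    then have "m \<le> j - 1" using card_length[of "answers X i (j - 1) \<omega>"] m_eq by simp
    then show False using that attempts_bounds[OF valid[OF w] that(1)] m_ge by auto
  qed
  have "info_rev b d X T \<theta> \<omega> \<le> (\<Sum>i = 1..num_items ?\<delta> T. \<Sum>j = 2..attempts ?\<delta> T i. slope_bound\<^sup>2)"
    unfolding info_rev_def using w len by (intro sum_mono nrm_bounds b_range) auto
  also have "\<dots> = (\<Sum>i = 1..num_items ?\<delta> T. slope_bound\<^sup>2 * (real (attempts ?\<delta> T i) - 1))"
  proof (rule sum.cong)
    fix i assume "i \<in> {1..num_items ?\<delta> T}"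
    then have "1 \<le> attempts ?\<delta> T i" using attempts_bounds[OF valid[OF w]] by simp
    then show "(\<Sum>j = 2..attempts ?\<delta> T i. slope_bound\<^sup>2) = slope_bound\<^sup>2 * (real (attempts ?\<delta> T i) - 1)"
      by (simp add: of_nat_diff Suc_diff_le numeral_2_eq_2)
  qed simp
  also have "\<dots> = slope_bound\<^sup>2 * (real (\<Sum>i = 1..num_items ?\<delta> T. attempts ?\<delta> T i) - real (num_items ?\<delta> T))"
    by (simp add: sum_distrib_left[symmetric] sum_subtractf)
  also have "(\<Sum>i = 1..num_items ?\<delta> T. attempts ?\<delta> T i) = T"
    using sum_attempts[OF valid[OF w], where h = "\<lambda>_ _. 1::nat" and T = T] by simp
  finally show ?thesis .
qed

section \<open>Asymptotic normality of the score\<close>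

text \<open>After division by the square root of the early information the compensator tends to the
  constant \<open>u\<^sup>2\<close> even when \<open>L\<close> is random. Its exponential can then
  be replaced by a constant in the expectation, which leaves the normal characteristic
  function.\<close>

lemma clt:
  assumes L: "((\<lambda>(n, \<omega>). mean_info \<theta> n \<omega> - L \<omega>) \<longlongrightarrow> 0) (in_prob M)"
  shows "(\<lambda>n. \<integral>\<omega>. iexp (u * (norm_score n \<omega> / sqrt (mean_info \<theta> n \<omega>))) \<partial>M)
    \<longlonglongrightarrow> complex_of_real (exp (- u\<^sup>2 / 2))"
proof -
  define N where "N = fourth_root_floor"
  \<comment> \<open>By this deterministic time \<open>tau d (N n)\<close> has passed, so
    \<open>lam n\<close> is known.\<close>
  define t0 where "t0 n = (m - 1) * N n" for n
  define lam where "lam n \<omega> = mean_info \<theta> (N n) \<omega>" for n \<omega>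
  define a where "a n \<omega> = u / sqrt (lam n \<omega>)" for n \<omega>
  \<comment> \<open>The weight vanishes while the scale \<open>a n\<close> is still unknown, and
    again after the test has stopped.\<close>
  define H where "H n t \<omega> = (if t < t0 n then 0 else if t < tau d n \<omega> then a n \<omega> / sqrt (real n) else 0)"
    for n t \<omega>
  define h where "h n = \<bar>u\<bar> / sqrt info_floor / sqrt (real n)" for n
  define P where "P n \<omega> = (\<Sum>t<t0 n. if t < tau d n \<omega> then score_term \<theta> t \<omega> else 0)" for n \<omega>
  define PV where "PV n \<omega> = (\<Sum>t<t0 n. if t < tau d n \<omega> then info_term \<theta> t \<omega> else 0)" for n \<omega>
  define S where "S n \<omega> = (\<Sum>t<(m - 1) * n. H n t \<omega> * score_term \<theta> t \<omega>)" for n \<omega>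
  define Q where "Q n \<omega> = (\<Sum>t<(m - 1) * n. (H n t \<omega>)\<^sup>2 * info_term \<theta> t \<omega>)" for n \<omega>
  define \<kappa> where "\<kappa> = \<bar>u\<bar> / sqrt info_floor * slope_bound"
  let ?W = "\<lambda>n \<omega>. norm_score n \<omega> / sqrt (mean_info \<theta> n \<omega>)"
  note N = fourth_root_floor[folded N_def]
  have c: "0 < info_floor" by (rule info_floor(1))
  have k0: "0 \<le> \<kappa>" using slope_bound(1) c by (simp add: \<kappa>_def)
  have t0_le: "t0 n \<le> (m - 1) * n" if "1 \<le> n" for n
    unfolding t0_def using N(2)[OF that] by (rule mult_le_mono2)
  have lam: "lam n \<omega> \<in> {info_floor..info_ceil}" "mean_info \<theta> n \<omega> \<in> {info_floor..info_ceil}"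
    if "\<omega> \<in> space M" "1 \<le> n" for n \<omega>
    unfolding lam_def using that N by (auto intro!: mean_info_bounds simp del: atLeastAtMost_iff)
  have a_bound: "\<bar>a n \<omega>\<bar> \<le> \<bar>u\<bar> / sqrt info_floor" if "\<omega> \<in> space M" "1 \<le> n" for n \<omega>
    unfolding a_def abs_divide using lam(1)[OF that] c by (intro divide_left_mono) auto
  have H_bound: "\<bar>H n t \<omega>\<bar> \<le> h n" if "\<omega> \<in> space M" "1 \<le> n" for n t \<omega>
    using divide_right_mono[OF a_bound[OF that], of "sqrt (real n)"] c
    unfolding H_def h_def by (auto simp: abs_divide)
  have hK: "h n * slope_bound = \<kappa> / sqrt (real n)" for n by (simp add: h_def \<kappa>_def)
  have H_hist: "H n t \<in> borel_measurable (hist t)" if n: "1 \<le> n" for n t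
  proof (cases "t < t0 n")
    case False
    \<comment> \<open>Only summands with index below \<open>t0 n\<close> enter \<open>lam n\<close>,
      and all of them are known at a time \<open>t\<close> that is not below
      \<open>t0 n\<close>.\<close>
    have info: "(\<lambda>\<omega>. if s < tau d (N n) \<omega> then info_term \<theta> s \<omega> else 0) \<in> borel_measurable (hist t)"
      if "s < t0 n" for s
      using False that by (intro measurable_hist_mono[OF _ less_tau_hist[OF N(1)[OF n] info_term_hist]]) auto
    have "(\<lambda>\<omega>. (\<Sum>s<t0 n. if s < tau d (N n) \<omega> then info_term \<theta> s \<omega> else 0) / real (N n))
        \<in> borel_measurable (hist t)"
      by (intro borel_measurable_divide borel_measurable_sum info) auto
    then have "lam n \<in> borel_measurable (hist t)"
    proof (rule measurable_cong[THEN iffD1, rotated])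
      fix \<omega> assume "\<omega> \<in> space (hist t)"
      then have w: "\<omega> \<in> space M" by simp
      show "(\<Sum>s<t0 n. if s < tau d (N n) \<omega> then info_term \<theta> s \<omega> else 0) / real (N n) = lam n \<omega>"
        unfolding lam_def mean_info_def info_eq[OF w] stopped_sum[OF w N(1)[OF n]] t0_def ..
    qed
    then have "(\<lambda>\<omega>. a n \<omega> / sqrt (real n)) \<in> borel_measurable (hist t)"
      unfolding a_def[abs_def] by measurable
    from less_tau_hist[OF n this] show ?thesis unfolding H_def[abs_def] using False by simp
  qed (simp add: H_def[abs_def])
  have S_eq: "S n \<omega> = a n \<omega> * (norm_score n \<omega> - P n \<omega> / sqrt (real n))"
    and Q_eq: "Q n \<omega> = (a n \<omega>)\<^sup>2 * (mean_info \<theta> n \<omega> - PV n \<omega> / real n)"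
    if w: "\<omega> \<in> space M" and n: "1 \<le> n" for n \<omega>
  proof -
    \<comment> \<open>The stopping indicator is kept in the subtracted sum because for small
      \<open>n\<close> the time \<open>t0 n\<close> may exceed
      \<open>tau d n \<omega>\<close>.\<close>
    have split: "(\<Sum>t<(m - 1) * n. if t < t0 n then 0 else if t < tau d n \<omega> then f t else 0) =
        (\<Sum>t<tau d n \<omega>. f t) - (\<Sum>t<t0 n. if t < tau d n \<omega> then f t else 0)" for f :: "nat \<Rightarrow> real"
    proof -
      have "(\<Sum>t<t0 n. if t < tau d n \<omega> then f t else 0) =
          (\<Sum>t<(m - 1) * n. if t < t0 n then if t < tau d n \<omega> then f t else 0 else 0)"
        using t0_le[OF n] by (intro sum.mono_neutral_cong_left) auto
      then show ?thesis
        unfolding stopped_sum[OF w n] sum_subtractf[symmetric]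
        by (simp add: sum_subtractf[symmetric]) (intro sum.cong; simp)
    qed
    have "S n \<omega> = a n \<omega> / sqrt (real n) *
        (\<Sum>t<(m - 1) * n. if t < t0 n then 0 else if t < tau d n \<omega> then score_term \<theta> t \<omega> else 0)"
      unfolding S_def sum_distrib_left by (intro sum.cong) (auto simp: H_def)
    then show "S n \<omega> = a n \<omega> * (norm_score n \<omega> - P n \<omega> / sqrt (real n))"
      unfolding split by (simp add: P_def norm_score_def score_eq[OF w] diff_divide_distrib right_diff_distrib)
    have "Q n \<omega> = (a n \<omega>)\<^sup>2 / real n *
        (\<Sum>t<(m - 1) * n. if t < t0 n then 0 else if t < tau d n \<omega> then info_term \<theta> t \<omega> else 0)"
      unfolding Q_def sum_distrib_left by (intro sum.cong) (auto simp: H_def power_divide)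
    then show "Q n \<omega> = (a n \<omega>)\<^sup>2 * (mean_info \<theta> n \<omega> - PV n \<omega> / real n)"
      unfolding split by (simp add: PV_def mean_info_def info_eq[OF w] diff_divide_distrib right_diff_distrib)
  qed
  have P_bound: "\<bar>P n \<omega>\<bar> \<le> real (t0 n) * slope_bound" if "\<omega> \<in> space M" for n \<omega>
    unfolding P_def
    using sum_bounded_above[of "{..<t0 n}" "\<lambda>t. \<bar>if t < tau d n \<omega> then score_term \<theta> t \<omega> else 0\<bar>" slope_bound]
      score_term_bound[OF that, of \<theta>] slope_bound(1)
    by (intro order_trans[OF sum_abs]) auto
  have PV_bound: "\<bar>PV n \<omega>\<bar> \<le> real (t0 n) * slope_bound\<^sup>2" if "\<omega> \<in> space M" for n \<omega>
    unfolding PV_def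
    using sum_bounded_above[of "{..<t0 n}" "\<lambda>t. \<bar>if t < tau d n \<omega> then info_term \<theta> t \<omega> else 0\<bar>" "slope_bound\<^sup>2"]
      info_term_bounds[OF that, of \<theta>]
    by (intro order_trans[OF sum_abs]) auto
  \<comment> \<open>The dropped part of the score has at most \<open>t0 n\<close> bounded terms;
    after normalization it is of order \<open>n powr (- 1 / 4)\<close>.\<close>
  define r where "r n = real (t0 n) / sqrt (real n)" for n
  have r0: "r \<longlonglongrightarrow> 0"
  proof (rule Lim_null_comparison)
    show "\<forall>\<^sub>F n in sequentially. norm (r n) \<le> real (m - 1) * (real n powr (1 / 4) / sqrt (real n))"
      using eventually_ge_at_top[of 1]
    proof eventually_elim
      case (elim n)
      then show ?case using N(3)[OF elim]
        by (auto simp: r_def t0_def intro!: divide_right_mono mult_left_mono)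
    qed
    show "(\<lambda>n. real (m - 1) * (real n powr (1 / 4) / sqrt (real n))) \<longlonglongrightarrow> 0"
      by (intro tendsto_mult_right_zero) real_asymp
  qed
  have r1: "(\<lambda>n. real (t0 n) / real n) \<longlonglongrightarrow> 0"
  proof (rule Lim_null_comparison[OF _ r0])
    show "\<forall>\<^sub>F n in sequentially. norm (real (t0 n) / real n) \<le> r n"
      using eventually_ge_at_top[of 1]
    proof eventually_elim
      case (elim n)
      then have "sqrt (real n) \<le> real n" by (simp add: real_sqrt_le_iff' sqrt_le_D real_le_lsqrt power2_eq_square)
      then show ?case using elim by (auto simp: r_def intro!: divide_left_mono)
    qed
  qed
  \<comment> \<open>Both the current and the early average are close to the same random limit, which
    cancels in the difference.\<close>
  have lam_lim: "((\<lambda>(n, \<omega>). mean_info \<theta> n \<omega> - lam n \<omega>) \<longlongrightarrow> 0) (in_prob M)"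
  proof -
    have "((\<lambda>p. (case (N (fst p), snd p) of (n, \<omega>) \<Rightarrow> mean_info \<theta> n \<omega> - L \<omega>)) \<longlongrightarrow> 0) (in_prob M)"
      unfolding N_def
      by (rule filterlim_compose[OF L filterlim_subsequence_in_prob[OF filterlim_fourth_root_floor]])
    from tendsto_diff[OF L this] show ?thesis by (simp add: lam_def case_prod_beta')
  qed
  \<comment> \<open>Up to the dropped initial part, \<open>Q n\<close> is \<open>u\<^sup>2\<close>
    times the ratio of current to early mean information.\<close>
  have Q_lim: "((\<lambda>(n, \<omega>). Q n \<omega> - u\<^sup>2) \<longlongrightarrow> 0) (in_prob M)"
  proof (rule Lim_null_comparison)
    show "\<forall>\<^sub>F p in in_prob M. norm (case p of (n, \<omega>) \<Rightarrow> Q n \<omega> - u\<^sup>2) \<le>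
       u\<^sup>2 / info_floor * (\<bar>case p of (n, \<omega>) \<Rightarrow> mean_info \<theta> n \<omega> - lam n \<omega>\<bar> +
          real (t0 (fst p)) / real (fst p) * slope_bound\<^sup>2)"
    proof (rule eventually_in_probI'[of 1])
      fix n :: nat and \<omega> assume n: "1 \<le> n" and w: "\<omega> \<in> space M"
      have l: "info_floor \<le> lam n \<omega>" "0 < lam n \<omega>" using lam(1)[OF w n] c by auto
      have "Q n \<omega> - u\<^sup>2 = u\<^sup>2 / lam n \<omega> * ((mean_info \<theta> n \<omega> - lam n \<omega>) - PV n \<omega> / real n)"
        using l unfolding Q_eq[OF w n] a_def by (simp add: power_divide field_simps)
      also have "\<bar>\<dots>\<bar> \<le> u\<^sup>2 / info_floor * (\<bar>mean_info \<theta> n \<omega> - lam n \<omega>\<bar> + real (t0 n) / real n * slope_bound\<^sup>2)"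
        unfolding abs_mult
      proof (rule mult_mono)
        show "\<bar>u\<^sup>2 / lam n \<omega>\<bar> \<le> u\<^sup>2 / info_floor" using l c by (auto intro!: divide_left_mono)
        have "\<bar>PV n \<omega> / real n\<bar> \<le> real (t0 n) / real n * slope_bound\<^sup>2"
          using divide_right_mono[OF PV_bound[OF w, of n], of "real n"] by (simp add: abs_divide)
        then show "\<bar>mean_info \<theta> n \<omega> - lam n \<omega> - PV n \<omega> / real n\<bar> \<le>
           \<bar>mean_info \<theta> n \<omega> - lam n \<omega>\<bar> + real (t0 n) / real n * slope_bound\<^sup>2"
          by linarith
      qed (use c in auto)
      finally show "norm (case (n, \<omega>) of (n, \<omega>) \<Rightarrow> Q n \<omega> - u\<^sup>2) \<le>
         u\<^sup>2 / info_floor * (\<bar>case (n, \<omega>) of (n, \<omega>) \<Rightarrow> mean_info \<theta> n \<omega> - lam n \<omega>\<bar> +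
          real (t0 (fst (n, \<omega>))) / real (fst (n, \<omega>)) * slope_bound\<^sup>2)" by simp
    qed
    show "((\<lambda>p. u\<^sup>2 / info_floor * (\<bar>case p of (n, \<omega>) \<Rightarrow> mean_info \<theta> n \<omega> - lam n \<omega>\<bar> +
          real (t0 (fst p)) / real (fst p) * slope_bound\<^sup>2)) \<longlongrightarrow> 0) (in_prob M)"
      by (intro tendsto_mult_right_zero tendsto_add_zero tendsto_rabs_zero lam_lim
          tendsto_mult_left_zero tendsto_in_probI[OF r1])
  qed
  have S_lim: "((\<lambda>(n, \<omega>). S n \<omega> - u * ?W n \<omega>) \<longlongrightarrow> 0) (in_prob M)"
  proof -
    \<comment> \<open>The mean information has no constant limit in general, so uniform continuity
      on its range is used; the positive lower end \<open>info_floor\<close> avoids the singularity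
      at 0.\<close>
    have cont: "continuous_on {info_floor..info_ceil} (\<lambda>x. u / sqrt x)"
      using c by (intro continuous_intros) auto
    have "((\<lambda>p. u / sqrt (lam (fst p) (snd p)) - u / sqrt (mean_info \<theta> (fst p) (snd p))) \<longlongrightarrow> 0) (in_prob M)"
    proof (rule tendsto_uniformly_continuous_diff[OF _ cont])
      show "\<forall>\<^sub>F p in in_prob M. lam (fst p) (snd p) \<in> {info_floor..info_ceil} \<and>
          mean_info \<theta> (fst p) (snd p) \<in> {info_floor..info_ceil}"
        using lam by (intro eventually_in_probI'[of 1]) auto
      show "((\<lambda>p. dist (lam (fst p) (snd p)) (mean_info \<theta> (fst p) (snd p))) \<longlongrightarrow> 0) (in_prob M)"
        using tendsto_rabs_zero[OF lam_lim] by (simp add: dist_real_def case_prod_beta' abs_minus_commute)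
    qed simp
    then have "((\<lambda>(n, \<omega>). a n \<omega> - u / sqrt (mean_info \<theta> n \<omega>)) \<longlongrightarrow> 0) (in_prob M)"
      by (simp add: a_def case_prod_beta')
    from norm_score_mult_tendsto[OF this]
    have 1: "((\<lambda>(n, \<omega>). norm_score n \<omega> * (a n \<omega> - u / sqrt (mean_info \<theta> n \<omega>))) \<longlongrightarrow> 0) (in_prob M)" .
    have 2: "((\<lambda>(n, \<omega>). a n \<omega> * (P n \<omega> / sqrt (real n))) \<longlongrightarrow> 0) (in_prob M)"
    proof (rule Lim_null_comparison)
      show "\<forall>\<^sub>F p in in_prob M. norm (case p of (n, \<omega>) \<Rightarrow> a n \<omega> * (P n \<omega> / sqrt (real n))) \<le>
          \<bar>u\<bar> / sqrt info_floor * (r (fst p) * slope_bound)"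
      proof (rule eventually_in_probI'[of 1])
        fix n :: nat and \<omega> assume n: "1 \<le> n" and w: "\<omega> \<in> space M"
        have "\<bar>P n \<omega> / sqrt (real n)\<bar> \<le> r n * slope_bound"
          using divide_right_mono[OF P_bound[OF w, of n], of "sqrt (real n)"] by (simp add: abs_divide r_def)
        then have "\<bar>a n \<omega>\<bar> * \<bar>P n \<omega> / sqrt (real n)\<bar> \<le> \<bar>u\<bar> / sqrt info_floor * (r n * slope_bound)"
          using a_bound[OF w n] c by (intro mult_mono) auto
        then show "norm (case (n, \<omega>) of (n, \<omega>) \<Rightarrow> a n \<omega> * (P n \<omega> / sqrt (real n))) \<le>
          \<bar>u\<bar> / sqrt info_floor * (r (fst (n, \<omega>)) * slope_bound)" by (simp add: abs_mult)
      qed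
      show "((\<lambda>p. \<bar>u\<bar> / sqrt info_floor * (r (fst p) * slope_bound)) \<longlongrightarrow> 0) (in_prob M)"
        by (intro tendsto_mult_right_zero tendsto_mult_left_zero tendsto_in_probI[OF r0])
    qed
    have "((\<lambda>p. (case p of (n, \<omega>) \<Rightarrow> norm_score n \<omega> * (a n \<omega> - u / sqrt (mean_info \<theta> n \<omega>))) -
        (case p of (n, \<omega>) \<Rightarrow> a n \<omega> * (P n \<omega> / sqrt (real n)))) \<longlongrightarrow> 0) (in_prob M)"
      using tendsto_diff[OF 1 2] by simp
    then show ?thesis
    proof (rule Lim_transform_eventually)
      show "\<forall>\<^sub>F p in in_prob M. (case p of (n, \<omega>) \<Rightarrow> norm_score n \<omega> * (a n \<omega> - u / sqrt (mean_info \<theta> n \<omega>))) -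
        (case p of (n, \<omega>) \<Rightarrow> a n \<omega> * (P n \<omega> / sqrt (real n))) = (case p of (n, \<omega>) \<Rightarrow> S n \<omega> - u * ?W n \<omega>)"
        by (rule eventually_in_probI'[of 1]) (simp add: S_eq algebra_simps)
    qed
  qed
  define Z where "Z n \<omega> = exp (Complex (Q n \<omega> / 2) (S n \<omega>))" for n \<omega>
  have Z_lim: "(\<lambda>n. \<integral>\<omega>. Z n \<omega> \<partial>M) \<longlonglongrightarrow> 1"
  proof -
    have "(\<lambda>n. norm ((\<integral>\<omega>. Z n \<omega> \<partial>M) - 1)) \<longlonglongrightarrow> 0"
    proof (rule Lim_null_comparison)
      have "(\<lambda>n. \<kappa> / sqrt (real n)) \<longlonglongrightarrow> 0" by real_asymp
      then have "\<forall>\<^sub>F n in sequentially. \<kappa> / sqrt (real n) < 1" by (rule order_tendstoD) simp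
      with eventually_ge_at_top[of 1]
      show "\<forall>\<^sub>F n in sequentially. norm (norm ((\<integral>\<omega>. Z n \<omega> \<partial>M) - 1)) \<le>
          real (m - 1) * 4 * \<kappa> ^ 3 * exp (real (m - 1) * \<kappa>\<^sup>2 / 2) * (1 / sqrt (real n))"
      proof eventually_elim
        case (elim n)
        then have n: "1 \<le> n" and le: "h n * slope_bound \<le> 1" by (auto simp: hK)
        \<comment> \<open>The number of steps is of order \<open>n\<close> and cancels one factor of
          the cubic error, which leaves \<open>1 / sqrt n\<close>.\<close>
        have p: "(\<kappa> / sqrt (real n)) ^ 3 = \<kappa> ^ 3 / (real n * sqrt (real n))"
          by (simp add: power_divide power3_eq_cube)
        have "norm ((\<integral>\<omega>. Z n \<omega> \<partial>M) - 1) \<le> real ((m - 1) * n) *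
          (4 * (h n * slope_bound) ^ 3 * exp (real ((m - 1) * n) * (h n * slope_bound)\<^sup>2 / 2))"
          unfolding Z_def Q_def S_def
          by (rule martingale.compensated_exponential[OF H_hist[OF n] H_bound[OF _ n] le])
        also have "\<dots> = real (m - 1) * 4 * \<kappa> ^ 3 * exp (real (m - 1) * \<kappa>\<^sup>2 / 2) * (1 / sqrt (real n))"
          unfolding hK p using n by (simp add: power_divide)
        finally show ?case by simp
      qed
      show "(\<lambda>n. real (m - 1) * 4 * \<kappa> ^ 3 * exp (real (m - 1) * \<kappa>\<^sup>2 / 2) * (1 / sqrt (real n))) \<longlonglongrightarrow> 0"
        by (rule tendsto_mult_right_zero) real_asymp
    qed
    then show ?thesis by (simp add: tendsto_norm_zero_iff LIM_zero_iff)
  qed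
  have S_meas: "S n \<in> borel_measurable M" and Q_meas: "Q n \<in> borel_measurable M" if "1 \<le> n" for n
    using martingale.partial_sum_measurable[of "H n" "(m - 1) * n", OF H_hist[OF that]]
    unfolding S_def[abs_def] Q_def[abs_def] by (auto intro: measurable_hist)
  have Z_meas: "Z n \<in> borel_measurable M" if "1 \<le> n" for n
    unfolding Z_def[abs_def] Complex_eq using S_meas[OF that] Q_meas[OF that]
    by (intro borel_measurable_continuous_on[where f = exp] continuous_intros; measurable)
  have W_meas: "?W n \<in> borel_measurable M" if "1 \<le> n" for n
    using norm_score_measurable[OF that] mean_info_measurable[OF that] by measurable
  have Z_bound: "norm (Z n \<omega>) \<le> exp (real (m - 1) * \<kappa>\<^sup>2 / 2)" if w: "\<omega> \<in> space M" and n: "1 \<le> n" for n \<omega>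
  proof -
    have "Q n \<omega> \<le> real ((m - 1) * n) * (h n * slope_bound)\<^sup>2"
      unfolding Q_def by (rule martingale.abs_weighted_bounds(4)[OF H_bound[OF _ n] w])
    also have "\<dots> = real (m - 1) * \<kappa>\<^sup>2" unfolding hK using n by (simp add: power_divide)
    finally show ?thesis by (simp add: Z_def norm_exp_eq_Re)
  qed
  define E where "E = complex_of_real (exp (- u\<^sup>2 / 2))"
  have diff_lim: "((\<lambda>(n, \<omega>). iexp (u * ?W n \<omega>) - E * Z n \<omega>) \<longlongrightarrow> 0) (in_prob M)"
  proof (rule tendsto_norm_zero_cancel)
    \<comment> \<open>Both exponentials are compared after factoring out one of modulus one, so only
      \<open>Q n - u\<^sup>2\<close> and the difference of the phases remain.\<close>
    have eq: "norm (case p of (n, \<omega>) \<Rightarrow> iexp (u * ?W n \<omega>) - E * Z n \<omega>) =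
       norm (exp (complex_of_real ((case p of (n, \<omega>) \<Rightarrow> Q n \<omega> - u\<^sup>2) / 2) +
        \<i> * complex_of_real (case p of (n, \<omega>) \<Rightarrow> S n \<omega> - u * ?W n \<omega>)) - 1)" for p
    proof (cases p)
      case (Pair n \<omega>)
      let ?z = "complex_of_real ((Q n \<omega> - u\<^sup>2) / 2) + \<i> * complex_of_real (S n \<omega> - u * ?W n \<omega>)"
      have "E * Z n \<omega> = exp (- (complex_of_real u)\<^sup>2 / 2 + (complex_of_real (Q n \<omega>) / 2 + \<i> * S n \<omega>))"
        unfolding E_def Z_def Complex_eq exp_add by (simp add: exp_of_real[symmetric])
      also have "\<dots> = exp (\<i> * complex_of_real (u * ?W n \<omega>) + ?z)"
        by (rule arg_cong[where f = exp]) (simp add: diff_divide_distrib algebra_simps)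
      also have "\<dots> = iexp (u * ?W n \<omega>) * exp ?z" by (rule exp_add)
      finally have "iexp (u * ?W n \<omega>) - E * Z n \<omega> = iexp (u * ?W n \<omega>) * (1 - exp ?z)"
        by (simp only: right_diff_distrib mult_1_right)
      then show ?thesis unfolding Pair by (simp add: norm_mult norm_minus_commute)
    qed
    have "((\<lambda>p. exp (complex_of_real ((case p of (n, \<omega>) \<Rightarrow> Q n \<omega> - u\<^sup>2) / 2) +
        \<i> * complex_of_real (case p of (n, \<omega>) \<Rightarrow> S n \<omega> - u * ?W n \<omega>)) - 1) \<longlongrightarrow>
        exp (complex_of_real (0 / 2) + \<i> * complex_of_real 0) - 1) (in_prob M)"
      by (intro tendsto_intros Q_lim S_lim) simp
    then show "((\<lambda>p. norm (case p of (n, \<omega>) \<Rightarrow> iexp (u * ?W n \<omega>) - E * Z n \<omega>)) \<longlongrightarrow> 0) (in_prob M)"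
      unfolding eq by (intro tendsto_norm_zero) simp
  qed
  have "(\<lambda>n. \<integral>\<omega>. iexp (u * ?W n \<omega>) - E * Z n \<omega> \<partial>M) \<longlonglongrightarrow> 0"
  proof (rule tendsto_expectation_in_prob[OF _ _ diff_lim])
    fix n :: nat assume n: "1 \<le> n"
    show "(\<lambda>\<omega>. iexp (u * ?W n \<omega>) - E * Z n \<omega>) \<in> borel_measurable M"
      using W_meas[OF n] Z_meas[OF n] by measurable
    fix \<omega> assume w: "\<omega> \<in> space M"
    show "norm (iexp (u * ?W n \<omega>) - E * Z n \<omega>) \<le> 1 + norm E * exp (real (m - 1) * \<kappa>\<^sup>2 / 2)"
      using Z_bound[OF w n] by (intro order_trans[OF norm_triangle_ineq4] add_mono)
        (auto simp: norm_mult intro!: mult_left_mono)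
  qed
  from tendsto_add[OF this tendsto_mult_left[OF Z_lim, of E]]
  have "(\<lambda>n. (\<integral>\<omega>. iexp (u * ?W n \<omega>) - E * Z n \<omega> \<partial>M) + E * (\<integral>\<omega>. Z n \<omega> \<partial>M)) \<longlonglongrightarrow> E" by simp
  then show ?thesis
    unfolding E_def[symmetric]
  proof (rule Lim_transform_eventually)
    show "\<forall>\<^sub>F n in sequentially. (\<integral>\<omega>. iexp (u * ?W n \<omega>) - E * Z n \<omega> \<partial>M) + E * (\<integral>\<omega>. Z n \<omega> \<partial>M) =
        (\<integral>\<omega>. iexp (u * ?W n \<omega>) \<partial>M)"
      using eventually_ge_at_top[of 1]
    proof eventually_elim
      case (elim n)
      have "integrable M (Z n)"
        using Z_bound[OF _ elim] Z_meas[OF elim] by (intro integrable_const_bound[OF AE_I2]) auto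
      moreover have "integrable M (\<lambda>\<omega>. iexp (u * ?W n \<omega>))"
      proof (rule integrable_const_bound[where B = 1])
        show "(\<lambda>\<omega>. iexp (u * ?W n \<omega>)) \<in> borel_measurable M" using W_meas[OF elim] by measurable
      qed simp
      ultimately show ?case by simp
    qed
  qed
qed

end

section \<open>Asymptotic normality of the estimator\<close>

context cat_estimator
begin

section \<open>Consistency and linearization of the estimator\<close>

definition est :: "nat \<Rightarrow> 'w \<Rightarrow> real" where
  "est n \<omega> = \<theta>hat (tau d n \<omega>) \<omega>"

lemma \<theta>hat_measurable: "1 \<le> t \<Longrightarrow> \<theta>hat t \<in> borel_measurable M"
  by (rule measurable_hist[OF estimator_measurable])

lemma est_measurable:
  assumes "1 \<le> n"
  shows "est n \<in> borel_measurable M"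
proof -
  have "(\<lambda>\<omega>. \<theta>hat (max 1 (tau d n \<omega>)) \<omega>) \<in> borel_measurable M"
    by (rule measurable_compose_countable[OF \<theta>hat_measurable tau_measurable[OF assms]]) simp
  then show ?thesis
    by (rule measurable_cong[THEN iffD1, rotated])
      (simp add: est_def max_absorb2 tau_bounds(1)[OF _ assms] del: One_nat_def)
qed

lemma info_est_measurable:
  assumes "1 \<le> n"
  shows "(\<lambda>\<omega>. info b d X (tau d n \<omega>) (est n \<omega>) \<omega>) \<in> borel_measurable M"
  by (rule measurable_compose_countable[OF info_measurable[OF est_measurable[OF assms]] tau_measurable[OF assms]])

text \<open>The score at \<theta> divided by \<open>n\<close> vanishes in probability. Once it is
  small, \<open>score_root\<close> provides a root; the estimator must then be a root, and every
  root is close to \<theta>. The arbitrary initialization is thereby confined to events of vanishing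
  probability.\<close>

lemma est_eventually:
  assumes e: "0 < \<epsilon>" "\<epsilon> \<le> 1"
  shows "\<forall>\<^sub>F (n, \<omega>) in in_prob M. 1 \<le> n \<and> \<omega> \<in> space M \<and>
    score b d X (tau d n \<omega>) (est n \<omega>) \<omega> = 0 \<and> \<bar>est n \<omega> - \<theta>\<bar> < \<epsilon>"
proof -
  have "(\<lambda>n. 1 / sqrt (real n)) \<longlonglongrightarrow> 0" by real_asymp
  then have "((\<lambda>(n, \<omega>). 1 / sqrt (real n)) \<longlongrightarrow> 0) (in_prob M)"
    using tendsto_in_probI[of "\<lambda>n. 1 / sqrt (real n)" 0] by (simp add: case_prod_beta')
  from norm_score_mult_tendsto[OF this]
  have lim: "((\<lambda>(n, \<omega>). norm_score n \<omega> * (1 / sqrt (real n))) \<longlongrightarrow> 0) (in_prob M)" .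
  have "0 < \<epsilon> * info_floor" using e info_floor(1) by simp
  from tendstoD[OF lim this] eventually_space[of 1] show ?thesis
  proof eventually_elim
    case (elim p)
    obtain n \<omega> where p: "p = (n, \<omega>)" by (cases p)
    have n: "1 \<le> n" and w: "\<omega> \<in> space M" using elim(2) by (auto simp: p)
    have "\<bar>norm_score n \<omega>\<bar> / sqrt (real n) < \<epsilon> * info_floor"
      using elim(1) by (simp add: p abs_mult)
    moreover have "\<bar>norm_score n \<omega>\<bar> / sqrt (real n) = \<bar>score b d X (tau d n \<omega>) \<theta> \<omega>\<bar> / real n"
      by (simp add: norm_score_def abs_divide)
    ultimately have "\<bar>score b d X (tau d n \<omega>) \<theta> \<omega>\<bar> <
        \<epsilon> * (info_floor * real (num_items (\<lambda>u. d u \<omega>) (tau d n \<omega>)))"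
      using n unfolding tau_bounds(4)[OF w n] by (simp add: field_simps)
    from score_root[OF w e this] estimator_root[OF tau_bounds(1)[OF w n] w]
    show ?case using n w by (simp add: p est_def)
  qed
qed

text \<open>Stated for any random point at least as close to \<theta> as the estimator, to cover
  both the estimator and the intermediate point.\<close>

lemma mean_info_near_tendsto:
  assumes "\<forall>\<^sub>F (n, \<omega>) in in_prob M. \<bar>\<zeta> n \<omega> - \<theta>\<bar> \<le> \<bar>est n \<omega> - \<theta>\<bar>"
  shows "((\<lambda>(n, \<omega>). mean_info (\<zeta> n \<omega>) n \<omega> - mean_info \<theta> n \<omega>) \<longlongrightarrow> 0) (in_prob M)"
proof (rule tendstoI)
  fix e :: real assume e: "0 < e"
  \<comment> \<open>At most \<open>m * n\<close> terms each change by \<open>e'\<close>, so the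
    average over \<open>n\<close> items changes by at most \<open>e / 2\<close>.\<close>
  define e' where "e' = e / (2 * real m)"
  have e': "0 < e'" using e m_ge by (simp add: e'_def)
  obtain \<delta> where \<delta>: "0 < \<delta>" "\<And>\<omega> T \<xi>. \<omega> \<in> space M \<Longrightarrow> \<bar>\<xi> - \<theta>\<bar> < \<delta> \<Longrightarrow>
    \<bar>info b d X T \<xi> \<omega> - info b d X T \<theta> \<omega>\<bar> \<le> real T * e'"
    using info_equicontinuous[OF e'] by blast
  have "0 < min 1 \<delta>" "min 1 \<delta> \<le> 1" using \<delta>(1) by auto
  from est_eventually[OF this] assms
  show "\<forall>\<^sub>F p in in_prob M. dist (case p of (n, \<omega>) \<Rightarrow> mean_info (\<zeta> n \<omega>) n \<omega> - mean_info \<theta> n \<omega>) 0 < e"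
  proof eventually_elim
    case (elim p)
    obtain n \<omega> where p: "p = (n, \<omega>)" by (cases p)
    have n: "1 \<le> n" and w: "\<omega> \<in> space M" and z: "\<bar>\<zeta> n \<omega> - \<theta>\<bar> < \<delta>" using elim by (auto simp: p)
    have t: "real (tau d n \<omega>) \<le> real m * real n"
    proof -
      have "tau d n \<omega> \<le> m * n" by (rule order_trans[OF tau_bounds(3)[OF w n]]) simp
      then show ?thesis by (metis of_nat_le_iff of_nat_mult)
    qed
    have "\<bar>info b d X (tau d n \<omega>) (\<zeta> n \<omega>) \<omega> - info b d X (tau d n \<omega>) \<theta> \<omega>\<bar> \<le> real (tau d n \<omega>) * e'"
      by (rule \<delta>(2)[OF w z])
    also have "\<dots> \<le> real m * real n * e'" using t e' by (intro mult_right_mono) auto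
    also have "\<dots> = real n * (e / 2)" using m_ge by (simp add: e'_def)
    finally have "\<bar>info b d X (tau d n \<omega>) (\<zeta> n \<omega>) \<omega> - info b d X (tau d n \<omega>) \<theta> \<omega>\<bar> / real n \<le> e / 2"
      using n by (simp add: field_simps)
    moreover have "\<bar>mean_info (\<zeta> n \<omega>) n \<omega> - mean_info \<theta> n \<omega>\<bar> =
        \<bar>info b d X (tau d n \<omega>) (\<zeta> n \<omega>) \<omega> - info b d X (tau d n \<omega>) \<theta> \<omega>\<bar> / real n"
      unfolding mean_info_def diff_divide_distrib[symmetric] by (simp add: abs_divide)
    ultimately have "\<bar>mean_info (\<zeta> n \<omega>) n \<omega> - mean_info \<theta> n \<omega>\<bar> < e" using e by linarith
    then show ?case by (simp add: p dist_real_def)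
  qed
qed

text \<open>The choice is made separately for each \<omega>, so this point need not be measurable.
  It enters only through statements along \<open>in_prob\<close>.\<close>

definition mvt_point :: "nat \<Rightarrow> 'w \<Rightarrow> real" where
  "mvt_point n \<omega> = (SOME z. \<bar>z - \<theta>\<bar> \<le> \<bar>est n \<omega> - \<theta>\<bar> \<and>
    score b d X (tau d n \<omega>) (est n \<omega>) \<omega> - score b d X (tau d n \<omega>) \<theta> \<omega> =
      - (est n \<omega> - \<theta>) * info b d X (tau d n \<omega>) z \<omega>)"

lemma mvt_point:
  assumes "\<omega> \<in> space M"
  shows "\<bar>mvt_point n \<omega> - \<theta>\<bar> \<le> \<bar>est n \<omega> - \<theta>\<bar>"
    "score b d X (tau d n \<omega>) (est n \<omega>) \<omega> - score b d X (tau d n \<omega>) \<theta> \<omega> =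
      - (est n \<omega> - \<theta>) * info b d X (tau d n \<omega>) (mvt_point n \<omega>) \<omega>"
proof -
  have "\<exists>z. \<bar>z - \<theta>\<bar> \<le> \<bar>est n \<omega> - \<theta>\<bar> \<and>
    score b d X (tau d n \<omega>) (est n \<omega>) \<omega> - score b d X (tau d n \<omega>) \<theta> \<omega> =
      - (est n \<omega> - \<theta>) * info b d X (tau d n \<omega>) z \<omega>"
    using score_mvt[OF assms, of "est n \<omega>" "tau d n \<omega>"] by metis
  from someI_ex[OF this] show "\<bar>mvt_point n \<omega> - \<theta>\<bar> \<le> \<bar>est n \<omega> - \<theta>\<bar>"
    "score b d X (tau d n \<omega>) (est n \<omega>) \<omega> - score b d X (tau d n \<omega>) \<theta> \<omega> =
      - (est n \<omega> - \<theta>) * info b d X (tau d n \<omega>) (mvt_point n \<omega>) \<omega>"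
    by (auto simp: mvt_point_def)
qed

lemma mean_info_mvt_tendsto:
  "((\<lambda>(n, \<omega>). mean_info (mvt_point n \<omega>) n \<omega> - mean_info \<theta> n \<omega>) \<longlongrightarrow> 0) (in_prob M)"
  by (intro mean_info_near_tendsto eventually_in_probI'[of 0]) (simp add: mvt_point)

lemma mean_info_est_tendsto:
  "((\<lambda>(n, \<omega>). mean_info (est n \<omega>) n \<omega> - mean_info \<theta> n \<omega>) \<longlongrightarrow> 0) (in_prob M)"
  by (intro mean_info_near_tendsto eventually_in_probI'[of 0]) simp

text \<open>At a root the mean value theorem reads \<open>score = (est - \<theta>) * info\<close>
  with the information at the intermediate point. The common interval bounds allow division and
  uniform continuity afterwards.\<close>

lemma expansion_eventually:
  "\<forall>\<^sub>F (n, \<omega>) in in_prob M. 1 \<le> n \<and> \<omega> \<in> space M \<and>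
    mean_info (mvt_point n \<omega>) n \<omega> \<in> {info_floor..info_ceil} \<and>
    mean_info (est n \<omega>) n \<omega> \<in> {info_floor..info_ceil} \<and>
    mean_info \<theta> n \<omega> \<in> {info_floor..info_ceil} \<and>
    sqrt (real n) * (est n \<omega> - \<theta>) = norm_score n \<omega> / mean_info (mvt_point n \<omega>) n \<omega>"
  using est_eventually[of 1, simplified]
proof eventually_elim
  case (elim p)
  obtain n \<omega> where p: "p = (n, \<omega>)" by (cases p)
  have n: "1 \<le> n" and w: "\<omega> \<in> space M" and root: "score b d X (tau d n \<omega>) (est n \<omega>) \<omega> = 0"
    and near: "\<bar>est n \<omega> - \<theta>\<bar> \<le> 1" using elim by (auto simp: p)
  have z: "\<bar>mvt_point n \<omega> - \<theta>\<bar> \<le> 1" using mvt_point(1)[OF w, of n] near by simp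
  note mz = mean_info_bounds[OF w n z]
  then have pos: "0 < mean_info (mvt_point n \<omega>) n \<omega>" using info_floor(1) by simp
  have "score b d X (tau d n \<omega>) \<theta> \<omega> = (est n \<omega> - \<theta>) * (mean_info (mvt_point n \<omega>) n \<omega> * real n)"
    using mvt_point(2)[OF w, of n] root n by (simp add: mean_info_def algebra_simps)
  then have "norm_score n \<omega> = (est n \<omega> - \<theta>) * mean_info (mvt_point n \<omega>) n \<omega> * (real n / sqrt (real n))"
    by (simp add: norm_score_def)
  also have "real n / sqrt (real n) = sqrt (real n)" by (simp add: real_div_sqrt)
  finally have "sqrt (real n) * (est n \<omega> - \<theta>) = norm_score n \<omega> / mean_info (mvt_point n \<omega>) n \<omega>"
    using pos by (simp add: field_simps)
  then show ?case
    using n w mz mean_info_bounds[OF w n near] mean_info_bounds[OF w n, of \<theta>] by (simp add: p)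
qed

section \<open>The two normal limits\<close>

text \<open>By the expansion the statistic is \<open>norm_score\<close> times
  \<open>sqrt x / y\<close>, with \<open>x\<close> and \<open>y\<close> the mean information at the
  estimator and at the intermediate point. Both may be replaced by the value at \<theta>, where the
  factor becomes \<open>1 / sqrt (mean_info \<theta> n \<omega>)\<close>.\<close>

lemma studentized_clt:
  assumes L: "((\<lambda>(n, \<omega>). mean_info \<theta> n \<omega> - L \<omega>) \<longlongrightarrow> 0) (in_prob M)"
  shows "weak_conv_m
    (\<lambda>n. distr M borel (\<lambda>\<omega>. sqrt (info b d X (tau d n \<omega>) (est n \<omega>) \<omega>) * (est n \<omega> - \<theta>)))
    std_normal_distribution"
proof (rule weak_conv_normal[where W = "\<lambda>n \<omega>. norm_score n \<omega> / sqrt (mean_info \<theta> n \<omega>)"])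
  let ?\<phi> = "\<lambda>q. sqrt (fst q) / snd q :: real"
  let ?f = "\<lambda>p. (mean_info (est (fst p) (snd p)) (fst p) (snd p), mean_info (mvt_point (fst p) (snd p)) (fst p) (snd p))"
  let ?g = "\<lambda>p. (mean_info \<theta> (fst p) (snd p), mean_info \<theta> (fst p) (snd p))"
  let ?I = "{info_floor..info_ceil}"
  have "((\<lambda>p. ?\<phi> (?f p) - ?\<phi> (?g p)) \<longlongrightarrow> 0) (in_prob M)"
  proof (rule tendsto_uniformly_continuous_diff[where S = "?I \<times> ?I" and \<phi> = ?\<phi> and f = ?f and g = ?g])
    show "compact (?I \<times> ?I)" by (intro compact_Times) auto
    show "continuous_on (?I \<times> ?I) ?\<phi>" using info_floor(1) by (auto intro!: continuous_intros)
    show "\<forall>\<^sub>F p in in_prob M. ?f p \<in> ?I \<times> ?I \<and> ?g p \<in> ?I \<times> ?I"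
      using expansion_eventually by eventually_elim auto
    have "((\<lambda>p. sqrt ((case p of (n, \<omega>) \<Rightarrow> mean_info (est n \<omega>) n \<omega> - mean_info \<theta> n \<omega>)\<^sup>2 +
        (case p of (n, \<omega>) \<Rightarrow> mean_info (mvt_point n \<omega>) n \<omega> - mean_info \<theta> n \<omega>)\<^sup>2)) \<longlongrightarrow> sqrt (0\<^sup>2 + 0\<^sup>2)) (in_prob M)"
      by (intro tendsto_intros mean_info_est_tendsto mean_info_mvt_tendsto)
    then show "((\<lambda>p. dist (?f p) (?g p)) \<longlongrightarrow> 0) (in_prob M)"
      by (simp add: dist_Pair_Pair dist_real_def case_prod_beta')
  qed
  then have "((\<lambda>(n, \<omega>). sqrt (mean_info (est n \<omega>) n \<omega>) / mean_info (mvt_point n \<omega>) n \<omega>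
      - sqrt (mean_info \<theta> n \<omega>) / mean_info \<theta> n \<omega>) \<longlongrightarrow> 0) (in_prob M)"
    by (simp add: case_prod_beta')
  from norm_score_mult_tendsto[OF this]
  show "((\<lambda>(n, \<omega>). sqrt (info b d X (tau d n \<omega>) (est n \<omega>) \<omega>) * (est n \<omega> - \<theta>) -
      1 * (norm_score n \<omega> / sqrt (mean_info \<theta> n \<omega>))) \<longlongrightarrow> 0) (in_prob M)"
  proof (rule Lim_transform_eventually)
    show "\<forall>\<^sub>F p in in_prob M. (case p of (n, \<omega>) \<Rightarrow> norm_score n \<omega> *
       (sqrt (mean_info (est n \<omega>) n \<omega>) / mean_info (mvt_point n \<omega>) n \<omega>
      - sqrt (mean_info \<theta> n \<omega>) / mean_info \<theta> n \<omega>)) =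
      (case p of (n, \<omega>) \<Rightarrow> sqrt (info b d X (tau d n \<omega>) (est n \<omega>) \<omega>) * (est n \<omega> - \<theta>) -
      1 * (norm_score n \<omega> / sqrt (mean_info \<theta> n \<omega>)))"
      using expansion_eventually
    proof eventually_elim
      case (elim p)
      obtain n \<omega> where p: "p = (n, \<omega>)" by (cases p)
      have n: "1 \<le> n" and th: "0 < mean_info \<theta> n \<omega>"
        and exp: "sqrt (real n) * (est n \<omega> - \<theta>) = norm_score n \<omega> / mean_info (mvt_point n \<omega>) n \<omega>"
        using elim info_floor(1) by (auto simp: p)
      have "info b d X (tau d n \<omega>) (est n \<omega>) \<omega> = mean_info (est n \<omega>) n \<omega> * real n"
        using n by (simp add: mean_info_def)
      then have A: "sqrt (info b d X (tau d n \<omega>) (est n \<omega>) \<omega>) * (est n \<omega> - \<theta>) =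
          sqrt (mean_info (est n \<omega>) n \<omega>) * (sqrt (real n) * (est n \<omega> - \<theta>))"
        by (simp add: real_sqrt_mult)
      have B: "sqrt (mean_info \<theta> n \<omega>) / mean_info \<theta> n \<omega> = 1 / sqrt (mean_info \<theta> n \<omega>)"
        using th by (simp add: real_sqrt_divide[symmetric] sqrt_divide_self_eq inverse_eq_divide)
      show ?case unfolding p prod.case A exp B by (simp add: right_diff_distrib)
    qed
  qed
qed (use clt[OF L] info_est_measurable est_measurable norm_score_measurable mean_info_measurable in \<open>auto\<close>)

text \<open>With a constant limit \<open>J\<close> the factor \<open>1 / mean_info\<close> at the
  intermediate point tends to \<open>1 / J\<close>, and so does \<open>sqrt (1 / J)\<close> times
  the factor that normalizes the score.\<close>

lemma scaled_clt:
  assumes J: "0 < J" and lim: "((\<lambda>(n, \<omega>). mean_info \<theta> n \<omega> - J) \<longlongrightarrow> 0) (in_prob M)"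
  shows "weak_conv_m (\<lambda>n. distr M borel (\<lambda>\<omega>. sqrt (real n) * (est n \<omega> - \<theta>)))
    (density lborel (normal_density 0 (sqrt (1 / J))))"
proof (rule weak_conv_normal[where W = "\<lambda>n \<omega>. norm_score n \<omega> / sqrt (mean_info \<theta> n \<omega>)"])
  have 1: "((\<lambda>p. mean_info \<theta> (fst p) (snd p)) \<longlongrightarrow> J) (in_prob M)"
    using lim by (simp add: LIM_zero_iff case_prod_beta')
  have 2: "((\<lambda>p. mean_info (mvt_point (fst p) (snd p)) (fst p) (snd p)) \<longlongrightarrow> J) (in_prob M)"
    using tendsto_add[OF mean_info_mvt_tendsto 1] by (simp add: case_prod_beta')
  have "((\<lambda>p. 1 / mean_info (mvt_point (fst p) (snd p)) (fst p) (snd p) -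
      sqrt (1 / J) / sqrt (mean_info \<theta> (fst p) (snd p))) \<longlongrightarrow> 1 / J - sqrt (1 / J) / sqrt J) (in_prob M)"
    using J by (intro tendsto_intros 1 2) auto
  then have "((\<lambda>(n, \<omega>). 1 / mean_info (mvt_point n \<omega>) n \<omega> - sqrt (1 / J) / sqrt (mean_info \<theta> n \<omega>)) \<longlongrightarrow> 0) (in_prob M)"
    using J by (simp add: case_prod_beta' real_sqrt_divide)
  from norm_score_mult_tendsto[OF this]
  show "((\<lambda>(n, \<omega>). sqrt (real n) * (est n \<omega> - \<theta>) -
      sqrt (1 / J) * (norm_score n \<omega> / sqrt (mean_info \<theta> n \<omega>))) \<longlongrightarrow> 0) (in_prob M)"
  proof (rule Lim_transform_eventually)
    show "\<forall>\<^sub>F p in in_prob M. (case p of (n, \<omega>) \<Rightarrow> norm_score n \<omega> *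
       (1 / mean_info (mvt_point n \<omega>) n \<omega> - sqrt (1 / J) / sqrt (mean_info \<theta> n \<omega>))) =
      (case p of (n, \<omega>) \<Rightarrow> sqrt (real n) * (est n \<omega> - \<theta>) -
      sqrt (1 / J) * (norm_score n \<omega> / sqrt (mean_info \<theta> n \<omega>)))"
      using expansion_eventually
    proof eventually_elim
      case (elim p)
      obtain n \<omega> where p: "p = (n, \<omega>)" by (cases p)
      have exp: "sqrt (real n) * (est n \<omega> - \<theta>) = norm_score n \<omega> / mean_info (mvt_point n \<omega>) n \<omega>"
        using elim by (auto simp: p)
      show ?case unfolding p prod.case exp by (simp add: right_diff_distrib)
    qed
  qed
qed (use J clt[OF lim] est_measurable norm_score_measurable mean_info_measurable in \<open>auto\<close>)

section \<open>Information-maximizing selection\<close>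

text \<open>The chosen item is optimal at the estimator. Passing from \<theta> to the estimator and
  back changes the information of any item by less than \<open>e / 3\<close> each time, so the loss
  at \<theta> is at most \<open>2 * (e / 3)\<close>.\<close>

lemma selected_info_tendsto:
  assumes sel: "\<forall>i\<ge>1. \<forall>\<omega>\<in>space M. is_arg_max (\<lambda>v. nrm_J (est i \<omega>) v []) (\<lambda>v. v \<in> B) (b (Suc i) \<omega>)"
  shows "((\<lambda>(i, \<omega>). nrm_J \<theta> (b (Suc i) \<omega>) [] - max_info) \<longlongrightarrow> 0) (in_prob M)"
proof (rule tendstoI)
  fix e :: real assume e: "0 < e"
  then have "0 < e / 3" by simp
  from nrm_J_equicontinuous[OF B_compact this, of \<theta>] obtain \<delta> where d: "0 < \<delta>"
    "\<And>v x \<xi>. v \<in> B \<Longrightarrow> \<bar>\<xi> - \<theta>\<bar> < \<delta> \<Longrightarrow> \<bar>nrm_J \<xi> v x - nrm_J \<theta> v x\<bar> < e / 3" by blast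
  have "0 < min 1 \<delta>" "min 1 \<delta> \<le> 1" using d(1) by auto
  from est_eventually[OF this]
  show "\<forall>\<^sub>F p in in_prob M. dist (case p of (i, \<omega>) \<Rightarrow> nrm_J \<theta> (b (Suc i) \<omega>) [] - max_info) 0 < e"
  proof eventually_elim
    case (elim p)
    obtain i \<omega> where p: "p = (i, \<omega>)" by (cases p)
    have i: "1 \<le> i" and w: "\<omega> \<in> space M" and near: "\<bar>est i \<omega> - \<theta>\<bar> < \<delta>" using elim by (auto simp: p)
    have sel': "b (Suc i) \<omega> \<in> B" "\<And>v. v \<in> B \<Longrightarrow> nrm_J (est i \<omega>) v [] \<le> nrm_J (est i \<omega>) (b (Suc i) \<omega>) []"
      using sel i w unfolding is_arg_max_def by (auto simp: not_less)
    have "max_info \<le> nrm_J \<theta> (b (Suc i) \<omega>) [] + 2 * (e / 3)"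
    proof (rule max_info_leI)
      fix v assume v: "v \<in> B"
      show "nrm_J \<theta> v [] \<le> nrm_J \<theta> (b (Suc i) \<omega>) [] + 2 * (e / 3)"
        using d(2)[OF v near, of "[]"] d(2)[OF sel'(1) near, of "[]"] sel'(2)[OF v] by linarith
    qed
    moreover have "nrm_J \<theta> (b (Suc i) \<omega>) [] \<le> max_info" by (rule nrm_J_le_max_info[OF sel'(1)])
    ultimately have "\<bar>nrm_J \<theta> (b (Suc i) \<omega>) [] - max_info\<bar> < e" using e by linarith
    then show ?case by (simp add: p dist_real_def)
  qed
qed

text \<open>Convergence in probability does not pass to averages in general. The deficits are
  bounded, so they converge in mean; averaging is harmless there, and Markov's inequality leads
  back. Revisions add at most a constant times their proportion.\<close>

lemma mean_info_tendsto_max_info: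
  assumes sel: "\<forall>i\<ge>1. \<forall>\<omega>\<in>space M. is_arg_max (\<lambda>v. nrm_J (est i \<omega>) v []) (\<lambda>v. v \<in> B) (b (Suc i) \<omega>)"
    and rev: "tendsto_in_prob M (\<lambda>n \<omega>. (real (tau d n \<omega>) - real n) / real n) (\<lambda>_. 0)"
  shows "((\<lambda>(n, \<omega>). mean_info \<theta> n \<omega> - max_info) \<longlongrightarrow> 0) (in_prob M)"
proof -
  define g where "g i \<omega> = nrm_J \<theta> (b (Suc i) \<omega>) [] - max_info" for i \<omega>
  have g_meas: "g i \<in> borel_measurable M" for i
    unfolding g_def[abs_def]
    by (intro borel_measurable_diff borel_measurable_const measurable_compose[OF item_measurable borel_measurable_nrm(2)]) simp
  have g_bound: "\<bar>g i \<omega>\<bar> \<le> max_info" if "\<omega> \<in> space M" for i \<omega>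
  proof -
    have "b (Suc i) \<omega> \<in> B" using that by (intro b_range) auto
    then show ?thesis
      using nrm_J_le_max_info[of "b (Suc i) \<omega>"] nrm_J_nonneg[of \<theta> "b (Suc i) \<omega>" "[]"] by (simp add: g_def)
  qed
  have g_int: "integrable M (g i)" for i
    using g_bound g_meas by (intro integrable_const_bound[where B = max_info] AE_I2) auto
  have "((\<lambda>(n, \<omega>). \<bar>g n \<omega>\<bar>) \<longlongrightarrow> 0) (in_prob M)"
    using tendsto_rabs_zero[OF selected_info_tendsto[OF sel]] by (simp add: g_def case_prod_beta')
  then have "(\<lambda>n. \<integral>\<omega>. \<bar>g n \<omega>\<bar> \<partial>M) \<longlonglongrightarrow> 0"
    using g_meas g_bound by (intro tendsto_expectation_in_prob[where N = 0 and C = max_info]) auto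
  from cesaro_null[OF this]
  have ces: "(\<lambda>n. (\<Sum>i<n. \<integral>\<omega>. \<bar>g i \<omega>\<bar> \<partial>M) / real n) \<longlonglongrightarrow> 0" .
  have avg_int: "integrable M (\<lambda>\<omega>. (\<Sum>i<n. g i \<omega>) / real n)" for n
    using g_int by simp
  have avg: "((\<lambda>(n, \<omega>). (\<Sum>i<n. g i \<omega>) / real n) \<longlongrightarrow> 0) (in_prob M)"
  proof (rule tendsto_in_prob_L1)
    show "(\<lambda>n. \<integral>\<omega>. \<bar>(\<Sum>i<n. g i \<omega>) / real n\<bar> \<partial>M) \<longlonglongrightarrow> 0"
    proof (rule Lim_null_comparison[OF always_eventually ces], rule allI)
      fix n
      have "(\<integral>\<omega>. \<bar>(\<Sum>i<n. g i \<omega>) / real n\<bar> \<partial>M) \<le> (\<integral>\<omega>. (\<Sum>i<n. \<bar>g i \<omega>\<bar>) / real n \<partial>M)"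
        using avg_int g_int
        by (intro integral_mono integrable_abs integrable_divide Bochner_Integration.integrable_sum)
          (auto simp: abs_divide intro!: divide_right_mono)
      also have "\<dots> = (\<Sum>i<n. \<integral>\<omega>. \<bar>g i \<omega>\<bar> \<partial>M) / real n"
        using g_int by (simp add: Bochner_Integration.integral_sum)
      finally show "norm (\<integral>\<omega>. \<bar>(\<Sum>i<n. g i \<omega>) / real n\<bar> \<partial>M) \<le> (\<Sum>i<n. \<integral>\<omega>. \<bar>g i \<omega>\<bar> \<partial>M) / real n"
        by simp
    qed
  qed (rule avg_int)
  have rev': "((\<lambda>(n, \<omega>). (real (tau d n \<omega>) - real n) / real n) \<longlongrightarrow> 0) (in_prob M)"
  proof -
    have "(\<lambda>\<omega>. (real (tau d n \<omega>) - real n) / real n) \<in> borel_measurable M" if "1 \<le> n" for n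
      using measurable_compose[OF tau_measurable[OF that], of real borel] by simp
    then show ?thesis using rev by (subst (asm) tendsto_in_prob_iff) auto
  qed
  show ?thesis
  proof (rule Lim_null_comparison)
    show "\<forall>\<^sub>F p in in_prob M. norm (case p of (n, \<omega>) \<Rightarrow> mean_info \<theta> n \<omega> - max_info) \<le>
        \<bar>case p of (n, \<omega>) \<Rightarrow> (\<Sum>i<n. g i \<omega>) / real n\<bar> +
        slope_bound\<^sup>2 * (case p of (n, \<omega>) \<Rightarrow> (real (tau d n \<omega>) - real n) / real n)"
    proof (rule eventually_in_probI'[of 1])
      fix n :: nat and \<omega> assume n: "1 \<le> n" and w: "\<omega> \<in> space M"
      \<comment> \<open>The deficit \<open>g i\<close> belongs to item \<open>i + 1\<close>. Thus
        \<open>g 0\<close> is that of the prescribed first item, a single bounded term that the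
        average absorbs.\<close>
      have "(\<Sum>i = 1..n. nrm_J \<theta> (b i \<omega>) []) = (\<Sum>i<n. g i \<omega>) + real n * max_info"
        by (simp add: g_def sum.atLeast1_atMost_eq sum_subtractf)
      then have eq: "mean_info \<theta> n \<omega> - max_info =
          (\<Sum>i<n. g i \<omega>) / real n + info_rev b d X (tau d n \<omega>) \<theta> \<omega> / real n"
        using n unfolding mean_info_def info_def tau_bounds(4)[OF w n] by (simp add: field_simps)
      have "info_rev b d X (tau d n \<omega>) \<theta> \<omega> / real n \<le> slope_bound\<^sup>2 * ((real (tau d n \<omega>) - real n) / real n)"
        using divide_right_mono[OF info_rev_le[OF w, of "tau d n \<omega>"], of "real n"]
        unfolding tau_bounds(4)[OF w n] by simp
      moreover have "0 \<le> info_rev b d X (tau d n \<omega>) \<theta> \<omega> / real n"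
        using info_rev_nonneg by simp
      ultimately show "norm (case (n, \<omega>) of (n, \<omega>) \<Rightarrow> mean_info \<theta> n \<omega> - max_info) \<le>
        \<bar>case (n, \<omega>) of (n, \<omega>) \<Rightarrow> (\<Sum>i<n. g i \<omega>) / real n\<bar> +
        slope_bound\<^sup>2 * (case (n, \<omega>) of (n, \<omega>) \<Rightarrow> (real (tau d n \<omega>) - real n) / real n)"
        unfolding prod.case eq real_norm_def by linarith
    qed
    show "((\<lambda>p. \<bar>case p of (n, \<omega>) \<Rightarrow> (\<Sum>i<n. g i \<omega>) / real n\<bar> +
        slope_bound\<^sup>2 * (case p of (n, \<omega>) \<Rightarrow> (real (tau d n \<omega>) - real n) / real n)) \<longlongrightarrow> 0) (in_prob M)"
      by (intro tendsto_add_zero tendsto_rabs_zero tendsto_mult_right_zero avg rev')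
  qed
qed

end

theorem theorem4p2:
  fixes M :: "'w measure" and m :: nat and \<theta> :: real
    and B :: "('k::finite) item set"
    and b :: "nat \<Rightarrow> 'w \<Rightarrow> 'k item"
    and d :: "nat \<Rightarrow> 'w \<Rightarrow> nat"
    and X :: "nat \<Rightarrow> nat \<Rightarrow> 'w \<Rightarrow> 'k option"
    and \<theta>hat :: "nat \<Rightarrow> 'w \<Rightarrow> real"
  assumes "cat_estimator M m \<theta> B b d X \<theta>hat"
  shows
    "(converges_in_prob M (\<lambda>n \<omega>. info b d X (tau d n \<omega>) \<theta> \<omega> / real n) \<longrightarrow>
        weak_conv_m
          (\<lambda>n. distr M borel (\<lambda>\<omega>. sqrt (info b d X (tau d n \<omega>) (\<theta>hat (tau d n \<omega>) \<omega>) \<omega>) *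
                                  (\<theta>hat (tau d n \<omega>) \<omega> - \<theta>)))
          std_normal_distribution)
     \<and>
     ((\<forall>i\<ge>1. \<forall>\<omega>\<in>space M.
          is_arg_max (\<lambda>v. nrm_J (\<theta>hat (tau d i \<omega>) \<omega>) v []) (\<lambda>v. v \<in> B) (b (Suc i) \<omega>)) \<and>
      tendsto_in_prob M (\<lambda>n \<omega>. (real (tau d n \<omega>) - real n) / real n) (\<lambda>_. 0) \<longrightarrow>
        converges_in_prob M (\<lambda>n \<omega>. info b d X (tau d n \<omega>) \<theta> \<omega> / real n) \<and>
        weak_conv_m
          (\<lambda>n. distr M borel (\<lambda>\<omega>. sqrt (info b d X (tau d n \<omega>) (\<theta>hat (tau d n \<omega>) \<omega>) \<omega>) *
                                  (\<theta>hat (tau d n \<omega>) \<omega> - \<theta>)))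
          std_normal_distribution \<and>
        weak_conv_m
          (\<lambda>n. distr M borel (\<lambda>\<omega>. sqrt (real n) * (\<theta>hat (tau d n \<omega>) \<omega> - \<theta>)))
          (density lborel (normal_density 0 (sqrt (1 / (SUP v\<in>B. nrm_J \<theta> v []))))))"
proof -
  interpret cat_estimator M m \<theta> B b d X \<theta>hat by fact
  let ?A = "weak_conv_m
    (\<lambda>n. distr M borel (\<lambda>\<omega>. sqrt (info b d X (tau d n \<omega>) (est n \<omega>) \<omega>) * (est n \<omega> - \<theta>)))
    std_normal_distribution"
  let ?\<Lambda> = "\<lambda>n \<omega>. info b d X (tau d n \<omega>) \<theta> \<omega> / real n"
  have iff: "tendsto_in_prob M ?\<Lambda> L \<longleftrightarrow> ((\<lambda>(n, \<omega>). mean_info \<theta> n \<omega> - L \<omega>) \<longlongrightarrow> 0) (in_prob M)"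
    if "L \<in> borel_measurable M" for L
    unfolding mean_info_def by (rule tendsto_in_prob_iff[OF mean_info_measurable[unfolded mean_info_def[abs_def]] that])
  have 1: ?A if "converges_in_prob M ?\<Lambda>"
    using that iff studentized_clt unfolding converges_in_prob_def by blast
  have 2: "converges_in_prob M ?\<Lambda> \<and> ?A \<and>
      weak_conv_m (\<lambda>n. distr M borel (\<lambda>\<omega>. sqrt (real n) * (est n \<omega> - \<theta>)))
        (density lborel (normal_density 0 (sqrt (1 / max_info))))"
    if sel: "\<forall>i\<ge>1. \<forall>\<omega>\<in>space M. is_arg_max (\<lambda>v. nrm_J (est i \<omega>) v []) (\<lambda>v. v \<in> B) (b (Suc i) \<omega>)"
      and rev: "tendsto_in_prob M (\<lambda>n \<omega>. (real (tau d n \<omega>) - real n) / real n) (\<lambda>_. 0)"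
  proof -
    note lim = mean_info_tendsto_max_info[OF sel rev]
    \<comment> \<open>The limit is the constant \<open>max_info\<close>, so the first part applies
      to this strategy.\<close>
    have conv: "converges_in_prob M ?\<Lambda>"
      unfolding converges_in_prob_def
      by (rule bexI[where x = "\<lambda>_. max_info"]) (use iff[of "\<lambda>_. max_info"] lim in auto)
    show ?thesis
      using conv 1[OF conv] scaled_clt[OF max_info_pos lim] by blast
  qed
  show ?thesis
    using 1 2 unfolding est_def max_info_def by blast
qed

end
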